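(* Fix $0 < p \le r < 1$ and let $H$ be a fixed $d$-regular graph for some $d \ge 2$. Let $G_n \sim \mathcal{G}(n,p)$ be the Erdős–Rényi random graph on $n$ vertices with edge probability $p$. (i) If the point $(r^d, h_p(r))$ lies on the convex minorant of the function $x \mapsto h_p(x^{1/d})$, then $$\lim_{n\to\infty} \frac{1}{\binom n2} \log \mathbb{P}\left(t(H,G_n) \ge r^{e(H)}\right) = -h_p(r),$$ and furthermore, for every $\varepsilon > 0$ there exists some $C = C(H,\varepsilon,p,r) > 0$ such that for all $n$, $$\mathbb{P}\left(\delta_\square(G_n,r) < \varepsilon \,\middle|\, t(H,G_n) \ge r^{e(H)}\right) \ge 1 - e^{-Cn^2}.$$ (ii) If the point $(r^d, h_p(r))$ does not lie on the convex minorant of the function $x \mapsto h_p(x^{1/d})$, then $$\lim_{n\to\infty} \frac{1}{\binom n2} \log \mathbb{P}\left(t(H,G_n) \ge r^{e(H)}\right) > -h_p(r),$$ and furthermore, there exist $\varepsilon, C > 0$ such that for all $n$, $$\mathbb{P}\left(\inf\{\delta_\square(G_n,s) : 0 \le s \le 1\} > \varepsilon \,\middle|\, t(H,G_n) \ge r^{e(H)}\right) \ge 1 - e^{-Cn^2}.$$ In particular, when $d = 2$, case (ii) occurs if and only if $p < \left[1 + (r^{-1}-1)^{1/(1-2r)}\right]^{-1}$.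
   Context: Graphs are finite and simple. $V(G)$, $E(G)$ are the vertex and edge sets and $e(G) = |E(G)|$. For $p \in (0,1)$ and $x \in [0,1]$, $h_p(x) := x \log\frac{x}{p} + (1-x)\log\frac{1-x}{1-p}$ (with $0\log 0 = 0$). The convex minorant of a function on $[0,1]$ is the largest convex function on $[0,1]$ that is pointwise at most that function. For graphs $H, G$, $t(H,G) := \hom(H,G)/|V(G)|^{|V(H)|}$, where $\hom(H,G)$ is the number of maps $V(H)\to V(G)$ carrying edges to edges. For a graph $G$ and $r \in [0,1]$, $\delta_\square(G,r) := \sup_{A,B \subset V(G)} \frac{1}{|V(G)|^2}\big|e_G(A,B) - r|A||B|\big|$, where $e_G(A,B)$ is the number of pairs $(a,b)\in A\times B$ with $ab \in E(G)$. For $r = 1/2$ the expression $(r^{-1}-1)^{1/(1-2r)}$ is interpreted as its limit $e^2$ as $r \to 1/2$.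
   Formalization: In (i), the bound "for all n" is stated for all sufficiently large n (depending on H, ε, p, r), since it fails when ε ≤ r/n²; in (ii), "for all n" means every n at which the conditioning event has positive probability; H is assumed to have at least one vertex. *)

theory Defs
  imports "HOL-Probability.Probability"
begin

text \<open>A graph is a pair of a vertex set and a set of edges, each edge a two-element set of vertices.\<close>

type_synonym 'a graph = "'a set \<times> 'a set set"

abbreviation verts :: "'a graph \<Rightarrow> 'a set" where
  "verts G \<equiv> fst G"

abbreviation edges :: "'a graph \<Rightarrow> 'a set set" where
  "edges G \<equiv> snd G"

definition all_edges :: "'a set \<Rightarrow> 'a set set" where
  "all_edges V = {e. e \<subseteq> V \<and> card e = 2}"

definition finite_simple_graph :: "'a graph \<Rightarrow> bool" where
  "finite_simple_graph G \<longleftrightarrow> finite (verts G) \<and> edges G \<subseteq> all_edges (verts G)"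

definition degree :: "'a graph \<Rightarrow> 'a \<Rightarrow> nat" where
  "degree G v = card {e \<in> edges G. v \<in> e}"

definition regular :: "nat \<Rightarrow> 'a graph \<Rightarrow> bool" where
  "regular d G \<longleftrightarrow> (\<forall>v \<in> verts G. degree G v = d)"

text \<open>An edge of the first graph sent to a single vertex has a singleton image, which is not an
  edge of a simple graph.\<close>

definition hom :: "'a graph \<Rightarrow> 'b graph \<Rightarrow> nat" where
  "hom H G = card {\<phi> \<in> verts H \<rightarrow>\<^sub>E verts G. \<forall>e \<in> edges H. \<phi> ` e \<in> edges G}"

definition hom_density :: "'a graph \<Rightarrow> 'b graph \<Rightarrow> real" where
  "hom_density H G = real (hom H G) / real (card (verts G)) ^ card (verts H)"

text \<open>Ordered pairs are counted, so an edge inside the intersection of the two sets counts twice.\<close>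

definition edges_between :: "'a graph \<Rightarrow> 'a set \<Rightarrow> 'a set \<Rightarrow> nat" where
  "edges_between G A B = card {(a, b). a \<in> A \<and> b \<in> B \<and> {a, b} \<in> edges G}"

definition cut_dist_const :: "'a graph \<Rightarrow> real \<Rightarrow> real" where
  "cut_dist_const G r =
     (SUP (A, B) \<in> Pow (verts G) \<times> Pow (verts G).
        1 / (real (card (verts G)))\<^sup>2
          * \<bar>real (edges_between G A B) - r * real (card A) * real (card B)\<bar>)"

definition random_graph :: "nat \<Rightarrow> real \<Rightarrow> nat graph pmf" where
  "random_graph n p =
     map_pmf (\<lambda>\<omega>. ({..<n}, {e \<in> all_edges {..<n}. \<omega> e}))
       (Pi_pmf (all_edges {..<n}) False (\<lambda>_. bernoulli_pmf p))"

text \<open>The convention $0 \log 0 = 0$ holds automatically because of the factor $0$.\<close>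

definition rel_entropy :: "real \<Rightarrow> real \<Rightarrow> real" where
  "rel_entropy p x = x * ln (x / p) + (1 - x) * ln ((1 - x) / (1 - p))"

definition is_convex_minorant :: "(real \<Rightarrow> real) \<Rightarrow> (real \<Rightarrow> real) \<Rightarrow> bool" where
  "is_convex_minorant f g \<longleftrightarrow>
     convex_on {0..1} g \<and> (\<forall>x\<in>{0..1}. g x \<le> f x) \<and>
     (\<forall>k. convex_on {0..1} k \<and> (\<forall>x\<in>{0..1}. k x \<le> f x) \<longrightarrow> (\<forall>x\<in>{0..1}. k x \<le> g x))"

definition on_convex_minorant :: "(real \<Rightarrow> real) \<Rightarrow> real \<times> real \<Rightarrow> bool" where
  "on_convex_minorant f P \<longleftrightarrow>
     (\<exists>g. is_convex_minorant f g \<and> fst P \<in> {0..1} \<and> g (fst P) = snd P)"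

text \<open>The convex minorant of a function bounded below exists and is unique on the unit interval,
  so the quantifier over minorants in the previous definition is harmless.\<close>

lemma is_convex_minorant_unique:
  assumes "is_convex_minorant f g" "is_convex_minorant f g'" "x \<in> {0..1}"
  shows "g x = g' x"
  using assms unfolding is_convex_minorant_def by (meson order_antisym)

lemma is_convex_minorant_exists:
  assumes "\<And>x. x \<in> {0..1} \<Longrightarrow> c \<le> f x"
  shows "\<exists>g. is_convex_minorant f g"
proof -
  define K where "K = {k. convex_on {0..1} k \<and> (\<forall>x\<in>{0..1::real}. k x \<le> f x)}"
  define g where "g x = (SUP k\<in>K. k x)" for x
  have cK: "(\<lambda>_. c) \<in> K"
    using assms by (auto simp: K_def convex_on_def simp flip: distrib_right)
  have bdd: "bdd_above ((\<lambda>k. k x) ` K)" if "x \<in> {0..1}" for x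
    using that by (intro bdd_aboveI[of _ "f x"]) (auto simp: K_def)
  have upper: "k x \<le> g x" if "k \<in> K" "x \<in> {0..1}" for k x
    unfolding g_def using that bdd by (intro cSUP_upper) auto
  have below: "g x \<le> f x" if "x \<in> {0..1}" for x
    unfolding g_def using cK that by (intro cSUP_least) (auto simp: K_def)
  have "convex_on {0..1} g"
  proof (rule convex_onI)
    fix t x y :: real
    assume t: "0 < t" "t < 1" and xy: "x \<in> {0..1}" "y \<in> {0..1}"
    show "g ((1 - t) *\<^sub>R x + t *\<^sub>R y) \<le> (1 - t) * g x + t * g y"
      unfolding g_def[of "(1 - t) *\<^sub>R x + t *\<^sub>R y"]
    proof (rule cSUP_least)
      fix k assume k: "k \<in> K"
      then have "k ((1 - t) *\<^sub>R x + t *\<^sub>R y) \<le> (1 - t) * k x + t * k y"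
        using t xy by (intro convex_onD[of "{0..1}"]) (auto simp: K_def)
      also have "\<dots> \<le> (1 - t) * g x + t * g y"
        using t upper[OF k] xy by (intro add_mono mult_left_mono) auto
      finally show "k ((1 - t) *\<^sub>R x + t *\<^sub>R y) \<le> (1 - t) * g x + t * g y" .
    qed (use cK in auto)
  qed auto
  then have "is_convex_minorant f g"
    using below upper by (auto simp: is_convex_minorant_def K_def)
  then show ?thesis by blast
qed

end

theory Submission
  imports Defs "HOL-Real_Asymp.Real_Asymp"
begin

text \<open>Write \<open>h = rel_entropy p\<close>. Everything is done at finite \<open>n\<close>, with \<open>[0, 1]\<close>-valued edge weights in
  place of graphons.

  Upper bound: by superadditivity of relative entropy, a set \<open>S\<close> of graphs has probability at most
  \<open>exp (- I w)\<close>, where \<open>I w\<close> is the sum of \<open>h (w e)\<close> over all edges and \<open>w\<close> is the mean of the random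
  graph conditioned on \<open>S\<close>. Weak regularity with rectangles of coefficients \<open>\<plusminus>\<epsilon>\<close> splits any event into
  \<open>exp (O(n))\<close> pieces of small cut diameter, so \<open>w\<close> may be taken close in cut norm to a graph of the
  event, and the counting lemma transfers the density of \<open>H\<close> from that graph to \<open>w\<close>. Lower bound: tilt the
  measure to a blow-up of a fixed weighted graph; the density of \<open>H\<close> concentrates by Chebyshev.

  If \<open>(r ^ d, h r)\<close> lies on the convex minorant, then a supporting line there and Finner's inequality,
  which bounds the density of a \<open>d\<close>-regular graph by the \<open>d\<close>-th moment of \<open>w\<close>, give the rate \<open>h r\<close>. The
  supporting line cannot touch the graph on both sides of \<open>r ^ d\<close>, which forces near-optimal weights
  to be close to \<open>r\<close>. Otherwise a chord passes below the point, and joining a few vertices to all others with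
  the two weights of that chord beats the constant \<open>r\<close>; graphs near a constant are then too
  expensive, since they have edge density almost \<open>r\<close>. The limit exists because the normalised
  costs are almost decreasing under blow-up.\<close>

section \<open>The relative entropy function\<close>

text \<open>Convexity is what lets finite \<open>n\<close> replace a limit object. Members of one
  regularity class are pairwise close in cut norm, and cut-norm balls are convex, so the conditional
  mean of a class stays close to each member; \<open>exp (O(n))\<close> classes are invisible
  against exponents of order \<open>n\<^sup>2\<close>.

  The lower bound needs slack: concentration yields density at least \<open>\<tau>\<close> only for
  weights whose density is strictly above \<open>\<tau>\<close>. Hence the constant \<open>r\<close>
  is raised slightly, and weights that come out of the upper bound are pushed towards 1 before they
  are reused; continuity of the entropy controls the cost.

  Joining few vertices to all others fits the chord for this reason: with \<open>K\<close> special
  vertices among \<open>N\<close>, both the change of density and the change of entropy are of first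
  order in \<open>K / N\<close>. A vertex of \<open>H\<close> placed on a special vertex of weight
  \<open>y\<close> turns \<open>r ^ d\<close> into \<open>y ^ d\<close>, because exactly
  \<open>d\<close> edges leave it. So at first order the comparison is between the averages of
  \<open>y ^ d\<close> and of \<open>h y\<close>, the two coordinates of the chord, while maps that
  use two special vertices matter only at second order.\<close>

lemma continuous_on_xlnx: "continuous_on {0..} (\<lambda>x::real. x * ln x)"
  unfolding continuous_on_eq_continuous_within
proof
  fix x :: real assume x: "x \<in> {0..}"
  show "continuous (at x within {0..}) (\<lambda>x. x * ln x)"
  proof (cases "x = 0")
    case True
    have "((\<lambda>x::real. x * ln x) \<longlongrightarrow> 0) (at_right 0)" by real_asymp
    then show ?thesis
      using True by (simp add: continuous_within at_within_Ici_at_right)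
  next
    case False
    then have "isCont (\<lambda>x. x * ln x) x" by (intro continuous_intros) auto
    then show ?thesis by (rule continuous_at_imp_continuous_at_within)
  qed
qed

lemma rel_entropy_expand:
  assumes "0 < p" "p < 1" "x \<in> {0..1}"
  shows "rel_entropy p x = x * ln x + (1 - x) * ln (1 - x) - x * ln p - (1 - x) * ln (1 - p)"
proof -
  consider "x = 0" | "x = 1" | "0 < x" "x < 1" using assms by force
  then show ?thesis
    by cases (use assms in \<open>auto simp: rel_entropy_def ln_div algebra_simps\<close>)
qed

lemma continuous_on_rel_entropy:
  assumes "0 < p" "p < 1"
  shows "continuous_on {0..1} (rel_entropy p)"
proof -
  have a: "continuous_on {0..1} (\<lambda>x::real. x * ln x)"
    by (rule continuous_on_subset[OF continuous_on_xlnx]) auto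
  have "continuous_on {0..1::real} ((\<lambda>x. x * ln x) \<circ> (\<lambda>x. 1 - x))"
    by (rule continuous_on_compose; (rule continuous_on_subset[OF continuous_on_xlnx])?)
       (auto intro!: continuous_intros)
  then have b: "continuous_on {0..1::real} (\<lambda>x. (1 - x) * ln (1 - x))" by (simp add: o_def)
  have "continuous_on {0..1} (\<lambda>x. x * ln x + (1 - x) * ln (1 - x) - x * ln p - (1 - x) * ln (1 - p))"
    by (intro continuous_intros a b)
  then show ?thesis
    by (rule continuous_on_eq) (simp add: rel_entropy_expand[OF assms])
qed

text \<open>This is \<open>ln z \<le> z - 1\<close> at \<open>z = b / a\<close>, strict unless
  \<open>z = 1\<close>. Summed over outcomes it is Gibbs' inequality; it serves both the two-point
  entropy and the measures on graphs.\<close>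

lemma mult_ln_ratio_ge:
  fixes a b :: real
  assumes "a \<ge> 0" "b > 0"
  shows "a * ln (a / b) \<ge> a - b" and "a \<noteq> b \<Longrightarrow> a * ln (a / b) > a - b"
proof -
  have *: "a * ln (a / b) \<ge> a - b" "a \<noteq> b \<longrightarrow> a * ln (a / b) > a - b"
  proof -
    consider "a = 0" | "a > 0" "a = b" | "a > 0" "a \<noteq> b" using assms by force
    then have "a * ln (a / b) \<ge> a - b \<and> (a \<noteq> b \<longrightarrow> a * ln (a / b) > a - b)"
    proof cases
      case 3
      have "ln (b / a) < b / a - 1"
        using 3 assms ln_le_minus_one[of "b / a"] ln_eq_minus_one[of "b / a"]
        by (force simp: field_simps)
      then have "a * ln (b / a) < a * (b / a - 1)" using 3 by simp
      then have "a * ln (a / b) > a - b"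
        using 3 assms by (simp add: ln_div algebra_simps)
      then show ?thesis using 3 by auto
    qed (use assms in auto)
    then show "a * ln (a / b) \<ge> a - b" "a \<noteq> b \<longrightarrow> a * ln (a / b) > a - b" by auto
  qed
  show "a * ln (a / b) \<ge> a - b" "a \<noteq> b \<Longrightarrow> a * ln (a / b) > a - b" using * by auto
qed

lemma rel_entropy_nonneg:
  assumes "0 < p" "p < 1" "x \<in> {0..1}"
  shows "rel_entropy p x \<ge> 0"
  using mult_ln_ratio_ge(1)[of x p] mult_ln_ratio_ge(1)[of "1 - x" "1 - p"] assms
  by (auto simp: rel_entropy_def)

lemma rel_entropy_pos:
  assumes "0 < p" "p < 1" "x \<in> {0..1}" "x \<noteq> p"
  shows "rel_entropy p x > 0"
  using mult_ln_ratio_ge(2)[of x p] mult_ln_ratio_ge(1)[of "1 - x" "1 - p"] assms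
  by (auto simp: rel_entropy_def)

lemma rel_entropy_self [simp]: "rel_entropy p p = 0"
  by (cases "p = 0"; cases "p = 1") (auto simp: rel_entropy_def)

text \<open>The defect in the tangent inequality at \<open>y\<close> is again a relative entropy, with base \<open>y\<close>.\<close>

lemma rel_entropy_tangent:
  assumes "0 < p" "p < 1" "0 < y" "y < 1" "x \<in> {0..1}"
  shows "rel_entropy p x \<ge> rel_entropy p y + (ln (y / p) - ln ((1 - y) / (1 - p))) * (x - y)"
proof -
  have "rel_entropy p x - (rel_entropy p y + (ln (y / p) - ln ((1 - y) / (1 - p))) * (x - y))
      = rel_entropy y x"
    using assms rel_entropy_expand[of p x] rel_entropy_expand[of y x] rel_entropy_expand[of p y]
    by (simp add: ln_div algebra_simps)
  then show ?thesis using rel_entropy_nonneg[of y x] assms by linarith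
qed

lemma rel_entropy_slope_nonneg:
  fixes p y :: real
  assumes "0 < p" "p \<le> y" "y < 1"
  shows "ln (y / p) - ln ((1 - y) / (1 - p)) \<ge> 0"
proof -
  have "ln (y / p) \<ge> 0" using assms by (simp add: ln_ge_zero)
  moreover have "ln ((1 - y) / (1 - p)) \<le> 0" using assms by (simp add: ln_le_zero_iff)
  ultimately show ?thesis by simp
qed

text \<open>Jensen's inequality from a one-sided bound on the average: \<open>y\<close> lies to the
  right of the minimiser \<open>p\<close>, so the tangent at \<open>y\<close> has nonnegative slope
  and a larger average can only raise the bound.\<close>

lemma rel_entropy_sum_ge:
  fixes w :: "'b \<Rightarrow> real"
  assumes p: "0 < p" "p \<le> y" "y < 1" and w: "\<And>e. e \<in> E \<Longrightarrow> w e \<in> {0..1}"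
    and avg: "(\<Sum>e\<in>E. w e) \<ge> y * real (card E)"
  shows "(\<Sum>e\<in>E. rel_entropy p (w e)) \<ge> real (card E) * rel_entropy p y"
proof -
  let ?s = "ln (y / p) - ln ((1 - y) / (1 - p))"
  have "(\<Sum>e\<in>E. rel_entropy p (w e)) \<ge> (\<Sum>e\<in>E. rel_entropy p y + ?s * (w e - y))"
    using p w by (intro sum_mono rel_entropy_tangent) auto
  also have "(\<Sum>e\<in>E. rel_entropy p y + ?s * (w e - y))
      = real (card E) * rel_entropy p y + ?s * ((\<Sum>e\<in>E. w e) - y * real (card E))"
    by (simp add: sum.distrib sum_subtractf flip: sum_distrib_left)
  moreover have "?s * ((\<Sum>e\<in>E. w e) - y * real (card E)) \<ge> 0"
    using rel_entropy_slope_nonneg[OF p] avg by (intro mult_nonneg_nonneg) auto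
  ultimately show ?thesis by linarith
qed

section \<open>Convex minorants\<close>

text \<open>The chord condition says that every difference quotient to the left of \<open>x0\<close>
  is at most every one to the right; the supremum of the left ones separates the two
  families.\<close>

lemma chord_imp_support:
  fixes f :: "real \<Rightarrow> real"
  assumes x0: "0 < x0" "x0 < 1"
    and chord: "\<And>x1 x2. \<lbrakk>0 \<le> x1; x1 < x0; x0 < x2; x2 \<le> 1\<rbrakk>
        \<Longrightarrow> f x0 * (x2 - x1) \<le> f x1 * (x2 - x0) + f x2 * (x0 - x1)"
  shows "\<exists>s. \<forall>x\<in>{0..1}. f x0 + s * (x - x0) \<le> f x"
proof -
  define s where "s = (SUP x\<in>{0..<x0}. (f x0 - f x) / (x0 - x))"
  have le: "(f x0 - f x1) / (x0 - x1) \<le> (f x2 - f x0) / (x2 - x0)"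
    if "0 \<le> x1" "x1 < x0" "x0 < x2" "x2 \<le> 1" for x1 x2
    using chord[OF that] that by (simp add: field_simps)
  have bdd: "bdd_above ((\<lambda>x. (f x0 - f x) / (x0 - x)) ` {0..<x0})"
    using le[of _ 1] x0 by (intro bdd_aboveI[of _ "(f 1 - f x0) / (1 - x0)"]) auto
  have "f x0 + s * (x - x0) \<le> f x" if x: "x \<in> {0..1}" for x
  proof -
    consider "x < x0" | "x = x0" | "x > x0" by linarith
    then show ?thesis
    proof cases
      case 1
      then have "(f x0 - f x) / (x0 - x) \<le> s"
        unfolding s_def using x by (intro cSUP_upper bdd) auto
      then show ?thesis using 1 by (simp add: field_simps)
    next
      case 3
      have "s \<le> (f x - f x0) / (x - x0)"
        unfolding s_def using le[of _ x] x x0 3 by (intro cSUP_least) auto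
      then show ?thesis using 3 by (simp add: field_simps)
    qed simp
  qed
  then show ?thesis by blast
qed

text \<open>Replaces the minorant by an affine function: a convex \<open>g\<close> touching
  \<open>f\<close> at \<open>x0\<close> gives the chord condition, and conversely a supporting line
  competes in the definition of the minorant. The bound \<open>c\<close> guarantees that a minorant
  exists.\<close>

lemma on_convex_minorant_iff_support:
  fixes f :: "real \<Rightarrow> real"
  assumes x0: "0 < x0" "x0 < 1" and c: "\<And>x. x \<in> {0..1} \<Longrightarrow> c \<le> f x"
  shows "on_convex_minorant f (x0, f x0) \<longleftrightarrow> (\<exists>s. \<forall>x\<in>{0..1}. f x0 + s * (x - x0) \<le> f x)"
proof
  assume "on_convex_minorant f (x0, f x0)"
  then obtain g where g: "convex_on {0..1} g" "\<And>x. x \<in> {0..1} \<Longrightarrow> g x \<le> f x" "g x0 = f x0"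
    by (auto simp: on_convex_minorant_def is_convex_minorant_def)
  show "\<exists>s. \<forall>x\<in>{0..1}. f x0 + s * (x - x0) \<le> f x"
  proof (rule chord_imp_support[OF x0])
    fix x1 x2 :: real assume x: "0 \<le> x1" "x1 < x0" "x0 < x2" "x2 \<le> 1"
    define t where "t = (x0 - x1) / (x2 - x1)"
    have tx: "t * (x2 - x1) = x0 - x1" using x by (simp add: t_def)
    have "(1 - t) * x1 + t * x2 = x1 + t * (x2 - x1)" by (simp add: algebra_simps)
    then have t: "0 \<le> t" "t \<le> 1" "(1 - t) * x1 + t * x2 = x0"
      using x tx by (simp_all add: t_def)
    have "g x0 \<le> (1 - t) * g x1 + t * g x2"
      using convex_onD[OF g(1), of t x1 x2] t x by auto
    also have "\<dots> \<le> (1 - t) * f x1 + t * f x2"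
      using g(2) t x by (intro add_mono mult_left_mono) auto
    finally have "f x0 * (x2 - x1) \<le> ((1 - t) * f x1 + t * f x2) * (x2 - x1)"
      using x g(3) by (intro mult_right_mono) auto
    moreover have "(1 - t) * (x2 - x1) = x2 - x0" "t * (x2 - x1) = x0 - x1"
      using x by (auto simp: t_def field_simps)
    ultimately show "f x0 * (x2 - x1) \<le> f x1 * (x2 - x0) + f x2 * (x0 - x1)"
      by (metis (no_types, opaque_lifting) distrib_right mult.assoc mult.commute)
  qed
next
  assume "\<exists>s. \<forall>x\<in>{0..1}. f x0 + s * (x - x0) \<le> f x"
  then obtain s where s: "\<And>x. x \<in> {0..1} \<Longrightarrow> f x0 + s * (x - x0) \<le> f x" by blast
  obtain g where g: "is_convex_minorant f g" using is_convex_minorant_exists c by blast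
  have "convex_on {0..1} (\<lambda>x. f x0 + s * (x - x0))"
    by (rule convex_onI) (auto simp: algebra_simps)
  then have "f x0 \<le> g x0"
    using g s x0 unfolding is_convex_minorant_def
    by (auto dest!: spec[of _ "\<lambda>x. f x0 + s * (x - x0)"] bspec[of _ _ x0])
  moreover have "g x0 \<le> f x0" using g x0 by (auto simp: is_convex_minorant_def)
  ultimately show "on_convex_minorant f (x0, f x0)"
    using g x0 unfolding on_convex_minorant_def by (auto intro!: exI[of _ g])
qed

lemma power_powr_inverse:
  fixes y :: real
  assumes "y \<ge> 0" "d > 0"
  shows "(y ^ d) powr (1 / real d) = y"
proof (cases "y = 0")
  case False
  then have "(y powr d) powr (1 / real d) = y" using assms by (simp add: powr_powr)
  then show ?thesis using assms False by (simp add: powr_realpow)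
qed (use assms in simp)

lemma powr_inverse_power:
  fixes x :: real
  assumes "x \<ge> 0" "d > 0"
  shows "(x powr (1 / real d)) ^ d = x"
proof (cases "x = 0")
  case False
  then have "(x powr (1 / real d)) powr d = x" using assms by (simp add: powr_powr)
  then show ?thesis using assms False by (simp add: powr_realpow)
qed (use assms in simp)

text \<open>The map from \<open>y\<close> to \<open>y ^ d\<close> is a bijection of the unit
  interval. From here on lines in \<open>x\<close> are affine functions of \<open>y ^ d\<close>, the
  quantity that Finner's inequality controls.\<close>

lemma on_convex_minorant_power_iff:
  fixes p r :: real
  assumes p: "0 < p" "p < 1" and r: "0 < r" "r < 1" and d: "d > 0"
  shows "on_convex_minorant (\<lambda>x. rel_entropy p (x powr (1 / real d))) (r ^ d, rel_entropy p r)
    \<longleftrightarrow> (\<exists>s. \<forall>y\<in>{0..1}. rel_entropy p r + s * (y ^ d - r ^ d) \<le> rel_entropy p y)"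
proof -
  let ?f = "\<lambda>x. rel_entropy p (x powr (1 / real d))"
  have f: "?f (y ^ d) = rel_entropy p y" if "0 \<le> y" for y
    using power_powr_inverse[OF that d] by simp
  have "on_convex_minorant ?f (r ^ d, ?f (r ^ d)) \<longleftrightarrow> (\<exists>s. \<forall>x\<in>{0..1}. ?f (r ^ d) + s * (x - r ^ d) \<le> ?f x)"
    using r p d by (intro on_convex_minorant_iff_support[of _ 0] rel_entropy_nonneg)
      (auto simp: power_less_one_iff powr_le1)
  also have "\<dots> \<longleftrightarrow> (\<exists>s. \<forall>y\<in>{0..1}. rel_entropy p r + s * (y ^ d - r ^ d) \<le> rel_entropy p y)"
  proof (intro arg_cong[where f = Ex] ext iffI ballI)
    fix s y :: real assume "\<forall>x\<in>{0..1}. ?f (r ^ d) + s * (x - r ^ d) \<le> ?f x" "y \<in> {0..1}"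
    then show "rel_entropy p r + s * (y ^ d - r ^ d) \<le> rel_entropy p y"
      using f[of y] f[of r] r by (auto dest!: bspec[of _ _ "y ^ d"] simp: power_le_one)
  next
    fix s x :: real
    assume a: "\<forall>y\<in>{0..1}. rel_entropy p r + s * (y ^ d - r ^ d) \<le> rel_entropy p y" "x \<in> {0..1}"
    then have "x powr (1 / real d) \<in> {0..1}" by (auto simp: powr_le1)
    then show "?f (r ^ d) + s * (x - r ^ d) \<le> ?f x"
      using bspec[OF a(1), of "x powr (1 / real d)"] powr_inverse_power[of x d] a(2) d f[of r] r by auto
  qed
  finally show ?thesis using f[of r] r by simp
qed

text \<open>At \<open>y = p\<close> the right side vanishes while \<open>rel_entropy p r\<close> is
  positive for \<open>p \<noteq> r\<close>, which forces a positive slope. For \<open>p = r\<close>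
  the zero slope works, because the entropy is nonnegative.\<close>

lemma support_slope_nonneg:
  fixes p r s :: real
  assumes p: "0 < p" "p \<le> r" "r < 1" and d: "d > 0"
    and supp: "\<forall>y\<in>{0..1}. rel_entropy p r + s * (y ^ d - r ^ d) \<le> rel_entropy p y"
  shows "\<exists>s'\<ge>0. (s' > 0 \<or> p = r) \<and>
    (\<forall>y\<in>{0..1}. rel_entropy p r + s' * (y ^ d - r ^ d) \<le> rel_entropy p y)"
proof (cases "p = r")
  case True
  then show ?thesis using rel_entropy_nonneg[of p] p by (intro exI[of _ 0]) auto
next
  case False
  have "rel_entropy p r + s * (p ^ d - r ^ d) \<le> 0" using bspec[OF supp, of p] p by simp
  moreover have "rel_entropy p r > 0" using rel_entropy_pos[of p r] False p by simp
  ultimately have "s * (r ^ d - p ^ d) > 0" by (simp add: algebra_simps)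
  moreover have "r ^ d - p ^ d > 0" using False p d by (simp add: power_strict_mono)
  ultimately have "s > 0" by (simp add: zero_less_mult_iff)
  then show ?thesis using supp by (intro exI[of _ s]) auto
qed

text \<open>Contraposition of \<open>chord_imp_support\<close>, in the variable \<open>y\<close>.
  The pair \<open>y1\<close>, \<open>y2\<close> supplies the weights of the symmetry-breaking
  construction.\<close>

lemma no_support_imp_chord:
  fixes p r :: real
  assumes p: "0 < p" "p < 1" and r: "0 < r" "r < 1" and d: "d > 0"
    and ns: "\<nexists>s. \<forall>y\<in>{0..1}. rel_entropy p r + s * (y ^ d - r ^ d) \<le> rel_entropy p y"
  obtains y1 y2 where "y1 \<in> {0..1}" "y2 \<in> {0..1}" "y1 ^ d < r ^ d" "r ^ d < y2 ^ d"
    "rel_entropy p y1 * (y2 ^ d - r ^ d) + rel_entropy p y2 * (r ^ d - y1 ^ d) < rel_entropy p r * (y2 ^ d - y1 ^ d)"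
proof -
  define f where "f x = rel_entropy p (x powr (1 / real d))" for x
  have f: "f (y ^ d) = rel_entropy p y" if "0 \<le> y" for y
    using power_powr_inverse[OF that d] by (simp add: f_def)
  have "\<nexists>s. \<forall>x\<in>{0..1}. f (r ^ d) + s * (x - r ^ d) \<le> f x"
  proof
    assume "\<exists>s. \<forall>x\<in>{0..1}. f (r ^ d) + s * (x - r ^ d) \<le> f x"
    then obtain s where s: "\<And>x. x \<in> {0..1} \<Longrightarrow> f (r ^ d) + s * (x - r ^ d) \<le> f x" by blast
    have "rel_entropy p r + s * (y ^ d - r ^ d) \<le> rel_entropy p y" if "y \<in> {0..1}" for y
      using s[of "y ^ d"] f[of y] f[of r] that r by (auto simp: power_le_one)
    then show False using ns by blast
  qed
  moreover have "0 < r ^ d" "r ^ d < 1" using r d by (auto simp: power_less_one_iff)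
  ultimately obtain x1 x2 where x: "0 \<le> x1" "x1 < r ^ d" "r ^ d < x2" "x2 \<le> 1"
    "f x1 * (x2 - r ^ d) + f x2 * (r ^ d - x1) < f (r ^ d) * (x2 - x1)"
    using chord_imp_support[of "r ^ d" f] by (meson not_le)
  show ?thesis
    using x f[of r] r d
    by (intro that[of "x1 powr (1 / real d)" "x2 powr (1 / real d)"])
       (auto simp: powr_inverse_power powr_le1 f_def)
qed

section \<open>The criterion for degree two\<close>

text \<open>The derivative of \<open>y * ln y + (1 - y) * ln (1 - y)\<close>.\<close>

definition logit :: "real \<Rightarrow> real" where
  "logit y = ln y - ln (1 - y)"

text \<open>With \<open>s = - logit p\<close> this is \<open>rel_entropy p\<close> up to a constant
  and a multiple of \<open>y\<^sup>2\<close>. Such a multiple only changes the slope of a line in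
  \<open>y\<^sup>2\<close>; the one chosen makes the function symmetric about
  \<open>1/2\<close>.\<close>

definition sym_entropy :: "real \<Rightarrow> real \<Rightarrow> real" where
  "sym_entropy s y = y * ln y + (1 - y) * ln (1 - y) + s * (y * (1 - y))"

text \<open>Half the slope of the chord of \<open>logit\<close> from \<open>1/2\<close> to
  \<open>r\<close>, and at \<open>r = 1/2\<close> half the derivative of \<open>logit\<close>, which
  is 4 there. For \<open>r \<noteq> 1/2\<close> it is the value of \<open>s\<close> at which
  \<open>sym_entropy s\<close> is stationary at \<open>r\<close>.\<close>

definition logit_slope :: "real \<Rightarrow> real" where
  "logit_slope r = (if r = 1/2 then 2 else logit r / (2 * r - 1))"

lemma logit_flip: "logit (1 - y) = - logit y"
  by (simp add: logit_def)

lemma sym_entropy_flip: "sym_entropy s (1 - y) = sym_entropy s y"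
  by (simp add: sym_entropy_def algebra_simps)

lemma logit_slope_flip: "logit_slope (1 - r) = logit_slope r"
proof (cases "r = 1/2")
  case False
  then have "2 * (1 - r) - 1 = - (2 * r - 1)" "1 - r \<noteq> 1/2" by auto
  then have "logit_slope (1 - r) = (- logit r) / (- (2 * r - 1))"
    by (simp only: logit_slope_def logit_flip if_False)
  then show ?thesis using False by (simp only: logit_slope_def if_False minus_divide_divide)
next
  case True
  have "1 - r = r" using True by simp
  then show ?thesis by (rule arg_cong)
qed

lemma logit_slope_eq: "logit r = (2 * r - 1) * logit_slope r"
proof (cases "r = 1/2")
  case True
  then show ?thesis by (simp only: logit_def) simp
qed (simp add: logit_slope_def)

lemma DERIV_logit:
  assumes "0 < y" "y < 1" shows "(logit has_real_derivative 1 / (y * (1 - y))) (at y)"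
  unfolding logit_def[abs_def]
  by (rule derivative_eq_intros refl | use assms in \<open>simp add: field_simps\<close>)+

lemma DERIV_sym_entropy:
  assumes "0 < y" "y < 1"
  shows "(sym_entropy s has_real_derivative (logit y + s * (1 - 2 * y))) (at y)"
  unfolding sym_entropy_def[abs_def] logit_def
  by (rule derivative_eq_intros refl | use assms in \<open>simp add: field_simps\<close>)+

lemma rel_entropy_sym_entropy:
  assumes "0 < p" "p < 1" "x \<in> {0..1}"
  shows "rel_entropy p x = sym_entropy (- logit p) x - logit p * x\<^sup>2 - ln (1 - p)"
  using rel_entropy_expand[OF assms]
  by (simp add: sym_entropy_def logit_def algebra_simps power2_eq_square)

lemma continuous_on_sym_entropy: "continuous_on {0..1} (sym_entropy s)"
proof -
  have "continuous_on {0..1} (\<lambda>x. rel_entropy (1/2) x + s * (x * (1 - x)) - ln 2)"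
    by (intro continuous_intros continuous_on_rel_entropy) auto
  then show ?thesis
    by (rule continuous_on_eq)
       (use rel_entropy_expand[of "1/2"] in \<open>auto simp: sym_entropy_def ln_div algebra_simps\<close>)
qed

lemma convex_on_logit: "convex_on {1/2..<1} logit"
proof (rule f''_ge0_imp_convex)
  show "(logit has_real_derivative 1 / (x * (1 - x))) (at x)" if "x \<in> {1/2..<1}" for x
    using DERIV_logit that by auto
  show "((\<lambda>x. 1 / (x * (1 - x))) has_real_derivative (2 * x - 1) / (x * (1 - x))\<^sup>2) (at x)"
    if "x \<in> {1/2..<1}" for x
    by (rule derivative_eq_intros refl | use that in \<open>simp add: field_simps power2_eq_square\<close>)+
qed auto

text \<open>The derivative \<open>1 / (y * (1 - y))\<close> is at least 4, its value at
  \<open>1/2\<close>. This is the limiting case \<open>r = 1/2\<close> of the next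
  comparison.\<close>

lemma logit_ge_half:
  assumes "1/2 \<le> y" "y < 1" shows "logit y \<ge> 2 * (2 * y - 1)"
proof -
  have "logit (1/2) - 2 * (2 * (1/2) - 1) \<le> logit y - 2 * (2 * y - 1)"
  proof (rule DERIV_nonneg_imp_nondecreasing[OF assms(1)])
    fix x :: real assume x: "1/2 \<le> x" "x \<le> y"
    have "(2 * x - 1)\<^sup>2 \<ge> 0" by simp
    then have "x * (1 - x) \<le> 1/4" by (simp add: power2_eq_square algebra_simps)
    moreover have "x * (1 - x) > 0" using x assms by simp
    ultimately have "1 / (x * (1 - x)) - 4 \<ge> 0" by (simp add: field_simps)
    moreover have "((\<lambda>x. logit x - 2 * (2 * x - 1)) has_real_derivative 1 / (x * (1 - x)) - 4) (at x)"
      by (rule derivative_eq_intros DERIV_logit refl | use x assms in simp)+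
    ultimately show "\<exists>z. ((\<lambda>x. logit x - 2 * (2 * x - 1)) has_real_derivative z) (at x) \<and> z \<ge> 0"
      by blast
  qed
  then show ?thesis by (simp add: logit_def)
qed

text \<open>\<open>logit\<close> vanishes at \<open>1/2\<close> and is convex to the right of it, so
  its chord slopes from \<open>1/2\<close> increase. The inequalities are multiplied out because the
  denominators \<open>2 * r - 1\<close> and \<open>2 * y - 1\<close> may vanish.\<close>

lemma logit_slope_compare:
  assumes r: "1/2 \<le> r" "r < 1" and y: "1/2 \<le> y" "y < 1"
  shows "r \<le> y \<Longrightarrow> logit y \<ge> (2 * y - 1) * logit_slope r"
    and "y \<le> r \<Longrightarrow> logit y \<le> (2 * y - 1) * logit_slope r"
proof -
  have conv: "(2 * b - 1) * logit a \<le> (2 * a - 1) * logit b" if "1/2 \<le> a" "a \<le> b" "1/2 < b" "b < 1" for a b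
  proof -
    define t where "t = (2 * a - 1) / (2 * b - 1)"
    have t: "0 \<le> t" "t \<le> 1" "t * (2 * b - 1) = 2 * a - 1" using that by (auto simp: t_def)
    have "(1 - t) * (1/2) + t * b = 1/2 + t * (2 * b - 1) / 2" by (simp add: field_simps)
    then have "(1 - t) * (1/2) + t * b = a" using t(3) by (simp add: field_simps)
    then have "logit a \<le> (1 - t) * logit (1/2) + t * logit b"
      using convex_onD[OF convex_on_logit, of t "1/2" b] t that by auto
    then have "(2 * b - 1) * logit a \<le> (2 * b - 1) * (t * logit b)"
      using that by (intro mult_left_mono) (auto simp: logit_def)
    also have "\<dots> = (t * (2 * b - 1)) * logit b" by simp
    finally show ?thesis using t by simp
  qed
  show "logit y \<ge> (2 * y - 1) * logit_slope r" if "r \<le> y"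
  proof (cases "r = 1/2")
    case True then show ?thesis using logit_ge_half y by (simp add: logit_slope_def)
  next
    case False
    then show ?thesis using conv[of r y] that r y by (simp add: logit_slope_def field_simps)
  qed
  show "logit y \<le> (2 * y - 1) * logit_slope r" if "y \<le> r"
  proof (cases "r = 1/2")
    case True
    have "y = 1/2" using that y True by simp
    then show ?thesis by (simp only: logit_def) simp
  next
    case False
    then show ?thesis using conv[of y r] that r y by (simp add: logit_slope_def field_simps)
  qed
qed

text \<open>Symmetry of \<open>sym_entropy s\<close> about \<open>1/2\<close> reduces the lower bound to the half of the unit
  interval that contains \<open>r\<close>, where the sign of the derivative is read off from the monotonicity
  of \<open>logit_slope\<close>.\<close>

lemma sym_entropy_support:
  assumes r: "0 < r" "r < 1" and s: "s \<le> logit_slope r"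
  shows "\<exists>c. \<forall>y\<in>{0..1}. sym_entropy s r + c * (y\<^sup>2 - r\<^sup>2) \<le> sym_entropy s y"
proof -
  define k where "k = logit_slope r"
  \<comment> \<open>Chosen so that the derivative of \<open>M\<close> below vanishes at
    \<open>r\<close>.\<close>
  define c where "c = (2 * r - 1) * (k - s) / (2 * r)"
  define M where "M y = sym_entropy s y - c * y\<^sup>2" for y
  have dM: "(M has_real_derivative (logit y + s * (1 - 2 * y) - 2 * c * y)) (at y)"
    if "0 < y" "y < 1" for y
    unfolding M_def by (rule derivative_eq_intros DERIV_sym_entropy refl | use that in simp)+
  have contM: "continuous_on {a..b} M" if "0 \<le> a" "b \<le> 1" for a b
    unfolding M_def
    by (intro continuous_intros continuous_on_subset[OF continuous_on_sym_entropy]) (use that in auto)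
  have ks: "k - s \<ge> 0" using s k_def by simp
  have cr: "2 * c * r = (2 * r - 1) * (k - s)" using r by (simp add: c_def)
  \<comment> \<open>Both sides are affine in \<open>y\<close> and agree at \<open>y = r\<close>; the
    identity for \<open>y - r\<close> fixes the sign of their difference on either side.\<close>
  have cmp_ge: "(2 * y - 1) * (k - s) \<ge> 2 * c * y" if "r \<le> y" for y
  proof -
    have "(2 * y - 1) * r - (2 * r - 1) * y = y - r" by (simp add: algebra_simps)
    then have "(2 * y - 1) * r \<ge> (2 * r - 1) * y" using that by simp
    then have "((2 * y - 1) * r) * (k - s) \<ge> ((2 * r - 1) * y) * (k - s)"
      using ks by (rule mult_right_mono)
    also have "((2 * r - 1) * y) * (k - s) = (2 * c * r) * y" using cr by simp
    finally have "r * ((2 * y - 1) * (k - s)) \<ge> r * (2 * c * y)" by (simp add: mult_ac)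
    then show ?thesis using r by simp
  qed
  have cmp_le: "(2 * y - 1) * (k - s) \<le> 2 * c * y" if "y \<le> r" for y
  proof -
    have "(2 * y - 1) * r - (2 * r - 1) * y = y - r" by (simp add: algebra_simps)
    then have "(2 * y - 1) * r \<le> (2 * r - 1) * y" using that by simp
    then have "((2 * y - 1) * r) * (k - s) \<le> ((2 * r - 1) * y) * (k - s)"
      using ks by (rule mult_right_mono)
    also have "((2 * r - 1) * y) * (k - s) = (2 * c * r) * y" using cr by simp
    finally have "r * ((2 * y - 1) * (k - s)) \<le> r * (2 * c * y)" by (simp add: mult_ac)
    then show ?thesis using r by simp
  qed
  have half: "M r \<le> M y" if y: "y \<in> {0..1}" and same: "(1/2 \<le> r \<and> 1/2 \<le> y) \<or> (r \<le> 1/2 \<and> y \<le> 1/2)" for y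
  proof (cases "r \<le> y")
    case True
    show ?thesis
    proof (rule DERIV_nonneg_imp_increasing_open[OF True])
      fix x assume x: "r < x" "x < y"
      have "logit x \<ge> (2 * x - 1) * k"
      proof (cases "1/2 \<le> r")
        case True
        then show ?thesis using logit_slope_compare(1)[of r x] x r y by (simp add: k_def)
      next
        case False
        then show ?thesis using logit_slope_compare(2)[of "1 - r" "1 - x"] same x r y
          by (simp add: k_def logit_flip logit_slope_flip algebra_simps)
      qed
      then have "logit x + s * (1 - 2 * x) - 2 * c * x \<ge> 0"
        using cmp_ge[of x] x by (simp add: algebra_simps)
      then show "\<exists>z. (M has_real_derivative z) (at x) \<and> z \<ge> 0"
        using dM[of x] x r y by auto
    qed (use contM r y in auto)
  next
    case False
    then have le: "y \<le> r" by simp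
    have "- M y \<le> - M r"
    proof (rule DERIV_nonneg_imp_increasing_open[OF le])
      fix x assume x: "y < x" "x < r"
      have "logit x \<le> (2 * x - 1) * k"
      proof (cases "1/2 \<le> r \<and> 1/2 \<le> y")
        case True
        then show ?thesis using logit_slope_compare(2)[of r x] x r y by (simp add: k_def)
      next
        case False
        then have "r \<le> 1/2" using same by auto
        then show ?thesis using logit_slope_compare(1)[of "1 - r" "1 - x"] x r y
          by (simp add: k_def logit_flip logit_slope_flip algebra_simps)
      qed
      then have "logit x + s * (1 - 2 * x) - 2 * c * x \<le> 0"
        using cmp_le[of x] x by (simp add: algebra_simps)
      moreover have "((\<lambda>x. - M x) has_real_derivative - (logit x + s * (1 - 2 * x) - 2 * c * x)) (at x)"
        using dM[of x] x r y by (intro DERIV_minus) auto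
      ultimately show "\<exists>z. ((\<lambda>x. - M x) has_real_derivative z) (at x) \<and> z \<ge> 0"
        by (intro exI conjI) (auto)
    qed (use contM r y in \<open>auto intro!: continuous_intros\<close>)
    then show ?thesis by simp
  qed
  have "M r \<le> M y" if y: "y \<in> {0..1}" for y
  proof (cases "(1/2 \<le> r \<and> 1/2 \<le> y) \<or> (r \<le> 1/2 \<and> y \<le> 1/2)")
    case True then show ?thesis using half y by blast
  next
    case False
    \<comment> \<open>A point in the other half is reflected. Only the term
      \<open>c * y\<^sup>2\<close> sees the reflection, and \<open>c\<close> has the sign of
      \<open>2 * r - 1\<close>, so the reflected value of \<open>M\<close> is the smaller
      one.\<close>
    have "M r \<le> M (1 - y)" using half[of "1 - y"] False y by auto
    also have "\<dots> \<le> M y"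
    proof -
      have "c * ((1 - y)\<^sup>2 - y\<^sup>2) = c * (1 - 2 * y)" by (simp add: power2_eq_square algebra_simps)
      moreover have "c * (1 - 2 * y) \<ge> 0"
      proof (cases "1/2 \<le> r")
        case True
        then have "c \<ge> 0" using ks r by (simp add: c_def)
        then show ?thesis using False True by auto
      next
        case F: False
        then have "c \<le> 0" using ks r by (simp add: c_def divide_le_0_iff mult_le_0_iff)
        then show ?thesis using False F by (auto intro: mult_nonpos_nonpos)
      qed
      ultimately show ?thesis by (simp add: M_def sym_entropy_flip algebra_simps)
    qed
    finally show ?thesis .
  qed
  then show ?thesis by (intro exI[of _ c]) (auto simp: M_def algebra_simps)
qed

text \<open>Stationarity at \<open>r\<close> determines \<open>c\<close>, and the test point
  \<open>1 - r\<close>, where \<open>sym_entropy s\<close> repeats its value, then forces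
  \<open>r = 1/2\<close>. There \<open>c = 0\<close> and the second derivative
  \<open>4 - 2 * s\<close> is negative, so \<open>1/2\<close> is not a minimum.\<close>

lemma sym_entropy_no_support:
  assumes r: "0 < r" "r < 1" and s: "s > logit_slope r"
    and c: "\<And>y. y \<in> {0..1} \<Longrightarrow> sym_entropy s r + c * (y\<^sup>2 - r\<^sup>2) \<le> sym_entropy s y"
  shows False
proof -
  define M where "M y = sym_entropy s y - c * y\<^sup>2" for y
  have "(M has_real_derivative (logit r + s * (1 - 2 * r) - 2 * c * r)) (at r)"
    unfolding M_def by (rule derivative_eq_intros DERIV_sym_entropy refl | use r in simp)+
  moreover have "\<forall>y. \<bar>r - y\<bar> < min r (1 - r) \<longrightarrow> M r \<le> M y"
    using c by (auto simp: M_def algebra_simps abs_less_iff)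
  ultimately have "logit r + s * (1 - 2 * r) - 2 * c * r = 0"
    using r by (intro DERIV_local_min[of M _ r "min r (1 - r)"]) auto
  then have d0: "(1 - 2 * r) * (s - logit_slope r) = 2 * c * r"
    using logit_slope_eq[of r] by (simp add: algebra_simps)
  have "c * ((1 - r)\<^sup>2 - r\<^sup>2) \<le> 0" using c[of "1 - r"] r by (simp add: sym_entropy_flip)
  moreover have "c * ((1 - r)\<^sup>2 - r\<^sup>2) = c * (1 - 2 * r)" by (simp add: power2_eq_square algebra_simps)
  ultimately have c2: "c * (1 - 2 * r) \<le> 0" by simp
  have "(1 - 2 * r)\<^sup>2 * (s - logit_slope r) = (2 * r) * (c * (1 - 2 * r))"
    using arg_cong[OF d0, of "\<lambda>z. (1 - 2 * r) * z"] by (simp add: power2_eq_square mult_ac)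
  also have "\<dots> \<le> 0" using c2 r by (simp add: mult_le_0_iff)
  finally have rh: "r = 1/2" using s by (auto simp: mult_le_0_iff)
  then have "c = 0" using d0 by (simp only: rh) simp
  have s2: "s > 2" using s rh by (simp add: logit_slope_def)
  define G where "G y = logit y + s * (1 - 2 * y)" for y
  have "(G has_real_derivative 1 / ((1/2) * (1 - 1/2)) - 2 * s) (at (1/2))"
    unfolding G_def by (rule derivative_eq_intros DERIV_logit refl | simp)+
  then obtain h where h: "h > 0" "\<And>u. 0 < u \<Longrightarrow> u < h \<Longrightarrow> G (1/2 + u) < G (1/2)"
    using DERIV_neg_dec_right[of G "1 / ((1/2) * (1 - 1/2)) - 2 * s" "1/2"] s2 by auto
  define b where "b = 1/2 + min h (1/2) / 2"
  have b: "1/2 < b" "b < 1" "b - 1/2 < h" using h(1) by (auto simp: b_def min_def)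
  have "sym_entropy s b < sym_entropy s (1/2)"
  proof (rule DERIV_neg_imp_decreasing_open[OF b(1)])
    fix x assume x: "1/2 < x" "x < b"
    have "G x < G (1/2)" using h(2)[of "x - 1/2"] x b by simp
    then show "\<exists>y. (sym_entropy s has_real_derivative y) (at x) \<and> y < 0"
      using DERIV_sym_entropy[of x s] x b by (auto simp: G_def logit_def)
  qed (rule continuous_on_subset[OF continuous_on_sym_entropy], use b in auto)
  moreover have "sym_entropy s (1/2) \<le> sym_entropy s b" using c[of b] \<open>c = 0\<close> rh b by simp
  ultimately show False by simp
qed

text \<open>The term \<open>logit p * y\<^sup>2\<close> that separates \<open>rel_entropy p\<close>
  from \<open>sym_entropy\<close> is linear in \<open>y\<^sup>2\<close>, so it only shifts the slope
  \<open>c\<close> by \<open>logit p\<close>.\<close>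

lemma on_convex_minorant_sqrt_iff:
  assumes p: "0 < p" "p < 1" and r: "0 < r" "r < 1"
  shows "on_convex_minorant (\<lambda>x. rel_entropy p (x powr (1 / 2))) (r\<^sup>2, rel_entropy p r)
     \<longleftrightarrow> - logit p \<le> logit_slope r"
proof -
  let ?f = "\<lambda>x. rel_entropy p (x powr (1 / 2))"
  let ?F = "sym_entropy (- logit p)"
  have "on_convex_minorant ?f (r\<^sup>2, rel_entropy p r)
      \<longleftrightarrow> (\<exists>c. \<forall>y\<in>{0..1}. rel_entropy p r + c * (y\<^sup>2 - r\<^sup>2) \<le> rel_entropy p y)"
    using on_convex_minorant_power_iff[OF p r, of 2] by simp
  also have "\<dots> \<longleftrightarrow> (\<exists>c. \<forall>y\<in>{0..1}. ?F r + (c + logit p) * (y\<^sup>2 - r\<^sup>2) \<le> ?F y)"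
    using r by (intro arg_cong[where f = Ex] ext ball_cong refl)
      (simp add: rel_entropy_sym_entropy[OF p] algebra_simps)
  also have "\<dots> \<longleftrightarrow> (\<exists>c. \<forall>y\<in>{0..1}. ?F r + c * (y\<^sup>2 - r\<^sup>2) \<le> ?F y)"
    by (metis (no_types, opaque_lifting) diff_add_cancel)
  also have "\<dots> \<longleftrightarrow> - logit p \<le> logit_slope r"
    using sym_entropy_support[OF r] sym_entropy_no_support[OF r] by (meson not_le)
  finally show ?thesis .
qed

text \<open>Exponentiation of the left side: the number added to 1 is
  \<open>exp (logit_slope r)\<close>, also at \<open>r = 1 / 2\<close> where the exponent is 2, and
  \<open>exp (- logit p)\<close> is \<open>(1 - p) / p\<close>.\<close>

lemma logit_slope_less_iff:
  assumes p: "0 < p" "p < 1" and r: "0 < r" "r < 1"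
  shows "logit_slope r < - logit p
    \<longleftrightarrow> p < inverse (1 + (if r = 1 / 2 then exp 2 else (inverse r - 1) powr (1 / (1 - 2 * r))))"
proof -
  let ?K = "if r = 1 / 2 then exp 2 else (inverse r - 1) powr (1 / (1 - 2 * r))"
  have r1: "inverse r - 1 > 0" using r by (simp add: field_simps)
  have "ln ?K = logit_slope r"
  proof (cases "r = 1/2")
    case False
    have "ln (inverse r - 1) = - logit r"
    proof -
      have "inverse r - 1 = (1 - r) / r" using r by (simp add: field_simps)
      then show ?thesis using r by (simp add: ln_div logit_def)
    qed
    moreover have "1 - 2 * r \<noteq> 0" "2 * r - 1 \<noteq> 0" using False by auto
    ultimately show ?thesis using False by (simp add: logit_slope_def ln_powr field_simps)
  qed (simp add: logit_slope_def)
  moreover have K: "?K > 0" using r1 r by auto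
  moreover have "- logit p = ln ((1 - p) / p)" using p by (simp add: logit_def ln_div)
  ultimately have "logit_slope r < - logit p \<longleftrightarrow> ?K < (1 - p) / p"
    using ln_less_cancel_iff[of ?K "(1 - p) / p"] p by simp
  also have "\<dots> \<longleftrightarrow> p < inverse (1 + ?K)"
  proof -
    have "?K < (1 - p) / p \<longleftrightarrow> p * (1 + ?K) < 1" using p by (simp add: field_simps)
    also have "\<dots> \<longleftrightarrow> p < inverse (1 + ?K)" using K by (simp add: inverse_eq_divide less_divide_eq)
    finally show ?thesis .
  qed
  finally show ?thesis .
qed

section \<open>Contact points of a supporting line, and stability\<close>

lemma DERIV_rel_entropy:
  assumes p: "0 < p" "p < 1" and y: "0 < y" "y < 1"
  shows "(rel_entropy p has_real_derivative (logit y - logit p)) (at y)"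
proof -
  have "((\<lambda>x. sym_entropy (- logit p) x - logit p * x\<^sup>2 - ln (1 - p)) has_real_derivative
      (logit y + (- logit p) * (1 - 2 * y) - logit p * (2 * y))) (at y)"
    by (rule derivative_eq_intros DERIV_sym_entropy refl | use y in simp)+
  then have "((\<lambda>x. sym_entropy (- logit p) x - logit p * x\<^sup>2 - ln (1 - p)) has_real_derivative
      (logit y - logit p)) (at y)"
    by (simp add: algebra_simps)
  then show ?thesis
    by (rule has_field_derivative_transform_within_open[where S = "{0<..<1}"])
       (use y rel_entropy_sym_entropy[OF p] in auto)
qed

lemma logit_strict_mono: "0 < a \<Longrightarrow> a < b \<Longrightarrow> b < 1 \<Longrightarrow> logit a < logit b"
  by (simp add: logit_def diff_strict_mono)

lemma Rolle_zero:
  fixes f f' :: "real \<Rightarrow> real"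
  assumes "a < b" "f a = f b" "continuous_on {a..b} f"
    and f': "\<And>x. a < x \<Longrightarrow> x < b \<Longrightarrow> (f has_real_derivative f' x) (at x)"
  shows "\<exists>z. a < z \<and> z < b \<and> f' z = 0"
proof -
  obtain z where z: "a < z" "z < b" "(f has_real_derivative 0) (at z)"
    using Rolle[OF assms(1-3)] f' real_differentiable_def by blast
  then show ?thesis using DERIV_unique[OF f'[of z] z(3)] by blast
qed

text \<open>In the variable \<open>x = y ^ d\<close> the function \<open>rel_entropy p\<close> is convex, then concave, then
  convex: the sign of its second derivative is that of the strictly convex function \<open>q\<close> below.
  A global contact point strictly between two others would lie in the concave part.\<close>

lemma no_two_sided_contact:
  fixes p r s :: real and d :: nat
  assumes p: "0 < p" "p < 1" and r: "0 < r" "r < 1" and d: "d \<ge> 2"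
    and M_def: "\<And>y. M y = rel_entropy p y - s * y ^ d"
    and min: "\<And>y. y \<in> {0..1} \<Longrightarrow> M r \<le> M y"
    and y: "0 \<le> y1" "y1 < r" "r < y2" "y2 \<le> 1" "M y1 = M r" "M y2 = M r"
  shows False
proof -
  define M' where "M' y = logit y - logit p - s * (real d * y ^ (d - 1))" for y
  have contM: "continuous_on {a..b} M" if "0 \<le> a" "b \<le> 1" for a b
    unfolding M_def
    by (intro continuous_intros continuous_on_subset[OF continuous_on_rel_entropy[OF p]]) (use that in auto)
  have dM: "(M has_real_derivative M' y) (at y)" if "0 < y" "y < 1" for y
    unfolding M_def M'_def
    by (rule derivative_eq_intros DERIV_rel_entropy refl | use that p d in simp)+
  have M'r: "M' r = 0"
    using dM[OF r] by (rule DERIV_local_min[where d = "min r (1 - r)"]) (use r min in \<open>auto simp: abs_less_iff\<close>)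
  \<comment> \<open>Equal values of \<open>M\<close> at \<open>y1\<close>, \<open>r\<close> and
    \<open>y2\<close> give a critical point on each side of \<open>r\<close>; together with the
    minimum \<open>r\<close> itself, \<open>M'\<close> has three zeros.\<close>
  have "\<exists>z>y1. z < r \<and> M' z = 0"
    by (rule Rolle_zero[where f = M]) (use y r in \<open>auto intro!: contM dM\<close>)
  then obtain z1 where z1: "y1 < z1" "z1 < r" "M' z1 = 0" by blast
  have "\<exists>z>r. z < y2 \<and> M' z = 0"
    by (rule Rolle_zero[where f = M]) (use y r in \<open>auto intro!: contM dM\<close>)
  then obtain z2 where z2: "r < z2" "z2 < y2" "M' z2 = 0" by blast
  \<comment> \<open>Division by \<open>y ^ (d - 1)\<close> turns the term with \<open>s\<close> into
    a constant. Zeros of \<open>M'\<close> become points where \<open>N\<close> takes one common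
    value, so Rolle applies again, and the result is independent of \<open>s\<close>.\<close>
  define N where "N y = (logit y - logit p) / y ^ (d - 1)" for y
  have N_M': "N y = s * real d + M' y / y ^ (d - 1)" if "0 < y" for y
    using that by (simp add: N_def M'_def field_simps)
  define q where "q y = 1 - (real d - 1) * (1 - y) * (logit y - logit p)" for y
  define N' where "N' y = q y / ((1 - y) * y ^ d)" for y
  have dN: "(N has_real_derivative N' y) (at y)" if "0 < y" "y < 1" for y
  proof -
    obtain k where k: "d = Suc (Suc k)" using le_Suc_ex[OF d] by auto
    have d1: "real (d - 1) = real d - 1" "y ^ d = y ^ (d - 2) * y * y" "y ^ (d - 1) = y ^ (d - 2) * y"
      by (simp_all add: k)
    have "(N has_real_derivative
        (1 / (y * (1 - y)) * y ^ (d - 1) - (logit y - logit p) * (real (d - 1) * y ^ (d - 2)))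
          / (y ^ (d - 1) * y ^ (d - 1))) (at y)"
      unfolding N_def
      by (rule derivative_eq_intros DERIV_logit refl | use that k in simp)+
    moreover have "(1 / (y * (1 - y)) * y ^ (d - 1) - (logit y - logit p) * (real (d - 1) * y ^ (d - 2)))
          / (y ^ (d - 1) * y ^ (d - 1)) = N' y"
      unfolding N'_def q_def d1 using that by (simp add: divide_simps) (simp add: algebra_simps)
    ultimately show ?thesis by simp
  qed
  have contN: "continuous_on {a..b} N" if "0 < a" "b < 1" for a b
    using dN that by (meson DERIV_atLeastAtMost_imp_continuous_on order.strict_trans1 order.strict_trans2)
  have Neq: "N z1 = N r" "N r = N z2"
    using N_M' z1 z2 M'r r y by auto
  have "\<exists>z>z1. z < r \<and> N' z = 0"
    by (rule Rolle_zero[where f = N]) (use Neq y r z1 in \<open>auto intro!: contN dN\<close>)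
  then obtain c1 where c1: "z1 < c1" "c1 < r" "N' c1 = 0" by blast
  have "\<exists>z>r. z < z2 \<and> N' z = 0"
    by (rule Rolle_zero[where f = N]) (use Neq y r z2 in \<open>auto intro!: contN dN\<close>)
  then obtain c2 where c2: "r < c2" "c2 < z2" "N' c2 = 0" by blast
  have c01: "0 < c1" "c1 < 1" "0 < c2" "c2 < 1" using c1 c2 z1 z2 y r by auto
  have qc: "q c1 = 0" "q c2 = 0" using c1(3) c2(3) c01 by (auto simp: N'_def)
  define q' where "q' y = (real d - 1) * (logit y - logit p - 1 / y)" for y
  have dq: "(q has_real_derivative q' y) (at y)" if "0 < y" "y < 1" for y
    unfolding q_def q'_def
    by (rule derivative_eq_intros DERIV_logit refl | use that in \<open>simp add: field_simps\<close>)+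
  \<comment> \<open>\<open>q'\<close> is strictly increasing, so \<open>q\<close> is strictly convex
    and negative between its zeros. A nonnegative value in between would give
    \<open>q' a \<ge> 0 \<ge> q' b\<close> with \<open>a < b\<close>.\<close>
  have q_neg: "q x < 0" if x: "c1 < x" "x < c2" for x
  proof (rule ccontr)
    assume nn: "\<not> q x < 0"
    obtain a where a: "c1 < a" "a < x" "q x - q c1 = (x - c1) * q' a"
      using MVT2[OF x(1), of q q'] dq c01 x by auto
    obtain b where b: "x < b" "b < c2" "q c2 - q x = (c2 - x) * q' b"
      using MVT2[OF x(2), of q q'] dq c01 x by auto
    have "q' a \<ge> 0" using a nn qc by (simp add: not_less zero_le_mult_iff)
    moreover have "(c2 - x) * q' b \<le> 0" using b nn qc by linarith
    then have "q' b \<le> 0" using b by (simp add: mult_le_0_iff)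
    moreover have "q' a < q' b"
    proof -
      have "logit a < logit b" by (rule logit_strict_mono) (use a b c01 in auto)
      moreover have "1 / b < 1 / a" using a b c01 by (simp add: frac_less2)
      ultimately show ?thesis using d by (simp add: q'_def)
    qed
    ultimately show False by simp
  qed
  \<comment> \<open>\<open>N\<close> decreases towards \<open>r\<close>, hence \<open>M'\<close> is
    positive just to the left of \<open>r\<close>. So \<open>M\<close> increases up to
    \<open>r\<close>, against its minimality there.\<close>
  have N_gt: "N x > N r" if x: "c1 < x" "x < r" for x
  proof (rule DERIV_neg_imp_decreasing[OF x(2)])
    fix t assume t: "x \<le> t" "t \<le> r"
    have "N' t < 0" unfolding N'_def
      by (rule divide_neg_pos) (use q_neg[of t] t x c2 c01 in auto)
    then show "\<exists>y. (N has_real_derivative y) (at t) \<and> y < 0" using dN[of t] t x c01 r by auto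
  qed
  define a where "a = (c1 + r) / 2"
  have a: "c1 < a" "a < r" using c1 by (auto simp: a_def)
  have "M a < M r"
  proof (rule DERIV_pos_imp_increasing_open[OF a(2)])
    fix x assume x: "a < x" "x < r"
    have "M' x / x ^ (d - 1) > 0"
      using N_gt[of x] N_M'[of x] N_M'[of r] M'r x a c01 r by simp
    then have "M' x > 0" using x a c01 by (simp add: zero_less_divide_iff)
    then show "\<exists>y. (M has_real_derivative y) (at x) \<and> y > 0" using dM[of x] x a c01 r by auto
  qed (use contM a c01 r in auto)
  then show False using min[of a] a c01 r by simp
qed

text \<open>The mixed product \<open>y * r ^ (d - 1)\<close> is compared with \<open>y ^ d\<close>.
  This converts closeness of \<open>d\<close>-th powers into closeness of the weights
  themselves.\<close>

lemma power_diff_lower: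
  fixes y r :: real
  assumes "0 \<le> y" "0 \<le> r" "d \<ge> 1"
  shows "r ^ (d - 1) * \<bar>y - r\<bar> \<le> \<bar>y ^ d - r ^ d\<bar>"
proof -
  obtain k where k: "d = Suc k" using assms by (metis Suc_le_D One_nat_def)
  show ?thesis
  proof (cases "r \<le> y")
    case True
    then have "y * r ^ k \<le> y * y ^ k" by (intro mult_left_mono power_mono) (use assms in auto)
    then show ?thesis using True power_mono[OF True, of d] assms by (simp add: k algebra_simps)
  next
    case False
    then have "y * y ^ k \<le> y * r ^ k" by (intro mult_left_mono power_mono) (use assms in auto)
    then show ?thesis using False power_mono[of y r d] assms by (simp add: k algebra_simps)
  qed
qed

lemma continuous_pos_lower_bound:
  fixes D :: "real \<Rightarrow> real"
  assumes "continuous_on S D" "compact S" "\<And>y. y \<in> S \<Longrightarrow> D y > 0"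
  obtains \<kappa> where "\<kappa> > 0" "\<And>y. y \<in> S \<Longrightarrow> D y \<ge> \<kappa>"
proof (cases "S = {}")
  case False
  then obtain m where "m \<in> S" "\<And>y. y \<in> S \<Longrightarrow> D m \<le> D y"
    using continuous_attains_inf[OF assms(2) _ assms(1)] by auto
  then show ?thesis using that[of "D m"] assms(3) by blast
qed (use that[of 1] in auto)

text \<open>Let \<open>D\<close> be the height of the entropy above the supporting line and
  \<open>X = y ^ d - r ^ d\<close>. The two hypotheses make the total of \<open>D\<close> small and
  bound the total of \<open>X\<close>. On one side of \<open>r\<close> the function \<open>D\<close>
  has no zero, so there \<open>D\<close> dominates that one-sided part of \<open>X\<close>; since
  the total of \<open>X\<close> is under control, one part suffices for the sum of
  \<open>\<bar>X\<bar>\<close>.\<close>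

lemma entropy_stability:
  fixes p r s :: real and d :: nat
  assumes p: "0 < p" "p \<le> r" "r < 1" and d: "d \<ge> 2" and \<delta>: "\<delta> > 0"
    and supp: "\<And>y. y \<in> {0..1} \<Longrightarrow> rel_entropy p r + s * (y ^ d - r ^ d) \<le> rel_entropy p y"
  shows "\<exists>c>0. \<forall>(E::'b set) w. finite E \<longrightarrow> (\<forall>e\<in>E. w e \<in> {0..1}) \<longrightarrow>
       (\<Sum>e\<in>E. w e ^ d) \<ge> (r ^ d - c) * real (card E) \<longrightarrow>
       (\<Sum>e\<in>E. rel_entropy p (w e)) \<le> (rel_entropy p r + c) * real (card E) \<longrightarrow>
       (\<Sum>e\<in>E. \<bar>w e - r\<bar>) \<le> \<delta> * real (card E)"
proof -
  have p1: "p < 1" and r: "0 < r" "r < 1" using p by auto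
  have "d > 0" using d by simp
  moreover have "\<forall>y\<in>{0..1}. rel_entropy p r + s * (y ^ d - r ^ d) \<le> rel_entropy p y" using supp by blast
  ultimately obtain s where s0: "s \<ge> 0" and s1: "s > 0 \<or> p = r"
    and "\<forall>y\<in>{0..1}. rel_entropy p r + s * (y ^ d - r ^ d) \<le> rel_entropy p y"
    using support_slope_nonneg[OF p] by metis
  note supp = this(3)[rule_format]
  define D where "D y = rel_entropy p y - rel_entropy p r - s * (y ^ d - r ^ d)" for y
  define X where "X y = y ^ d - r ^ d" for y
  have D0: "D y \<ge> 0" if "y \<in> {0..1}" for y using supp[OF that] by (simp add: D_def)
  have contD: "continuous_on {a..b} D" if "0 \<le> a" "b \<le> 1" for a b
    unfolding D_def
    by (intro continuous_intros continuous_on_subset[OF continuous_on_rel_entropy[OF p(1) p1]]) (use that in auto)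
  \<comment> \<open>When the zero-free side is the left one, the total of \<open>X\<close> must be
    bounded from above, which the entropy hypothesis does only for \<open>s > 0\<close>. If
    \<open>p = r\<close> and \<open>D\<close> has a zero to the right, then \<open>s > 0\<close> and
    \<open>D\<close> is positive on the left.\<close>
  have oneside: "(\<forall>y\<in>{0..<r}. D y > 0) \<and> s > 0 \<or> (\<forall>y\<in>{r<..1}. D y > 0)"
  proof (cases "p = r")
    case True
    show ?thesis
    proof (cases "\<forall>y\<in>{r<..1}. D y > 0")
      case False
      then obtain y where y: "r < y" "y \<le> 1" "\<not> D y > 0" by auto
      then have "D y = 0" using D0[of y] r by auto
      then have "s * (y ^ d - r ^ d) > 0" using rel_entropy_pos[of p y] True p p1 y by (simp add: D_def)
      then have "s > 0" using s0 by (cases "s = 0") auto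
      moreover have "D y1 > 0" if "y1 \<in> {0..<r}" for y1
      proof -
        have "y1 ^ d \<le> r ^ d" using that by (intro power_mono) auto
        then have "s * (y1 ^ d - r ^ d) \<le> 0" using s0 by (simp add: mult_le_0_iff)
        then show ?thesis using rel_entropy_pos[of p y1] that True p p1 by (simp add: D_def)
      qed
      ultimately show ?thesis by auto
    qed auto
  next
    case False
    then have "s > 0" using s1 by auto
    moreover have "(\<forall>y\<in>{0..<r}. D y > 0) \<or> (\<forall>y\<in>{r<..1}. D y > 0)"
    proof (rule ccontr)
      assume "\<not> ?thesis"
      then obtain y1 y2 where y: "0 \<le> y1" "y1 < r" "\<not> D y1 > 0" "r < y2" "y2 \<le> 1" "\<not> D y2 > 0" by auto
      then have z: "D y1 = 0" "D y2 = 0" using D0[of y1] D0[of y2] r by auto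
      show False
        by (rule no_two_sided_contact[of p r d "\<lambda>y. rel_entropy p y - s * y ^ d" s y1 y2])
          (use y z p p1 r d supp in \<open>auto simp: D_def algebra_simps\<close>)
    qed
    ultimately show ?thesis by auto
  qed
  define b where "b = \<delta> * r ^ (d - 1)"
  have b0: "b > 0" using \<delta> r by (simp add: b_def)
  \<comment> \<open>Radius of the window around \<open>r\<close> in which \<open>D\<close> says
    nothing. There \<open>\<bar>X\<bar> \<le> real d * \<delta>1\<close>, and twice that uses up
    half of \<open>b\<close>.\<close>
  define \<delta>1 where "\<delta>1 = b / (4 * real d)"
  have \<delta>1: "\<delta>1 > 0" "2 * (real d * \<delta>1) = b / 2" using b0 d by (auto simp: \<delta>1_def)
  have absX: "\<bar>X y\<bar> \<le> real d * \<bar>y - r\<bar>" if "y \<in> {0..1}" for y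
    using norm_power_diff[of y r d] that r by (simp add: X_def)
  have absX1: "\<bar>X y\<bar> \<le> 1" if "y \<in> {0..1}" for y
  proof -
    have "y ^ d \<in> {0..1}" "r ^ d \<in> {0..1}" using that r by (auto simp: power_le_one)
    then show ?thesis by (auto simp: X_def abs_le_iff)
  qed
  \<comment> \<open>\<open>\<kappa>\<close> is a lower bound for \<open>D\<close> outside the window
    on the zero-free side, so that \<open>D / \<kappa> \<ge> 1 \<ge> \<bar>X\<bar>\<close>
    there.\<close>
  obtain \<kappa> where \<kappa>: "\<kappa> > 0"
    and side: "(s > 0 \<and> (\<forall>y\<in>{0..1}. max 0 (- X y) \<le> real d * \<delta>1 + D y / \<kappa>)) \<or>
       (\<forall>y\<in>{0..1}. max 0 (X y) \<le> real d * \<delta>1 + D y / \<kappa>)"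
  proof -
    from oneside show ?thesis
    proof (elim disjE conjE)
      assume pos: "\<forall>y\<in>{0..<r}. D y > 0" and s: "s > 0"
      obtain \<kappa> where \<kappa>: "\<kappa> > 0" "\<And>y. y \<in> {0..r - \<delta>1} \<Longrightarrow> D y \<ge> \<kappa>"
        by (rule continuous_pos_lower_bound[of "{0..r - \<delta>1}" D]) (use contD r \<delta>1 pos in auto)
      have "max 0 (- X y) \<le> real d * \<delta>1 + D y / \<kappa>" if y: "y \<in> {0..1}" for y
      proof (cases "y \<le> r - \<delta>1")
        case True
        have "D y / \<kappa> \<ge> 1" using \<kappa> True y by simp
        moreover have "real d * \<delta>1 \<ge> 0" using \<delta>1 by simp
        ultimately show ?thesis using absX1[OF y] by linarith
      next
        case False
        have "- X y \<le> real d * \<delta>1"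
        proof (cases "y \<le> r")
          case True
          then have "- X y \<le> real d * (r - y)" using absX[OF y] by (simp add: abs_le_iff)
          also have "\<dots> \<le> real d * \<delta>1" using False by (intro mult_left_mono) auto
          finally show ?thesis .
        next
          case F: False
          then have "X y \<ge> 0" using r power_mono[of r y d] by (simp add: X_def)
          moreover have "real d * \<delta>1 \<ge> 0" using \<delta>1 by simp
          ultimately show ?thesis by linarith
        qed
        moreover have "D y / \<kappa> \<ge> 0" "real d * \<delta>1 \<ge> 0" using D0[OF y] \<kappa> \<delta>1 by auto
        ultimately show ?thesis by (simp add: max_def)
      qed
      then show ?thesis using that[OF \<kappa>(1)] s by blast
    next
      assume pos: "\<forall>y\<in>{r<..1}. D y > 0"
      obtain \<kappa> where \<kappa>: "\<kappa> > 0" "\<And>y. y \<in> {r + \<delta>1..1} \<Longrightarrow> D y \<ge> \<kappa>"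
        by (rule continuous_pos_lower_bound[of "{r + \<delta>1..1}" D]) (use contD r \<delta>1 pos in auto)
      have "max 0 (X y) \<le> real d * \<delta>1 + D y / \<kappa>" if y: "y \<in> {0..1}" for y
      proof (cases "y \<ge> r + \<delta>1")
        case True
        have "D y / \<kappa> \<ge> 1" using \<kappa> True y by simp
        moreover have "real d * \<delta>1 \<ge> 0" using \<delta>1 by simp
        ultimately show ?thesis using absX1[OF y] by linarith
      next
        case False
        have "X y \<le> real d * \<delta>1"
        proof (cases "y \<ge> r")
          case True
          then have "X y \<le> real d * (y - r)" using absX[OF y] by (simp add: abs_le_iff)
          also have "\<dots> \<le> real d * \<delta>1" using False by (intro mult_left_mono) auto
          finally show ?thesis .
        next
          case F: False
          then have "X y \<le> 0" using y power_mono[of y r d] by (simp add: X_def)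
          moreover have "real d * \<delta>1 \<ge> 0" using \<delta>1 by simp
          ultimately show ?thesis by linarith
        qed
        moreover have "D y / \<kappa> \<ge> 0" "real d * \<delta>1 \<ge> 0" using D0[OF y] \<kappa> \<delta>1 by auto
        ultimately show ?thesis by (simp add: max_def)
      qed
      then show ?thesis using that[OF \<kappa>(1)] by blast
    qed
  qed
  \<comment> \<open>Collects the errors per unit of \<open>c\<close>: the first summand from the
    total of \<open>D\<close>, the second from the lower bound on the total of \<open>X\<close>, the
    third from its upper bound. For \<open>s = 0\<close> the value of \<open>1 / s\<close> is 0, and
    the branch with the third error does not occur.\<close>
  define T where "T = 2 * (1 + s) / \<kappa> + 1 + 1 / s"
  have "2 * (1 + s) / \<kappa> \<ge> 0" "1 / s \<ge> 0" using s0 \<kappa> by auto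
  then have T: "T > 0" unfolding T_def by linarith
  define c where "c = b / 2 / T"
  have c: "c > 0" "c * T = b / 2" using b0 T by (auto simp: c_def)
  show ?thesis
  proof (intro exI[of _ c] conjI allI impI c(1))
    fix E :: "'b set" and w :: "'b \<Rightarrow> real"
    assume fin: "finite E" and w: "\<forall>e\<in>E. w e \<in> {0..1}"
      and A: "(\<Sum>e\<in>E. w e ^ d) \<ge> (r ^ d - c) * real (card E)"
      and B: "(\<Sum>e\<in>E. rel_entropy p (w e)) \<le> (rel_entropy p r + c) * real (card E)"
    let ?n = "real (card E)"
    have SX: "(\<Sum>e\<in>E. X (w e)) \<ge> - c * ?n"
      using A by (simp add: X_def sum_subtractf algebra_simps)
    have SDeq: "(\<Sum>e\<in>E. D (w e)) = (\<Sum>e\<in>E. rel_entropy p (w e)) - rel_entropy p r * ?n - s * (\<Sum>e\<in>E. X (w e))"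
      by (simp add: D_def X_def sum_subtractf sum.distrib sum_distrib_left algebra_simps)
    have SD0: "(\<Sum>e\<in>E. D (w e)) \<ge> 0" using D0 w by (intro sum_nonneg) auto
    have SD: "(\<Sum>e\<in>E. D (w e)) \<le> (1 + s) * c * ?n"
      using SDeq B mult_left_mono[OF SX s0] by (simp add: algebra_simps)
    have "(\<Sum>e\<in>E. \<bar>X (w e)\<bar>) \<le> b * ?n"
    proof -
      have bound: "(\<Sum>e\<in>E. real d * \<delta>1 + D (w e) / \<kappa>) \<le> (real d * \<delta>1 + (1 + s) * c / \<kappa>) * ?n"
      proof -
        have "(\<Sum>e\<in>E. D (w e)) / \<kappa> \<le> (1 + s) * c * ?n / \<kappa>" using SD \<kappa> by (simp add: divide_right_mono)
        then show ?thesis by (simp add: sum.distrib algebra_simps flip: sum_divide_distrib)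
      qed
      define Y where "Y = (1 + s) * c / \<kappa> * ?n"
      define Z where "Z = real d * \<delta>1 * ?n"
      have YZ: "(real d * \<delta>1 + (1 + s) * c / \<kappa>) * ?n = Z + Y" by (simp only: Y_def Z_def distrib_right)
      have bn: "b * ?n = b / 2 * ?n + b / 2 * ?n" by (simp flip: distrib_right)
      have cT: "b / 2 * ?n = 2 * Y + c * ?n + c / s * ?n" unfolding Y_def
        using c(2) by (simp flip: c(2) add: T_def algebra_simps)
      have cs: "c / s * ?n \<ge> 0" using c s0 by simp
      have cn: "c * ?n \<ge> 0" using c by simp
      have d1: "2 * Z = b / 2 * ?n" unfolding Z_def using \<delta>1(2) by (metis mult.assoc)
      have arith: "S \<le> N + N"
        if "S \<le> P + 2 * (Z + Y)" "N = 2 * Y + Q + P \<or> N = 2 * Y + P + Q" "0 \<le> Q" "2 * Z = N" for S N P Q :: real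
        using that by argo
      from side show ?thesis
      proof (elim disjE conjE)
        assume s: "s > 0" and m: "\<forall>y\<in>{0..1}. max 0 (- X y) \<le> real d * \<delta>1 + D y / \<kappa>"
        have "s * (\<Sum>e\<in>E. X (w e)) \<le> c * ?n" using SDeq SD0 B by (simp add: algebra_simps)
        then have SXu: "(\<Sum>e\<in>E. X (w e)) \<le> c / s * ?n" using s by (simp add: field_simps)
        have "(\<Sum>e\<in>E. \<bar>X (w e)\<bar>) = (\<Sum>e\<in>E. X (w e)) + 2 * (\<Sum>e\<in>E. max 0 (- X (w e)))"
          by (simp add: sum_distrib_left flip: sum.distrib) (rule sum.cong, auto)
        also have "(\<Sum>e\<in>E. max 0 (- X (w e))) \<le> (\<Sum>e\<in>E. real d * \<delta>1 + D (w e) / \<kappa>)"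
          using m w by (intro sum_mono) auto
        finally have "(\<Sum>e\<in>E. \<bar>X (w e)\<bar>) \<le> c / s * ?n + 2 * ((real d * \<delta>1 + (1 + s) * c / \<kappa>) * ?n)"
          using bound SXu by linarith
        then show ?thesis unfolding YZ bn by (rule arith) (use cT cn d1 in auto)
      next
        assume m: "\<forall>y\<in>{0..1}. max 0 (X y) \<le> real d * \<delta>1 + D y / \<kappa>"
        have "(\<Sum>e\<in>E. \<bar>X (w e)\<bar>) = 2 * (\<Sum>e\<in>E. max 0 (X (w e))) - (\<Sum>e\<in>E. X (w e))"
          by (simp add: sum_distrib_left flip: sum_subtractf) (rule sum.cong, auto)
        moreover have "(\<Sum>e\<in>E. max 0 (X (w e))) \<le> (\<Sum>e\<in>E. real d * \<delta>1 + D (w e) / \<kappa>)"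
          using m w by (intro sum_mono) auto
        ultimately have "(\<Sum>e\<in>E. \<bar>X (w e)\<bar>) \<le> c * ?n + 2 * ((real d * \<delta>1 + (1 + s) * c / \<kappa>) * ?n)"
          using bound SX by linarith
        then show ?thesis unfolding YZ bn by (rule arith) (use cT cs d1 in auto)
      qed
    qed
    moreover have "r ^ (d - 1) * (\<Sum>e\<in>E. \<bar>w e - r\<bar>) \<le> (\<Sum>e\<in>E. \<bar>X (w e)\<bar>)"
      unfolding sum_distrib_left X_def using w r d by (intro sum_mono power_diff_lower) auto
    ultimately have "r ^ (d - 1) * (\<Sum>e\<in>E. \<bar>w e - r\<bar>) \<le> r ^ (d - 1) * (\<delta> * ?n)"
      by (simp add: b_def mult_ac)
    then show "(\<Sum>e\<in>E. \<bar>w e - r\<bar>) \<le> \<delta> * ?n" using r by simp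
  qed
qed

section \<open>Finner's inequality for regular graphs\<close>

text \<open>Hoelder's inequality for \<open>d\<close> functions with all exponents \<open>d\<close>:
  scale each function to \<open>d\<close>-norm 1 and apply the inequality of arithmetic and
  geometric means pointwise. A function of norm 0 makes both sides vanish.\<close>

lemma holder_prod_sum:
  fixes a :: "'i \<Rightarrow> 'b \<Rightarrow> real"
  assumes I: "finite I" "card I = d" "d > 0" and a: "\<And>i x. i \<in> I \<Longrightarrow> x \<in> S \<Longrightarrow> a i x \<ge> 0"
    and S: "finite S"
  shows "(\<Sum>x\<in>S. \<Prod>i\<in>I. a i x) \<le> (\<Prod>i\<in>I. root d (\<Sum>x\<in>S. a i x ^ d))"
proof -
  define A where "A i = (\<Sum>x\<in>S. a i x ^ d)" for i
  have A0: "A i \<ge> 0" if "i \<in> I" for i using a that by (auto simp: A_def intro!: sum_nonneg)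
  show ?thesis
  proof (cases "\<exists>i\<in>I. A i = 0")
    case True
    then obtain i where i: "i \<in> I" "A i = 0" by blast
    then have "a i x = 0" if "x \<in> S" for x
      using that a S \<open>d > 0\<close> sum_nonneg_eq_0_iff[of S "\<lambda>x. a i x ^ d"] by (auto simp: A_def)
    then have "(\<Prod>i\<in>I. a i x) = 0" if "x \<in> S" for x using that i I by (auto intro: prod_zero)
    then show ?thesis using A0 \<open>d > 0\<close> by (auto simp: A_def intro!: prod_nonneg)
  next
    case False
    then have Ap: "A i > 0" if "i \<in> I" for i using A0[OF that] that by force
    define b where "b i x = a i x / root d (A i)" for i x
    have b0: "b i x \<ge> 0" if "i \<in> I" "x \<in> S" for i x
      using a[OF that] A0[OF that(1)] \<open>d > 0\<close> by (simp add: b_def)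
    have amgm: "(\<Prod>i\<in>I. b i x) \<le> (\<Sum>i\<in>I. b i x ^ d) / d" if x: "x \<in> S" for x
    proof -
      have "(\<Prod>i\<in>I. b i x ^ d) powr (1 / card I) \<le> (\<Sum>i\<in>I. b i x ^ d / card I)"
        using I b0 x by (intro arith_geom_mean) auto
      moreover have "(\<Prod>i\<in>I. b i x ^ d) powr (1 / card I) = (\<Prod>i\<in>I. b i x)"
      proof -
        define P where "P = (\<Prod>i\<in>I. b i x)"
        have P: "P \<ge> 0" using b0 x by (auto simp: P_def intro!: prod_nonneg)
        have "(P ^ d) powr (1 / d) = P"
        proof (cases "P = 0")
          case False
          then have "(P powr d) powr (1 / d) = P" using P \<open>d > 0\<close> by (simp add: powr_powr)
          then show ?thesis using P False by (simp add: powr_realpow)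
        qed (use \<open>d > 0\<close> in simp)
        then show ?thesis using I by (simp add: P_def prod_power_distrib)
      qed
      ultimately show ?thesis using I by (simp add: sum_divide_distrib)
    qed
    have "(\<Sum>x\<in>S. \<Prod>i\<in>I. b i x) \<le> (\<Sum>x\<in>S. (\<Sum>i\<in>I. b i x ^ d) / d)"
      using amgm by (intro sum_mono) auto
    also have "\<dots> = (\<Sum>i\<in>I. \<Sum>x\<in>S. b i x ^ d) / d"
      by (subst sum.swap) (simp add: sum_divide_distrib)
    also have "(\<Sum>i\<in>I. \<Sum>x\<in>S. b i x ^ d) = (\<Sum>i\<in>I. 1)"
    proof (rule sum.cong)
      fix i assume i: "i \<in> I"
      have "(\<Sum>x\<in>S. b i x ^ d) = A i / (root d (A i)) ^ d"
        by (simp add: b_def A_def power_divide sum_divide_distrib)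
      then show "(\<Sum>x\<in>S. b i x ^ d) = 1" using Ap[OF i] \<open>d > 0\<close> by simp
    qed simp
    finally have le1: "(\<Sum>x\<in>S. \<Prod>i\<in>I. b i x) \<le> 1" using I by simp
    have "(\<Sum>x\<in>S. \<Prod>i\<in>I. a i x) = (\<Prod>i\<in>I. root d (A i)) * (\<Sum>x\<in>S. \<Prod>i\<in>I. b i x)"
    proof -
      have "root d (A i) * b i x = a i x" if "i \<in> I" for i x
        using Ap[OF that] \<open>d > 0\<close> by (simp add: b_def)
      then show ?thesis by (simp add: sum_distrib_left flip: prod.distrib)
    qed
    also have "\<dots> \<le> (\<Prod>i\<in>I. root d (A i))"
      using le1 A0 \<open>d > 0\<close> by (intro mult_left_le prod_nonneg) auto
    finally show ?thesis by (simp add: A_def)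
  qed
qed

lemma sum_PiE_insert:
  assumes "v \<notin> U"
  shows "(\<Sum>\<phi>\<in>insert v U \<rightarrow>\<^sub>E S. F \<phi>) = (\<Sum>\<phi>\<in>U \<rightarrow>\<^sub>E S. \<Sum>x\<in>S. F (\<phi>(v := x)))"
proof -
  have "(\<Sum>\<phi>\<in>insert v U \<rightarrow>\<^sub>E S. F \<phi>) = (\<Sum>(x, \<phi>)\<in>S \<times> (U \<rightarrow>\<^sub>E S). F (\<phi>(v := x)))"
    using inj_combinator[OF assms, of "\<lambda>_. S"]
    by (simp add: PiE_insert_eq sum.reindex case_prod_unfold o_def)
  also have "\<dots> = (\<Sum>x\<in>S. \<Sum>\<phi>\<in>U \<rightarrow>\<^sub>E S. F (\<phi>(v := x)))"
    by (rule sum.cartesian_product[symmetric])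
  finally show ?thesis by (subst sum.swap)
qed

text \<open>One variable is summed out at a time. Exactly \<open>d\<close> factors depend on
  \<open>v\<close>, so Hoelder applies to them and the others pass through. Replacing each of the
  \<open>d\<close> factors by its \<open>d\<close>-norm in \<open>v\<close>, which is
  \<open>g\<close>, leaves its full \<open>d\<close>-norm unchanged, so the induction hypothesis
  gives the same right side.\<close>

lemma finner_inequality:
  fixes f :: "'i \<Rightarrow> ('v \<Rightarrow> 'b) \<Rightarrow> real"
  assumes U: "finite U" and I: "finite I" and S: "finite S" and d: "d > 0"
    and e: "\<And>i. i \<in> I \<Longrightarrow> e i \<subseteq> U"
    and deg: "\<And>v. v \<in> U \<Longrightarrow> card {i \<in> I. v \<in> e i} = d"
    and f0: "\<And>i \<phi>. i \<in> I \<Longrightarrow> f i \<phi> \<ge> 0"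
    and f: "\<And>i \<phi> \<psi>. i \<in> I \<Longrightarrow> (\<And>v. v \<in> e i \<Longrightarrow> \<phi> v = \<psi> v) \<Longrightarrow> f i \<phi> = f i \<psi>"
  shows "(\<Sum>\<phi>\<in>U \<rightarrow>\<^sub>E S. \<Prod>i\<in>I. f i \<phi>) \<le> (\<Prod>i\<in>I. root d (\<Sum>\<phi>\<in>e i \<rightarrow>\<^sub>E S. f i \<phi> ^ d))"
  using U e deg f0 f
proof (induction U arbitrary: e f rule: finite_induct)
  case empty
  have "root d (\<Sum>\<phi>\<in>e i \<rightarrow>\<^sub>E S. f i \<phi> ^ d) = f i (\<lambda>_. undefined)" if "i \<in> I" for i
  proof -
    have "e i = {}" using empty.prems(1)[OF that] by simp
    then show ?thesis using empty.prems(3)[OF that, of "\<lambda>_. undefined"] d by (simp add: real_root_power_cancel)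
  qed
  then show ?case by simp
next
  case (insert v U)
  define g where "g i \<phi> = (if v \<in> e i then root d (\<Sum>x\<in>S. f i (\<phi>(v := x)) ^ d) else f i \<phi>)" for i \<phi>
  define I1 where "I1 = {i \<in> I. v \<in> e i}"
  have I1: "finite I1" "I1 \<subseteq> I" "card I1 = d" using I insert.prems(2)[of v] by (auto simp: I1_def)
  have "(\<Sum>\<phi>\<in>insert v U \<rightarrow>\<^sub>E S. \<Prod>i\<in>I. f i \<phi>) = (\<Sum>\<phi>\<in>U \<rightarrow>\<^sub>E S. \<Sum>x\<in>S. \<Prod>i\<in>I. f i (\<phi>(v := x)))"
    using insert.hyps by (rule_tac sum_PiE_insert)
  also have "\<dots> \<le> (\<Sum>\<phi>\<in>U \<rightarrow>\<^sub>E S. \<Prod>i\<in>I. g i \<phi>)"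
  proof (rule sum_mono)
    fix \<phi> :: "'v \<Rightarrow> 'b"
    have "(\<Sum>x\<in>S. \<Prod>i\<in>I. f i (\<phi>(v := x)))
        = (\<Sum>x\<in>S. (\<Prod>i\<in>I - I1. f i \<phi>) * (\<Prod>i\<in>I1. f i (\<phi>(v := x))))"
    proof (rule sum.cong)
      fix x
      have "(\<Prod>i\<in>I - I1. f i (\<phi>(v := x))) = (\<Prod>i\<in>I - I1. f i \<phi>)"
        by (intro prod.cong refl insert.prems(4)) (auto simp: I1_def)
      then show "(\<Prod>i\<in>I. f i (\<phi>(v := x))) = (\<Prod>i\<in>I - I1. f i \<phi>) * (\<Prod>i\<in>I1. f i (\<phi>(v := x)))"
        using prod.subset_diff[OF I1(2) I, of "\<lambda>i. f i (\<phi>(v := x))"] by simp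
    qed simp
    also have "\<dots> = (\<Prod>i\<in>I - I1. f i \<phi>) * (\<Sum>x\<in>S. \<Prod>i\<in>I1. f i (\<phi>(v := x)))"
      by (simp add: sum_distrib_left)
    also have "\<dots> \<le> (\<Prod>i\<in>I - I1. f i \<phi>) * (\<Prod>i\<in>I1. root d (\<Sum>x\<in>S. f i (\<phi>(v := x)) ^ d))"
      using I1 insert.prems(3) S d by (intro mult_left_mono holder_prod_sum prod_nonneg) auto
    also have "\<dots> = (\<Prod>i\<in>I - I1. g i \<phi>) * (\<Prod>i\<in>I1. g i \<phi>)"
      by (intro arg_cong2[where f = "(*)"] prod.cong) (auto simp: g_def I1_def)
    also have "\<dots> = (\<Prod>i\<in>I. g i \<phi>)" using prod.subset_diff[OF I1(2) I, of "\<lambda>i. g i \<phi>"] by simp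
    finally show "(\<Sum>x\<in>S. \<Prod>i\<in>I. f i (\<phi>(v := x))) \<le> (\<Prod>i\<in>I. g i \<phi>)" .
  qed
  also have "\<dots> \<le> (\<Prod>i\<in>I. root d (\<Sum>\<phi>\<in>(e i - {v}) \<rightarrow>\<^sub>E S. g i \<phi> ^ d))"
  proof (rule insert.IH)
    show "e i - {v} \<subseteq> U" if "i \<in> I" for i using insert.prems(1)[OF that] by auto
    show "card {i \<in> I. u \<in> e i - {v}} = d" if "u \<in> U" for u
    proof -
      have "{i \<in> I. u \<in> e i - {v}} = {i \<in> I. u \<in> e i}" using that insert.hyps by auto
      then show ?thesis using insert.prems(2)[of u] that by simp
    qed
    show "g i \<phi> \<ge> 0" if "i \<in> I" for i \<phi>
      using insert.prems(3)[OF that] d by (auto simp: g_def intro!: sum_nonneg)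
    show "g i \<phi> = g i \<psi>" if i: "i \<in> I" and *: "\<And>u. u \<in> e i - {v} \<Longrightarrow> \<phi> u = \<psi> u" for i \<phi> \<psi>
    proof (cases "v \<in> e i")
      case True
      have "f i (\<phi>(v := x)) = f i (\<psi>(v := x))" for x
        by (rule insert.prems(4)[OF i]) (use * in auto)
      then show ?thesis using True by (simp add: g_def)
    next
      case False
      have "f i \<phi> = f i \<psi>"
        by (rule insert.prems(4)[OF i]) (use * False in auto)
      then show ?thesis using False by (simp add: g_def)
    qed
  qed
  also have "\<dots> = (\<Prod>i\<in>I. root d (\<Sum>\<phi>\<in>e i \<rightarrow>\<^sub>E S. f i \<phi> ^ d))"
  proof (rule prod.cong)
    fix i assume i: "i \<in> I"
    show "root d (\<Sum>\<phi>\<in>(e i - {v}) \<rightarrow>\<^sub>E S. g i \<phi> ^ d) = root d (\<Sum>\<phi>\<in>e i \<rightarrow>\<^sub>E S. f i \<phi> ^ d)"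
    proof (cases "v \<in> e i")
      case True
      have "(\<Sum>\<phi>\<in>e i \<rightarrow>\<^sub>E S. f i \<phi> ^ d) = (\<Sum>\<phi>\<in>insert v (e i - {v}) \<rightarrow>\<^sub>E S. f i \<phi> ^ d)"
        using True by (simp add: insert_absorb)
      also have "\<dots> = (\<Sum>\<phi>\<in>(e i - {v}) \<rightarrow>\<^sub>E S. \<Sum>x\<in>S. f i (\<phi>(v := x)) ^ d)"
        by (rule sum_PiE_insert) simp
      also have "\<dots> = (\<Sum>\<phi>\<in>(e i - {v}) \<rightarrow>\<^sub>E S. g i \<phi> ^ d)"
        using True d insert.prems(3)[OF i] by (simp add: g_def sum_nonneg)
      finally show ?thesis by simp
    qed (simp add: g_def)
  qed simp
  finally show ?case .
qed

section \<open>Weighted homomorphism densities\<close>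

text \<open>Weights on vertex sets make \<open>w {x, y}\<close> a symmetric kernel with diagonal
  \<open>w {x}\<close>. A map that collapses an edge of \<open>H\<close> contributes a diagonal
  value: 0 for an actual graph, possibly positive for weights used as a template.\<close>

definition hom_sum :: "'a graph \<Rightarrow> nat \<Rightarrow> (nat set \<Rightarrow> real) \<Rightarrow> real" where
  "hom_sum H n w = (\<Sum>\<phi>\<in>verts H \<rightarrow>\<^sub>E {..<n}. \<Prod>e\<in>edges H. w (\<phi> ` e))"

definition weighted_density :: "'a graph \<Rightarrow> nat \<Rightarrow> (nat set \<Rightarrow> real) \<Rightarrow> real" where
  "weighted_density H n w = hom_sum H n w / real n ^ card (verts H)"

lemma finite_edges: "finite_simple_graph H \<Longrightarrow> finite (edges H)"
  unfolding finite_simple_graph_def all_edges_def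
  by (rule finite_subset[of _ "Pow (verts H)"]) auto

lemma edge_cases:
  assumes "finite_simple_graph H" "e \<in> edges H"
  obtains a b where "e = {a, b}" "a \<noteq> b" "a \<in> verts H" "b \<in> verts H"
proof -
  have "e \<subseteq> verts H" "card e = 2" using assms by (auto simp: finite_simple_graph_def all_edges_def)
  then show ?thesis using that by (auto simp: card_2_iff)
qed

lemma hom_density_eq:
  assumes "finite_simple_graph H"
  shows "hom_density H ({..<n}, X) = weighted_density H n (\<lambda>e. of_bool (e \<in> X))"
proof -
  have fin: "finite (verts H)" "finite (edges H)" using assms finite_edges[OF assms] by (auto simp: finite_simple_graph_def)
  have "real (hom H ({..<n}, X)) = (\<Sum>\<phi>\<in>verts H \<rightarrow>\<^sub>E {..<n}. of_bool (\<forall>e\<in>edges H. \<phi> ` e \<in> X))"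
    using fin by (simp add: hom_def of_bool_def sum.If_cases Int_def finite_PiE)
  also have "\<dots> = hom_sum H n (\<lambda>e. of_bool (e \<in> X))"
    unfolding hom_sum_def
  proof (rule sum.cong)
    fix \<phi> :: "'a \<Rightarrow> nat"
    have "of_bool (\<forall>e\<in>F. \<phi> ` e \<in> X) = (\<Prod>e\<in>F. of_bool (\<phi> ` e \<in> X) :: real)" if "finite F" for F
      using that by (induction F rule: finite_induct) auto
    then show "of_bool (\<forall>e\<in>edges H. \<phi> ` e \<in> X) = (\<Prod>e\<in>edges H. of_bool (\<phi> ` e \<in> X) :: real)"
      using fin(2) by blast
  qed simp
  finally show ?thesis by (simp add: hom_density_def weighted_density_def)
qed

lemma sum_PiE_pair:
  assumes "a \<noteq> b"
  shows "(\<Sum>\<phi>\<in>{a, b} \<rightarrow>\<^sub>E S. F (\<phi> ` {a, b})) = (\<Sum>x\<in>S. \<Sum>y\<in>S. F {x, y})"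
proof -
  have "(\<Sum>\<phi>\<in>{a, b} \<rightarrow>\<^sub>E S. F (\<phi> ` {a, b})) = (\<Sum>\<phi>\<in>{b} \<rightarrow>\<^sub>E S. \<Sum>x\<in>S. F {x, \<phi> b})"
    using assms by (subst sum_PiE_insert) (auto intro!: sum.cong simp: insert_commute)
  also have "\<dots> = (\<Sum>y\<in>S. \<Sum>x\<in>S. F {x, y})"
    by (subst sum_PiE_insert) auto
  finally show ?thesis by (subst sum.swap)
qed

lemma handshake:
  assumes H: "finite_simple_graph H" and reg: "regular d H"
  shows "card (verts H) * d = 2 * card (edges H)"
proof -
  have fin: "finite (verts H)" "finite (edges H)" using H finite_edges[OF H] by (auto simp: finite_simple_graph_def)
  have "card (verts H) * d = (\<Sum>v\<in>verts H. card {e \<in> edges H. v \<in> e})"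
    using reg by (simp add: regular_def degree_def)
  also have "\<dots> = 2 * card (edges H)"
  proof (rule sum_multicount[OF fin])
    show "\<forall>e\<in>edges H. card {v \<in> verts H. v \<in> e} = 2"
    proof
      fix e assume e: "e \<in> edges H"
      then have "{v \<in> verts H. v \<in> e} = e" "card e = 2"
        using H by (auto simp: finite_simple_graph_def all_edges_def)
      then show "card {v \<in> verts H. v \<in> e} = 2" by simp
    qed
  qed
  finally show ?thesis .
qed

text \<open>In Finner's inequality every edge of \<open>H\<close> contributes the same
  \<open>d\<close>-norm, that of the kernel \<open>w\<close>. The handshake identity matches the
  normalisations \<open>n ^ (card (verts H) * d)\<close> and
  \<open>n ^ (2 * card (edges H))\<close>.\<close>

lemma weighted_density_le:
  assumes H: "finite_simple_graph H" and reg: "regular d H" and d: "d > 0" and n: "n > 0"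
    and w: "\<And>e. w e \<ge> 0"
  shows "weighted_density H n w ^ d
    \<le> ((\<Sum>x<n. \<Sum>y<n. w {x, y} ^ d) / (real n)\<^sup>2) ^ card (edges H)"
proof -
  have fin: "finite (verts H)" "finite (edges H)" using H finite_edges[OF H] by (auto simp: finite_simple_graph_def)
  define A where "A = (\<Sum>x<n. \<Sum>y<n. w {x, y} ^ d)"
  have A0: "A \<ge> 0" using w by (auto simp: A_def intro!: sum_nonneg)
  have "hom_sum H n w \<le> (\<Prod>e\<in>edges H. root d (\<Sum>\<phi>\<in>e \<rightarrow>\<^sub>E {..<n}. w (\<phi> ` e) ^ d))"
    unfolding hom_sum_def
  proof (rule finner_inequality)
    show "card {e \<in> edges H. v \<in> e} = d" if "v \<in> verts H" for v
      using reg that by (simp add: regular_def degree_def)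
    show "e \<subseteq> verts H" if "e \<in> edges H" for e
      using H that by (auto simp: finite_simple_graph_def all_edges_def)
    show "w (\<phi> ` e) = w (\<psi> ` e)" if "\<And>v. v \<in> e \<Longrightarrow> \<phi> v = \<psi> v" for e and \<phi> \<psi> :: "'a \<Rightarrow> nat"
      using that by (metis image_cong)
  qed (use fin d w in auto)
  also have "\<dots> = root d A ^ card (edges H)"
  proof -
    have "(\<Sum>\<phi>\<in>e \<rightarrow>\<^sub>E {..<n}. w (\<phi> ` e) ^ d) = A" if "e \<in> edges H" for e
      using edge_cases[OF H that] sum_PiE_pair[of _ _ "\<lambda>e. w e ^ d" "{..<n}"] by (metis A_def)
    then show ?thesis by simp
  qed
  finally have "hom_sum H n w ^ d \<le> (root d A ^ card (edges H)) ^ d"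
    using w by (intro power_mono) (auto simp: hom_sum_def intro!: sum_nonneg prod_nonneg)
  also have "\<dots> = (root d A ^ d) ^ card (edges H)" by (simp flip: power_mult add: mult.commute)
  also have "\<dots> = A ^ card (edges H)" using A0 d by simp
  finally have "hom_sum H n w ^ d / real n ^ (card (verts H) * d) \<le> A ^ card (edges H) / real n ^ (2 * card (edges H))"
    using handshake[OF H reg] by (simp add: divide_right_mono)
  then show ?thesis
    by (simp add: weighted_density_def power_divide A_def power_mult)
qed

section \<open>The counting lemma\<close>

text \<open>The form is linear in each of \<open>\<alpha>\<close> and \<open>\<beta>\<close>, so it
  is largest at indicators: first of the rows with positive sum, then of the columns. This passes
  from sets to the fractional weights met in counting.\<close>

lemma bilinear_bound:
  fixes D :: "'b \<Rightarrow> 'c \<Rightarrow> real"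
  assumes fin: "finite V" "finite W"
    and D: "\<And>A B. A \<subseteq> V \<Longrightarrow> B \<subseteq> W \<Longrightarrow> (\<Sum>x\<in>A. \<Sum>y\<in>B. D x y) \<le> c"
    and \<alpha>: "\<And>x. x \<in> V \<Longrightarrow> \<alpha> x \<in> {0..1}" and \<beta>: "\<And>y. y \<in> W \<Longrightarrow> \<beta> y \<in> {0..1}"
  shows "(\<Sum>x\<in>V. \<Sum>y\<in>W. D x y * (\<alpha> x * \<beta> y)) \<le> c"
proof -
  have *: "(\<Sum>x\<in>U. \<gamma> x * z x) \<le> (\<Sum>x\<in>{x \<in> U. z x > 0}. z x)"
    if "finite U" "\<And>x. x \<in> U \<Longrightarrow> \<gamma> x \<in> {0..1}" for U and \<gamma> z :: "'d \<Rightarrow> real"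
  proof -
    have "(\<Sum>x\<in>U. \<gamma> x * z x) \<le> (\<Sum>x\<in>U. if z x > 0 then z x else 0)"
    proof (rule sum_mono)
      fix x assume "x \<in> U"
      then show "\<gamma> x * z x \<le> (if z x > 0 then z x else 0)"
        using that(2)[of x] mult_right_mono[of "\<gamma> x" 1 "z x"] by (auto simp: not_less mult_nonneg_nonpos)
    qed
    also have "\<dots> = (\<Sum>x\<in>{x \<in> U. z x > 0}. z x)" using that(1) by (rule sum.inter_filter[symmetric])
    finally show ?thesis .
  qed
  define A where "A = {x \<in> V. (\<Sum>y\<in>W. D x y * \<beta> y) > 0}"
  define B where "B = {y \<in> W. (\<Sum>x\<in>A. D x y) > 0}"
  have "(\<Sum>x\<in>V. \<Sum>y\<in>W. D x y * (\<alpha> x * \<beta> y)) = (\<Sum>x\<in>V. \<alpha> x * (\<Sum>y\<in>W. D x y * \<beta> y))"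
    by (simp add: sum_distrib_left mult_ac)
  also have "\<dots> \<le> (\<Sum>x\<in>A. \<Sum>y\<in>W. D x y * \<beta> y)"
    unfolding A_def by (rule *[OF fin(1) \<alpha>])
  also have "\<dots> = (\<Sum>y\<in>W. \<beta> y * (\<Sum>x\<in>A. D x y))"
    by (subst sum.swap) (simp add: sum_distrib_left mult_ac)
  also have "\<dots> \<le> (\<Sum>y\<in>B. \<Sum>x\<in>A. D x y)"
    unfolding B_def by (rule *[OF fin(2) \<beta>])
  also have "\<dots> = (\<Sum>x\<in>A. \<Sum>y\<in>B. D x y)" by (rule sum.swap)
  also have "\<dots> \<le> c" by (rule D) (auto simp: A_def B_def)
  finally show ?thesis .
qed

text \<open>Freeze all vertices except \<open>a\<close> and \<open>b\<close>. No other edge contains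
  both, so the remaining product is a function of the image of \<open>a\<close> times a function of
  the image of \<open>b\<close>, and the cut bound applies for each frozen map.\<close>

lemma counting_step:
  fixes D :: "nat set \<Rightarrow> real"
  assumes V: "finite V" "a \<in> V" "b \<in> V" "a \<noteq> b" and F: "finite F" "\<And>e. e \<in> F \<Longrightarrow> \<not> (a \<in> e \<and> b \<in> e)"
    and D: "\<And>A B. A \<subseteq> {..<n} \<Longrightarrow> B \<subseteq> {..<n} \<Longrightarrow> \<bar>\<Sum>x\<in>A. \<Sum>y\<in>B. D {x, y}\<bar> \<le> c"
    and s: "\<And>e f. e \<in> F \<Longrightarrow> s e f \<in> {0..1}"
  shows "\<bar>\<Sum>\<phi>\<in>V \<rightarrow>\<^sub>E {..<n}. D (\<phi> ` {a, b}) * (\<Prod>e\<in>F. s e (\<phi> ` e))\<bar> \<le> c * real n ^ (card V - 2)"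
proof -
  define U where "U = V - {a, b}"
  have VU: "V = insert a (insert b U)" "b \<notin> U" "a \<notin> insert b U" "finite U" using V by (auto simp: U_def)
  have cU: "card U = card V - 2" using V by (simp add: U_def card_Diff_subset)
  define Fa where "Fa = {e \<in> F. a \<in> e}"
  have Fa: "Fa \<subseteq> F" by (auto simp: Fa_def)
  define \<alpha> where "\<alpha> \<psi> x = (\<Prod>e\<in>Fa. s e (\<psi>(a := x) ` e))" for \<psi> :: "'a \<Rightarrow> nat" and x
  define \<beta> where "\<beta> \<psi> y = (\<Prod>e\<in>F - Fa. s e (\<psi>(b := y) ` e))" for \<psi> :: "'a \<Rightarrow> nat" and y
  have \<alpha>: "\<alpha> \<psi> x \<in> {0..1}" for \<psi> x
    using s by (auto simp: \<alpha>_def Fa_def intro!: prod_nonneg prod_le_1)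
  have \<beta>: "\<beta> \<psi> x \<in> {0..1}" for \<psi> x
    using s by (auto simp: \<beta>_def intro!: prod_nonneg prod_le_1)
  have split: "(\<Prod>e\<in>F. s e (\<psi>(b := y, a := x) ` e)) = \<alpha> \<psi> x * \<beta> \<psi> y" for \<psi> :: "'a \<Rightarrow> nat" and x y
  proof -
    have 1: "(\<psi>(b := y, a := x)) ` e = (\<psi>(a := x)) ` e" if "e \<in> Fa" for e
      using that F(2)[of e] V by (intro image_cong) (auto simp: Fa_def)
    have 2: "(\<psi>(b := y, a := x)) ` e = (\<psi>(b := y)) ` e" if "e \<in> F - Fa" for e
      using that V by (intro image_cong) (auto simp: Fa_def)
    have "(\<Prod>e\<in>F. s e (\<psi>(b := y, a := x) ` e)) = (\<Prod>e\<in>F - Fa. s e (\<psi>(b := y, a := x) ` e)) * (\<Prod>e\<in>Fa. s e (\<psi>(b := y, a := x) ` e))"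
      by (rule prod.subset_diff[OF Fa F(1)])
    also have "\<dots> = \<beta> \<psi> y * \<alpha> \<psi> x"
      unfolding \<alpha>_def \<beta>_def using 1 2 by (intro arg_cong2[where f = "(*)"] prod.cong) auto
    finally show ?thesis by simp
  qed
  have "(\<Sum>\<phi>\<in>V \<rightarrow>\<^sub>E {..<n}. D (\<phi> ` {a, b}) * (\<Prod>e\<in>F. s e (\<phi> ` e)))
      = (\<Sum>\<psi>\<in>U \<rightarrow>\<^sub>E {..<n}. \<Sum>y<n. \<Sum>x<n. D ((\<psi>(b := y, a := x)) ` {a, b}) * (\<Prod>e\<in>F. s e ((\<psi>(b := y, a := x)) ` e)))"
    unfolding VU(1) by (simp only: sum_PiE_insert[OF VU(3)] sum_PiE_insert[OF VU(2)])
  also have "\<dots> = (\<Sum>\<psi>\<in>U \<rightarrow>\<^sub>E {..<n}. \<Sum>y<n. \<Sum>x<n. D {x, y} * (\<alpha> \<psi> x * \<beta> \<psi> y))"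
    using V by (simp only: split) (simp add: insert_commute)
  also have "\<dots> = (\<Sum>\<psi>\<in>U \<rightarrow>\<^sub>E {..<n}. \<Sum>x<n. \<Sum>y<n. D {x, y} * (\<alpha> \<psi> x * \<beta> \<psi> y))"
    by (intro sum.cong refl sum.swap)
  also have "\<bar>\<dots>\<bar> \<le> (\<Sum>\<psi>\<in>U \<rightarrow>\<^sub>E {..<n}. c)"
  proof (rule order.trans[OF sum_abs sum_mono])
    fix \<psi> :: "'a \<Rightarrow> nat"
    have "(\<Sum>x<n. \<Sum>y<n. D {x, y} * (\<alpha> \<psi> x * \<beta> \<psi> y)) \<le> c"
      using \<alpha> \<beta> D by (intro bilinear_bound) (auto simp: abs_le_iff)
    moreover have "(\<Sum>x<n. \<Sum>y<n. - D {x, y} * (\<alpha> \<psi> x * \<beta> \<psi> y)) \<le> c"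
      using \<alpha> \<beta> D by (intro bilinear_bound) (auto simp: abs_le_iff sum_negf)
    ultimately show "\<bar>\<Sum>x<n. \<Sum>y<n. D {x, y} * (\<alpha> \<psi> x * \<beta> \<psi> y)\<bar> \<le> c"
      by (simp add: sum_negf abs_le_iff)
  qed
  also have "\<dots> = c * real n ^ (card V - 2)"
    using VU(4) cU by (simp add: card_funcsetE)
  finally show ?thesis .
qed

text \<open>Telescoping, one edge of \<open>H\<close> at a time: edges in \<open>F\<close> still
  change from \<open>u\<close> to \<open>w\<close>, those in \<open>F'\<close> already carry
  \<open>w\<close>, and each exchange costs one application of the previous lemma.\<close>

lemma counting_lemma_sum:
  fixes u w :: "nat set \<Rightarrow> real"
  assumes H: "finite_simple_graph H"
    and u: "\<And>e. u e \<in> {0..1}" and w: "\<And>e. w e \<in> {0..1}"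
    and D: "\<And>A B. A \<subseteq> {..<n} \<Longrightarrow> B \<subseteq> {..<n} \<Longrightarrow> \<bar>\<Sum>x\<in>A. \<Sum>y\<in>B. u {x, y} - w {x, y}\<bar> \<le> c"
  shows "\<bar>hom_sum H n u - hom_sum H n w\<bar> \<le> real (card (edges H)) * c * real n ^ (card (verts H) - 2)"
proof -
  have fin: "finite (verts H)" "finite (edges H)" using H finite_edges[OF H] by (auto simp: finite_simple_graph_def)
  let ?C = "c * real n ^ (card (verts H) - 2)"
  let ?\<Phi> = "verts H \<rightarrow>\<^sub>E {..<n}"
  have "\<bar>\<Sum>\<phi>\<in>?\<Phi>. ((\<Prod>e\<in>F. u (\<phi> ` e)) - (\<Prod>e\<in>F. w (\<phi> ` e))) * (\<Prod>e\<in>F'. w (\<phi> ` e))\<bar> \<le> real (card F) * ?C"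
    if "finite F" "F \<subseteq> edges H" "F' \<subseteq> edges H" "F \<inter> F' = {}" for F F'
    using that
  proof (induction F arbitrary: F' rule: finite_induct)
    case (insert e0 F)
    have fF': "finite F'" using insert.prems fin finite_subset by auto
    obtain a b where ab: "e0 = {a, b}" "a \<noteq> b" "a \<in> verts H" "b \<in> verts H"
      using edge_cases[OF H, of e0] insert.prems by auto
    define s where "s e = (if e \<in> F then u else w)" for e
    have s: "s e f \<in> {0..1}" for e f using u[of f] w[of f] by (simp add: s_def)
    have "\<bar>\<Sum>\<phi>\<in>?\<Phi>. (u (\<phi> ` {a, b}) - w (\<phi> ` {a, b})) * (\<Prod>e\<in>F \<union> F'. s e (\<phi> ` e))\<bar> \<le> ?C"
    proof (rule counting_step[where D = "\<lambda>f. u f - w f"])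
      fix e assume e: "e \<in> F \<union> F'"
      then have "e \<noteq> e0" "card e = 2" "card e0 = 2"
        using insert.hyps insert.prems H by (auto simp: finite_simple_graph_def all_edges_def)
      then show "\<not> (a \<in> e \<and> b \<in> e)"
        unfolding ab by (metis (no_types) ab(2) card_2_iff insertE singletonD insert_commute)
    qed (use ab fin D s insert.hyps fF' in auto)
    moreover have "(\<Prod>e\<in>F \<union> F'. s e (\<phi> ` e)) = (\<Prod>e\<in>F. u (\<phi> ` e)) * (\<Prod>e\<in>F'. w (\<phi> ` e))" for \<phi> :: "'a \<Rightarrow> nat"
    proof -
      have "(\<Prod>e\<in>F'. s e (\<phi> ` e)) = (\<Prod>e\<in>F'. w (\<phi> ` e))"
        using insert.prems by (intro prod.cong) (auto simp: s_def)
      then show ?thesis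
        using insert.hyps insert.prems fF' by (subst prod.union_disjoint) (auto simp: s_def)
    qed
    ultimately have 1: "\<bar>\<Sum>\<phi>\<in>?\<Phi>. (u (\<phi> ` e0) - w (\<phi> ` e0)) * ((\<Prod>e\<in>F. u (\<phi> ` e)) * (\<Prod>e\<in>F'. w (\<phi> ` e)))\<bar> \<le> ?C"
      unfolding ab(1) by simp
    have 2: "\<bar>\<Sum>\<phi>\<in>?\<Phi>. ((\<Prod>e\<in>F. u (\<phi> ` e)) - (\<Prod>e\<in>F. w (\<phi> ` e))) * (\<Prod>e\<in>insert e0 F'. w (\<phi> ` e))\<bar> \<le> real (card F) * ?C"
      using insert.hyps insert.prems by (intro insert.IH) auto
    have "(\<Sum>\<phi>\<in>?\<Phi>. ((\<Prod>e\<in>insert e0 F. u (\<phi> ` e)) - (\<Prod>e\<in>insert e0 F. w (\<phi> ` e))) * (\<Prod>e\<in>F'. w (\<phi> ` e)))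
       = (\<Sum>\<phi>\<in>?\<Phi>. (u (\<phi> ` e0) - w (\<phi> ` e0)) * ((\<Prod>e\<in>F. u (\<phi> ` e)) * (\<Prod>e\<in>F'. w (\<phi> ` e))))
       + (\<Sum>\<phi>\<in>?\<Phi>. ((\<Prod>e\<in>F. u (\<phi> ` e)) - (\<Prod>e\<in>F. w (\<phi> ` e))) * (\<Prod>e\<in>insert e0 F'. w (\<phi> ` e)))"
      using insert.hyps insert.prems fF' by (simp add: algebra_simps flip: sum.distrib)
    then show ?case using 1 2 insert.hyps by (simp add: algebra_simps)
  qed simp
  from this[of "edges H" "{}"] show ?thesis using fin by (simp add: hom_sum_def sum_subtractf)
qed

lemma counting_lemma:
  fixes u w :: "nat set \<Rightarrow> real"
  assumes H: "finite_simple_graph H" and n: "n > 0"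
    and u: "\<And>e. u e \<in> {0..1}" and w: "\<And>e. w e \<in> {0..1}"
    and D: "\<And>A B. A \<subseteq> {..<n} \<Longrightarrow> B \<subseteq> {..<n} \<Longrightarrow> \<bar>\<Sum>x\<in>A. \<Sum>y\<in>B. u {x, y} - w {x, y}\<bar> \<le> \<epsilon> * (real n)\<^sup>2"
  shows "\<bar>weighted_density H n u - weighted_density H n w\<bar> \<le> real (card (edges H)) * \<epsilon>"
proof (cases "edges H = {}")
  case True
  then show ?thesis by (simp add: weighted_density_def hom_sum_def)
next
  case False
  then obtain e where "e \<in> edges H" by blast
  then have "card e \<le> card (verts H)" "card e = 2"
    using H by (auto simp: finite_simple_graph_def all_edges_def intro!: card_mono)
  \<comment> \<open>An edge forces at least two vertices, so the subtraction in the exponent is not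
    truncated.\<close>
  then have v: "real n ^ card (verts H) = (real n)\<^sup>2 * real n ^ (card (verts H) - 2)"
    by (metis le_add_diff_inverse power_add)
  have "\<bar>hom_sum H n u - hom_sum H n w\<bar> \<le> real (card (edges H)) * (\<epsilon> * (real n)\<^sup>2) * real n ^ (card (verts H) - 2)"
    by (rule counting_lemma_sum[OF H u w D])
  also have "\<dots> = (real (card (edges H)) * \<epsilon>) * real n ^ card (verts H)" by (simp add: v mult_ac)
  finally have "\<bar>hom_sum H n u - hom_sum H n w\<bar> / real n ^ card (verts H) \<le> real (card (edges H)) * \<epsilon>"
    using n by (simp add: field_simps)
  then show ?thesis by (simp add: weighted_density_def flip: diff_divide_distrib)
qed

section \<open>Monotonicity and perturbation of densities\<close>

lemma hom_sum_nonneg: "(\<And>e. w e \<ge> 0) \<Longrightarrow> hom_sum H n w \<ge> 0"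
  unfolding hom_sum_def by (intro sum_nonneg prod_nonneg) auto

lemma weighted_density_nonneg: "(\<And>e. w e \<ge> 0) \<Longrightarrow> weighted_density H n w \<ge> 0"
  unfolding weighted_density_def by (intro divide_nonneg_nonneg hom_sum_nonneg) auto

lemma weighted_density_mono:
  assumes "\<And>e. 0 \<le> u e" "\<And>e. u e \<le> w e"
  shows "weighted_density H n u \<le> weighted_density H n w"
  unfolding weighted_density_def hom_sum_def
  using assms by (intro divide_right_mono sum_mono prod_mono) auto

lemma weighted_density_const:
  assumes "finite (verts H)" "n > 0"
  shows "weighted_density H n (\<lambda>_. c) = c ^ card (edges H)"
  using assms by (simp add: weighted_density_def hom_sum_def card_funcsetE)

text \<open>Each factor is the probability that at least one of two independent events, of
  probabilities \<open>w e\<close> and \<open>\<delta>\<close>, occurs.\<close>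

lemma prod_perturb:
  fixes w :: "'e \<Rightarrow> real"
  assumes "finite F" "\<And>e. e \<in> F \<Longrightarrow> w e \<in> {0..1}" "\<delta> \<in> {0..1}"
  shows "(\<Prod>e\<in>F. w e + \<delta> * (1 - w e)) \<ge> (\<Prod>e\<in>F. w e) + (1 - (\<Prod>e\<in>F. w e)) * \<delta> ^ card F"
  using assms(1,2)
proof (induction F rule: finite_induct)
  case (insert e F)
  define X where "X = (\<Prod>e\<in>F. w e)"
  define D where "D = \<delta> ^ card F"
  have X: "0 \<le> X" "X \<le> 1" using insert.prems by (auto simp: X_def intro!: prod_nonneg prod_le_1)
  have D: "0 \<le> D" "D \<le> 1" using assms(3) by (auto simp: D_def power_le_one)
  have w: "0 \<le> w e" "w e \<le> 1" using insert.prems by auto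
  have \<delta>: "0 \<le> \<delta>" "\<delta> \<le> 1" using assms(3) by auto
  have "(w e + \<delta> * (1 - w e)) * (X + (1 - X) * D) \<le> (w e + \<delta> * (1 - w e)) * (\<Prod>e\<in>F. w e + \<delta> * (1 - w e))"
    using insert w \<delta> by (intro mult_left_mono) (auto simp: X_def D_def)
  moreover have "(w e + \<delta> * (1 - w e)) * (X + (1 - X) * D) - (w e * X + (1 - w e * X) * (\<delta> * D))
     = w e * ((1 - X) * (D * (1 - \<delta>))) + (1 - w e) * (\<delta> * (X * (1 - D)))"
    by (simp add: algebra_simps)
  moreover have "\<dots> \<ge> 0" using w \<delta> D X by simp
  ultimately show ?case using insert.hyps by (simp add: X_def D_def)
qed simp

text \<open>Pushing all weights towards 1 by a fraction \<open>\<delta>\<close> raises a density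
  below 1 by an amount independent of \<open>n\<close>. This buys back the error of the counting
  lemma and leaves a strict inequality.\<close>

lemma weighted_density_perturb:
  assumes H: "finite_simple_graph H" and n: "n > 0"
    and w: "\<And>e. w e \<in> {0..1}" and \<delta>: "\<delta> \<in> {0..1}"
  shows "weighted_density H n (\<lambda>e. w e + \<delta> * (1 - w e))
    \<ge> weighted_density H n w + (1 - weighted_density H n w) * \<delta> ^ card (edges H)"
proof -
  have fin: "finite (verts H)" "finite (edges H)" using H finite_edges[OF H] by (auto simp: finite_simple_graph_def)
  let ?N = "real n ^ card (verts H)"
  let ?D = "\<delta> ^ card (edges H)"
  have "hom_sum H n (\<lambda>e. w e + \<delta> * (1 - w e)) \<ge>
      (\<Sum>\<phi>\<in>verts H \<rightarrow>\<^sub>E {..<n}. (\<Prod>e\<in>edges H. w (\<phi> ` e)) + (1 - (\<Prod>e\<in>edges H. w (\<phi> ` e))) * ?D)"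
    unfolding hom_sum_def by (intro sum_mono prod_perturb fin \<delta> w)
  also have "(\<Sum>\<phi>\<in>verts H \<rightarrow>\<^sub>E {..<n}. (\<Prod>e\<in>edges H. w (\<phi> ` e)) + (1 - (\<Prod>e\<in>edges H. w (\<phi> ` e))) * ?D)
     = hom_sum H n w + (?N - hom_sum H n w) * ?D"
    using fin by (simp add: hom_sum_def sum.distrib sum_subtractf card_funcsetE flip: sum_distrib_right)
  finally have "(hom_sum H n w + (?N - hom_sum H n w) * ?D) / ?N \<le> hom_sum H n (\<lambda>e. w e + \<delta> * (1 - w e)) / ?N"
    by (intro divide_right_mono) auto
  moreover have "(hom_sum H n w + (?N - hom_sum H n w) * ?D) / ?N
      = weighted_density H n w + (1 - weighted_density H n w) * ?D"
    using n by (simp add: weighted_density_def field_simps)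
  ultimately show ?thesis by (simp add: weighted_density_def)
qed

section \<open>Maps with collisions\<close>

lemma card_maps_collide:
  assumes "finite V" "a \<in> V" "b \<in> V" "a \<noteq> b"
  shows "card {\<phi> \<in> V \<rightarrow>\<^sub>E {..<n::nat}. \<phi> a = \<phi> b} \<le> n ^ (card V - 1)"
proof -
  have "card {\<phi> \<in> V \<rightarrow>\<^sub>E {..<n}. \<phi> a = \<phi> b} \<le> card ((V - {a}) \<rightarrow>\<^sub>E {..<n})"
  proof (rule card_inj_on_le)
    show "inj_on (\<lambda>\<phi>. restrict \<phi> (V - {a})) {\<phi> \<in> V \<rightarrow>\<^sub>E {..<n}. \<phi> a = \<phi> b}"
    proof (rule inj_onI)
      fix \<phi> \<psi> :: "'a \<Rightarrow> nat"
      assume \<phi>: "\<phi> \<in> {\<phi> \<in> V \<rightarrow>\<^sub>E {..<n}. \<phi> a = \<phi> b}" and \<psi>: "\<psi> \<in> {\<phi> \<in> V \<rightarrow>\<^sub>E {..<n}. \<phi> a = \<phi> b}"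
        and eq: "restrict \<phi> (V - {a}) = restrict \<psi> (V - {a})"
      have other: "\<phi> x = \<psi> x" if "x \<in> V - {a}" for x using fun_cong[OF eq, of x] that by auto
      then have "\<phi> a = \<psi> a" using \<phi> \<psi> assms by auto
      then have "\<phi> x = \<psi> x" if "x \<in> V" for x using other[of x] that by (cases "x = a") auto
      then show "\<phi> = \<psi>" using \<phi> \<psi> by (intro PiE_ext[of _ V "\<lambda>_. {..<n}"]) auto
    qed
    show "(\<lambda>\<phi>. restrict \<phi> (V - {a})) ` {\<phi> \<in> V \<rightarrow>\<^sub>E {..<n}. \<phi> a = \<phi> b} \<subseteq> (V - {a}) \<rightarrow>\<^sub>E {..<n}"
      by (intro image_subsetI) (simp only: restrict_PiE_iff, blast dest: PiE_mem)
    show "finite ((V - {a}) \<rightarrow>\<^sub>E {..<n})" using assms by (auto intro: finite_PiE)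
  qed
  then show ?thesis using assms by (simp add: card_funcsetE)
qed

lemma card_maps_not_inj:
  assumes "finite V" "n > 0"
  shows "real (card {\<phi> \<in> V \<rightarrow>\<^sub>E {..<n::nat}. \<not> inj_on \<phi> V}) \<le> (real (card V))\<^sup>2 / real n * real n ^ card V"
proof (cases "V = {}")
  case False
  have "{\<phi> \<in> V \<rightarrow>\<^sub>E {..<n}. \<not> inj_on \<phi> V}
      \<subseteq> (\<Union>(a, b)\<in>{(a, b) \<in> V \<times> V. a \<noteq> b}. {\<phi> \<in> V \<rightarrow>\<^sub>E {..<n}. \<phi> a = \<phi> b})"
    by (auto simp: inj_on_def)
  then have "card {\<phi> \<in> V \<rightarrow>\<^sub>E {..<n}. \<not> inj_on \<phi> V}
      \<le> card (\<Union>(a, b)\<in>{(a, b) \<in> V \<times> V. a \<noteq> b}. {\<phi> \<in> V \<rightarrow>\<^sub>E {..<n}. \<phi> a = \<phi> b})"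
    using assms(1) by (intro card_mono) (auto intro!: finite_subset[OF _ finite_PiE[of V "\<lambda>_. {..<n}"]])
  also have "\<dots> \<le> (\<Sum>(a, b)\<in>{(a, b) \<in> V \<times> V. a \<noteq> b}. card {\<phi> \<in> V \<rightarrow>\<^sub>E {..<n}. \<phi> a = \<phi> b})"
    unfolding case_prod_unfold
    by (rule card_UN_le, rule finite_subset[of _ "V \<times> V"]) (use assms(1) in auto)
  also have "\<dots> \<le> (\<Sum>(a, b)\<in>{(a, b) \<in> V \<times> V. a \<noteq> b}. n ^ (card V - 1))"
    using card_maps_collide[OF assms(1)] by (intro sum_mono) auto
  also have "\<dots> \<le> card (V \<times> V) * n ^ (card V - 1)"
  proof -
    have "card {(a, b) \<in> V \<times> V. a \<noteq> b} \<le> card (V \<times> V)" using assms(1) by (intro card_mono) auto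
    then show ?thesis by simp
  qed
  finally have "real (card {\<phi> \<in> V \<rightarrow>\<^sub>E {..<n}. \<not> inj_on \<phi> V}) \<le> real (card V * card V * n ^ (card V - 1))"
    by (metis card_cartesian_product of_nat_mono)
  also have "\<dots> = (real (card V))\<^sup>2 / real n * real n ^ card V"
  proof -
    obtain k where "card V = Suc k" using False assms(1) by (metis card_eq_0_iff not0_implies_Suc)
    then show ?thesis using assms(2) by (simp add: power2_eq_square field_simps)
  qed
  finally show ?thesis .
qed simp

text \<open>Only a fraction \<open>O(1/n)\<close> of the pairs of maps share a vertex; all other
  pairs give independent copies of \<open>H\<close>, so this fraction bounds the variance.\<close>

lemma card_map_pairs_meet:
  assumes "finite V" "n > 0"
  shows "real (card {(\<phi>, \<psi>) \<in> (V \<rightarrow>\<^sub>E {..<n::nat}) \<times> (V \<rightarrow>\<^sub>E {..<n}). \<exists>a\<in>V. \<exists>b\<in>V. \<phi> a = \<psi> b})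
    \<le> (real (card V))\<^sup>2 / real n * (real n ^ card V)\<^sup>2"
proof (cases "V = {}")
  case False
  let ?P = "V \<rightarrow>\<^sub>E {..<n}"
  define M where "M a b = {(\<phi>, \<psi>) \<in> ?P \<times> ?P. \<phi> a = \<psi> b}" for a b :: 'a
  have cM: "card (M a b) \<le> n ^ (card V - 1) * n ^ card V" if "a \<in> V" "b \<in> V" for a b
  proof -
    have "card (M a b) \<le> card (((V - {a}) \<rightarrow>\<^sub>E {..<n}) \<times> ?P)"
    proof (rule card_inj_on_le)
      show "inj_on (\<lambda>(\<phi>, \<psi>). (restrict \<phi> (V - {a}), \<psi>)) (M a b)"
      proof (rule inj_onI)
        fix z z' assume m: "z \<in> M a b" "z' \<in> M a b"
          and eq: "(\<lambda>(\<phi>, \<psi>). (restrict \<phi> (V - {a}), \<psi>)) z = (\<lambda>(\<phi>, \<psi>). (restrict \<phi> (V - {a}), \<psi>)) z'"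
        obtain \<phi> \<psi> \<phi>' where z: "z = (\<phi>, \<psi>)" "z' = (\<phi>', \<psi>)" using eq by (cases z, cases z') auto
        have eq': "restrict \<phi> (V - {a}) = restrict \<phi>' (V - {a})" using eq z by simp
        have other: "\<phi> x = \<phi>' x" if "x \<in> V - {a}" for x using fun_cong[OF eq', of x] that by auto
        have "\<phi> a = \<phi>' a" using m z by (auto simp: M_def)
        then have "\<phi> x = \<phi>' x" if "x \<in> V" for x using other[of x] that by (cases "x = a") auto
        then have "\<phi> = \<phi>'" using m z by (intro PiE_ext[of _ V "\<lambda>_. {..<n}"]) (auto simp: M_def)
        then show "z = z'" using z by simp
      qed
      show "(\<lambda>(\<phi>, \<psi>). (restrict \<phi> (V - {a}), \<psi>)) ` M a b \<subseteq> ((V - {a}) \<rightarrow>\<^sub>E {..<n}) \<times> ?P"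
      proof (rule image_subsetI)
        fix z assume "z \<in> M a b"
        then obtain \<phi> \<psi> where z: "z = (\<phi>, \<psi>)" and "\<phi> \<in> ?P" "\<psi> \<in> ?P" by (auto simp: M_def)
        then show "(\<lambda>(\<phi>, \<psi>). (restrict \<phi> (V - {a}), \<psi>)) z \<in> ((V - {a}) \<rightarrow>\<^sub>E {..<n}) \<times> ?P"
          by (simp only: z case_prod_conv restrict_PiE_iff mem_Times_iff fst_conv snd_conv) (blast dest: PiE_mem)
      qed
      show "finite (((V - {a}) \<rightarrow>\<^sub>E {..<n}) \<times> ?P)" using assms by (auto intro: finite_PiE)
    qed
    then show ?thesis using assms that by (simp add: card_cartesian_product card_funcsetE)
  qed
  have eqU: "{(\<phi>, \<psi>) \<in> ?P \<times> ?P. \<exists>a\<in>V. \<exists>b\<in>V. \<phi> a = \<psi> b} = (\<Union>(a, b)\<in>V \<times> V. M a b)"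
    by (auto simp: M_def)
  have "card (\<Union>(a, b)\<in>V \<times> V. M a b) \<le> (\<Sum>(a, b)\<in>V \<times> V. card (M a b))"
    using assms(1) card_UN_le[of "V \<times> V" "\<lambda>(a, b). M a b"] by (simp add: case_prod_unfold)
  also have "\<dots> \<le> (\<Sum>(a, b)\<in>V \<times> V. n ^ (card V - 1) * n ^ card V)"
    using cM by (intro sum_mono) auto
  also have "\<dots> = card V * card V * (n ^ (card V - 1) * n ^ card V)"
    by (simp add: card_cartesian_product)
  finally have "real (card (\<Union>(a, b)\<in>V \<times> V. M a b)) \<le> real (card V * card V * (n ^ (card V - 1) * n ^ card V))"
    by (simp only: of_nat_mono)
  also have "\<dots> = (real (card V))\<^sup>2 / real n * (real n ^ card V)\<^sup>2"
  proof -
    obtain k where "card V = Suc k" using False assms(1) by (metis card_eq_0_iff not0_implies_Suc)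
    then show ?thesis using assms(2) by (simp add: power2_eq_square field_simps)
  qed
  finally show ?thesis unfolding eqU .
qed simp

section \<open>Blow-ups and sums over edges\<close>

text \<open>Vertex \<open>x\<close> of the blow-up is a copy of \<open>x mod n\<close>, so a map
  into it is a base map \<open>\<psi>\<close> together with a choice \<open>\<kappa>\<close> of
  copies, encoded as \<open>\<psi> v + n * \<kappa> v\<close>. The vertices from
  \<open>q * n\<close> up to \<open>m\<close> are padding, where \<open>w'\<close> only has to be
  nonnegative.\<close>

lemma hom_sum_blow_up:
  assumes V: "finite (verts H)" and H: "\<And>e. e \<in> edges H \<Longrightarrow> e \<subseteq> verts H" and n: "n > 0" and q: "q * n \<le> m"
    and w: "\<And>e. w e \<ge> 0" and w': "\<And>e. w' e \<ge> 0"
    and le: "\<And>e. e \<subseteq> {..<q * n} \<Longrightarrow> w ((\<lambda>x. x mod n) ` e) \<le> w' e"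
  shows "real q ^ card (verts H) * hom_sum H n w \<le> hom_sum H m w'"
proof -
  let ?V = "verts H"
  define g where "g = (\<lambda>(\<kappa> :: 'a \<Rightarrow> nat, \<psi> :: 'a \<Rightarrow> nat). restrict (\<lambda>v. \<psi> v + n * \<kappa> v) ?V)"
  let ?D = "(?V \<rightarrow>\<^sub>E {..<q}) \<times> (?V \<rightarrow>\<^sub>E {..<n})"
  have inj: "inj_on g ?D"
  proof (rule inj_onI, clarify)
    fix \<kappa> \<psi> \<kappa>' \<psi>'
    assume mem: "\<kappa> \<in> ?V \<rightarrow>\<^sub>E {..<q}" "\<psi> \<in> ?V \<rightarrow>\<^sub>E {..<n}" "\<kappa>' \<in> ?V \<rightarrow>\<^sub>E {..<q}" "\<psi>' \<in> ?V \<rightarrow>\<^sub>E {..<n}"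
      and eq: "g (\<kappa>, \<psi>) = g (\<kappa>', \<psi>')"
    have *: "\<psi> v = \<psi>' v \<and> \<kappa> v = \<kappa>' v" if v: "v \<in> ?V" for v
    proof -
      have lt: "\<psi> v < n" "\<psi>' v < n" using mem v by (auto simp: PiE_iff)
      have "\<psi> v + n * \<kappa> v = \<psi>' v + n * \<kappa>' v" using fun_cong[OF eq, of v] v by (simp add: g_def)
      then have "(\<psi> v + n * \<kappa> v) mod n = (\<psi>' v + n * \<kappa>' v) mod n" "(\<psi> v + n * \<kappa> v) div n = (\<psi>' v + n * \<kappa>' v) div n"
        by simp_all
      then show ?thesis using lt by simp
    qed
    have "\<kappa> = \<kappa>'" using mem * by (intro PiE_ext[of _ ?V "\<lambda>_. {..<q}"]) auto
    moreover have "\<psi> = \<psi>'" using mem * by (intro PiE_ext[of _ ?V "\<lambda>_. {..<n}"]) auto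
    ultimately show "\<kappa> = \<kappa>' \<and> \<psi> = \<psi>'" by simp
  qed
  have bound: "\<psi> v + n * \<kappa> v < q * n" if "\<kappa> v < q" "\<psi> v < n" for \<kappa> \<psi> and v :: 'a
  proof -
    have "\<psi> v + n * \<kappa> v < n + n * \<kappa> v" using that by simp
    also have "\<dots> = Suc (\<kappa> v) * n" by simp
    also have "\<dots> \<le> q * n" using that by (intro mult_le_mono1) auto
    finally show ?thesis .
  qed
  have img: "g ` ?D \<subseteq> ?V \<rightarrow>\<^sub>E {..<m}"
  proof (rule image_subsetI)
    fix z assume "z \<in> ?D"
    then obtain \<kappa> \<psi> where z: "z = (\<kappa>, \<psi>)" "\<And>v. v \<in> ?V \<Longrightarrow> \<kappa> v < q" "\<And>v. v \<in> ?V \<Longrightarrow> \<psi> v < n"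
      by (auto simp: PiE_iff)
    have "\<psi> v + n * \<kappa> v < m" if "v \<in> ?V" for v
      using bound[of \<kappa> v \<psi>] z that q by (meson order.strict_trans2)
    then show "g z \<in> ?V \<rightarrow>\<^sub>E {..<m}" unfolding z(1) g_def case_prod_conv restrict_PiE_iff by auto
  qed
  have "real q ^ card ?V * hom_sum H n w = (\<Sum>(\<kappa>, \<psi>)\<in>?D. \<Prod>e\<in>edges H. w (\<psi> ` e))"
    using V by (subst sum.cartesian_product[symmetric]) (simp add: hom_sum_def card_funcsetE)
  also have "\<dots> \<le> (\<Sum>z\<in>?D. \<Prod>e\<in>edges H. w' (g z ` e))"
  proof (rule sum_mono, clarify)
    fix \<kappa> \<psi> assume mem: "\<kappa> \<in> ?V \<rightarrow>\<^sub>E {..<q}" "\<psi> \<in> ?V \<rightarrow>\<^sub>E {..<n}"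
    show "(\<Prod>e\<in>edges H. w (\<psi> ` e)) \<le> (\<Prod>e\<in>edges H. w' (g (\<kappa>, \<psi>) ` e))"
    proof (rule prod_mono, intro conjI w)
      fix e assume e: "e \<in> edges H"
      have g_eq: "g (\<kappa>, \<psi>) v = \<psi> v + n * \<kappa> v" and lt: "\<kappa> v < q" "\<psi> v < n" if "v \<in> e" for v
        using mem H[OF e] that by (auto simp: g_def PiE_iff)
      have sub: "g (\<kappa>, \<psi>) ` e \<subseteq> {..<q * n}"
        by (rule image_subsetI) (simp add: g_eq bound lt)
      have "(\<lambda>x. x mod n) ` g (\<kappa>, \<psi>) ` e = \<psi> ` e"
        unfolding image_image by (intro image_cong refl) (simp add: g_eq lt)
      then show "w (\<psi> ` e) \<le> w' (g (\<kappa>, \<psi>) ` e)" using le[OF sub] by simp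
    qed
  qed
  also have "\<dots> = (\<Sum>\<phi>\<in>g ` ?D. \<Prod>e\<in>edges H. w' (\<phi> ` e))"
    using inj by (simp add: sum.reindex)
  also have "\<dots> \<le> hom_sum H m w'"
    unfolding hom_sum_def using V img w' by (intro sum_mono2 finite_PiE prod_nonneg) auto
  finally show ?thesis .
qed

lemma sum_mod_blocks:
  fixes f :: "nat \<Rightarrow> real"
  shows "(\<Sum>x<q * n. f (x mod n)) = real q * (\<Sum>x<n. f x)"
proof (induction q)
  case (Suc q)
  have "(\<Sum>x<Suc q * n. f (x mod n)) = (\<Sum>x<q * n. f (x mod n)) + (\<Sum>x\<in>{q * n..<q * n + n}. f (x mod n))"
    by (subst sum.union_disjoint[symmetric]) (auto intro!: sum.cong)
  also have "(\<Sum>x\<in>{q * n..<q * n + n}. f (x mod n)) = (\<Sum>x<n. f ((x + q * n) mod n))"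
    using sum.shift_bounds_nat_ivl[of "\<lambda>x. f (x mod n)" 0 "q * n" n]
    by (simp add: add.commute lessThan_atLeast0)
  also have "\<dots> = (\<Sum>x<n. f x)" by (intro sum.cong) auto
  finally show ?case using Suc by (simp add: algebra_simps)
qed simp

lemma finite_all_edges: "finite (all_edges {..<n::nat})"
  unfolding all_edges_def by (rule finite_subset[of _ "Pow {..<n}"]) auto

lemma sum_all_edges:
  fixes f :: "nat set \<Rightarrow> real"
  shows "2 * (\<Sum>e\<in>all_edges {..<n}. f e) = (\<Sum>x<n. \<Sum>y\<in>{..<n} - {x}. f {x, y})"
proof -
  let ?P = "SIGMA x:{..<n}. {..<n} - {x}"
  have fin: "finite ?P" by auto
  have finE: "finite (all_edges {..<n})" by (rule finite_all_edges)
  have img: "(\<lambda>(x, y). {x, y}) ` ?P \<subseteq> all_edges {..<n}" by (auto simp: all_edges_def card_insert_if)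
  have "(\<Sum>x<n. \<Sum>y\<in>{..<n} - {x}. f {x, y}) = (\<Sum>(x, y)\<in>?P. f {x, y})"
    by (rule sum.Sigma) auto
  also have "\<dots> = (\<Sum>e\<in>all_edges {..<n}. \<Sum>z\<in>{z \<in> ?P. (\<lambda>(x, y). {x, y}) z = e}. (\<lambda>(x, y). f {x, y}) z)"
    by (rule sum.group[OF fin finE img, symmetric])
  also have "\<dots> = (\<Sum>e\<in>all_edges {..<n}. 2 * f e)"
  proof (rule sum.cong)
    fix e assume "e \<in> all_edges {..<n}"
    then obtain a b where ab: "e = {a, b}" "a \<noteq> b" "a < n" "b < n"
      by (auto simp: all_edges_def card_2_iff)
    then have "{z \<in> ?P. (\<lambda>(x, y). {x, y}) z = e} = {(a, b), (b, a)}"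
      by (auto simp: doubleton_eq_iff)
    then show "(\<Sum>z\<in>{z \<in> ?P. (\<lambda>(x, y). {x, y}) z = e}. (\<lambda>(x, y). f {x, y}) z) = 2 * f e"
      using ab by (simp add: insert_commute)
  qed simp
  finally show ?thesis by (simp add: sum_distrib_left)
qed

lemma card_all_edges: "card (all_edges {..<n::nat}) = n choose 2"
  using n_subsets[of "{..<n}" 2] by (simp add: all_edges_def)

lemma real_choose_2: "real (n choose 2) = real n * (real n - 1) / 2"
proof -
  have "even (n * (n - 1))" by (cases n) simp_all
  then have "2 * (n choose 2) = n * (n - 1)" by (simp add: choose_two)
  then have "2 * real (n choose 2) = real n * real (n - 1)" by (metis of_nat_mult of_nat_numeral)
  then show ?thesis by (cases n) auto
qed

section \<open>Weak regularity\<close>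

text \<open>The coefficient is recorded as a sign rather than a real number, so that lists of a
  given length can be counted.\<close>

fun rect_sum :: "real \<Rightarrow> (bool \<times> nat set \<times> nat set) list \<Rightarrow> nat \<Rightarrow> nat \<Rightarrow> real" where
  "rect_sum \<epsilon> [] x y = 0"
| "rect_sum \<epsilon> ((\<sigma>, S, T) # l) x y
     = (if x \<in> S \<and> y \<in> T then if \<sigma> then \<epsilon> else - \<epsilon> else 0) + rect_sum \<epsilon> l x y"

text \<open>Energy decrement, with the hypothesis as a budget for \<open>k\<close> steps. If a
  rectangle violates the cut bound, subtracting \<open>\<plusminus>\<epsilon>\<close> on it changes
  the energy by at most \<open>\<epsilon>\<^sup>2 * (real n)\<^sup>2\<close> minus twice that
  amount, which pays for one step.\<close>

lemma weak_regularity: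
  fixes R :: "nat \<Rightarrow> nat \<Rightarrow> real"
  assumes \<epsilon>: "\<epsilon> > 0" and R: "(\<Sum>x<n. \<Sum>y<n. (R x y)\<^sup>2) \<le> real k * \<epsilon>\<^sup>2 * (real n)\<^sup>2"
  shows "\<exists>l. set l \<subseteq> UNIV \<times> Pow {..<n} \<times> Pow {..<n} \<and> length l = k \<and>
    (\<forall>A\<subseteq>{..<n}. \<forall>B\<subseteq>{..<n}. \<bar>\<Sum>x\<in>A. \<Sum>y\<in>B. R x y - rect_sum \<epsilon> l x y\<bar> \<le> \<epsilon> * (real n)\<^sup>2)"
  using R
proof (induction k arbitrary: R)
  case 0
  have "R x y = 0" if "x < n" "y < n" for x y
  proof -
    have "(R x y)\<^sup>2 \<le> (\<Sum>y<n. (R x y)\<^sup>2)" using that by (intro member_le_sum) auto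
    also have "\<dots> \<le> (\<Sum>x<n. \<Sum>y<n. (R x y)\<^sup>2)"
      using that by (intro member_le_sum[of x _ "\<lambda>x. \<Sum>y<n. (R x y)\<^sup>2"] sum_nonneg) auto
    also have "\<dots> \<le> 0" using 0 by simp
    finally show ?thesis by simp
  qed
  then have "(\<Sum>x\<in>A. \<Sum>y\<in>B. R x y) = 0" if "A \<subseteq> {..<n}" "B \<subseteq> {..<n}" for A B
    using that by (intro sum.neutral ballI) auto
  then show ?case using \<epsilon> by (intro exI[of _ "[]"]) auto
next
  case (Suc k)
  show ?case
  proof (cases "\<forall>A\<subseteq>{..<n}. \<forall>B\<subseteq>{..<n}. \<bar>\<Sum>x\<in>A. \<Sum>y\<in>B. R x y\<bar> \<le> \<epsilon> * (real n)\<^sup>2")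
    case True
    \<comment> \<open>Empty rectangles pad the list to the exact length \<open>k\<close>.\<close>
    have "rect_sum \<epsilon> (replicate j (True, {}, {})) x y = 0" for j x y by (induction j) auto
    then show ?thesis using True by (intro exI[of _ "replicate (Suc k) (True, {}, {})"]) auto
  next
    case False
    then obtain A B where AB: "A \<subseteq> {..<n}" "B \<subseteq> {..<n}" "\<bar>\<Sum>x\<in>A. \<Sum>y\<in>B. R x y\<bar> > \<epsilon> * (real n)\<^sup>2"
      by (auto simp: not_le)
    define \<sigma> where "\<sigma> \<longleftrightarrow> (\<Sum>x\<in>A. \<Sum>y\<in>B. R x y) > 0"
    define c where "c = (if \<sigma> then \<epsilon> else - \<epsilon>)"
    define R' where "R' x y = R x y - (if x \<in> A \<and> y \<in> B then c else 0)" for x y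
    have cs: "c * (\<Sum>x\<in>A. \<Sum>y\<in>B. R x y) \<ge> \<epsilon>\<^sup>2 * (real n)\<^sup>2"
    proof -
      have "c * (\<Sum>x\<in>A. \<Sum>y\<in>B. R x y) = \<epsilon> * \<bar>\<Sum>x\<in>A. \<Sum>y\<in>B. R x y\<bar>"
        by (simp add: c_def \<sigma>_def)
      also have "\<dots> \<ge> \<epsilon> * (\<epsilon> * (real n)\<^sup>2)" using AB(3) \<epsilon> by (intro mult_left_mono) auto
      finally show ?thesis by (simp add: power2_eq_square mult_ac)
    qed
    have restr: "(\<Sum>x<n. \<Sum>y<n. if x \<in> A \<and> y \<in> B then F x y else 0) = (\<Sum>x\<in>A. \<Sum>y\<in>B. F x y)" for F :: "nat \<Rightarrow> nat \<Rightarrow> real"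
    proof -
      have "(\<Sum>x<n. \<Sum>y<n. if x \<in> A \<and> y \<in> B then F x y else 0) = (\<Sum>x<n. if x \<in> A then \<Sum>y<n. if y \<in> B then F x y else 0 else 0)"
        by (intro sum.cong refl) auto
      also have "\<dots> = (\<Sum>x\<in>A. \<Sum>y<n. if y \<in> B then F x y else 0)"
        using AB by (simp add: sum.If_cases Int_absorb1)
      also have "\<dots> = (\<Sum>x\<in>A. \<Sum>y\<in>B. F x y)"
        using AB by (simp add: sum.If_cases Int_absorb1)
      finally show ?thesis .
    qed
    have "(\<Sum>x<n. \<Sum>y<n. (R' x y)\<^sup>2) = (\<Sum>x<n. \<Sum>y<n. (R x y)\<^sup>2 + (if x \<in> A \<and> y \<in> B then c\<^sup>2 - 2 * c * R x y else 0))"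
      by (intro sum.cong refl) (auto simp: R'_def power2_eq_square algebra_simps)
    also have "\<dots> = (\<Sum>x<n. \<Sum>y<n. (R x y)\<^sup>2) + (\<Sum>x\<in>A. \<Sum>y\<in>B. c\<^sup>2 - 2 * c * R x y)"
      by (simp add: sum.distrib restr)
    also have "(\<Sum>x\<in>A. \<Sum>y\<in>B. c\<^sup>2 - 2 * c * R x y) = real (card A) * real (card B) * c\<^sup>2 - 2 * (c * (\<Sum>x\<in>A. \<Sum>y\<in>B. R x y))"
      by (simp add: sum_subtractf sum_distrib_left mult_ac)
    also have "real (card A) * real (card B) * c\<^sup>2 \<le> real n * real n * \<epsilon>\<^sup>2"
    proof -
      have "card A \<le> n" "card B \<le> n" using AB card_mono[of "{..<n}"] by auto
      then show ?thesis by (intro mult_mono) (auto simp: c_def)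
    qed
    finally have "(\<Sum>x<n. \<Sum>y<n. (R' x y)\<^sup>2) \<le> (\<Sum>x<n. \<Sum>y<n. (R x y)\<^sup>2) - \<epsilon>\<^sup>2 * (real n)\<^sup>2"
      using cs by (simp add: power2_eq_square mult_ac)
    also have "\<dots> \<le> real k * \<epsilon>\<^sup>2 * (real n)\<^sup>2" using Suc.prems by (simp add: algebra_simps)
    finally have "\<exists>l. set l \<subseteq> UNIV \<times> Pow {..<n} \<times> Pow {..<n} \<and> length l = k \<and>
      (\<forall>A\<subseteq>{..<n}. \<forall>B\<subseteq>{..<n}. \<bar>\<Sum>x\<in>A. \<Sum>y\<in>B. R' x y - rect_sum \<epsilon> l x y\<bar> \<le> \<epsilon> * (real n)\<^sup>2)"
      by (rule Suc.IH)
    then obtain l where l: "set l \<subseteq> UNIV \<times> Pow {..<n} \<times> Pow {..<n}" "length l = k"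
      and l3: "\<forall>A\<subseteq>{..<n}. \<forall>B\<subseteq>{..<n}. \<bar>\<Sum>x\<in>A. \<Sum>y\<in>B. R' x y - rect_sum \<epsilon> l x y\<bar> \<le> \<epsilon> * (real n)\<^sup>2"
      by (elim exE conjE)
    have eq: "R' x y - rect_sum \<epsilon> l x y = R x y - rect_sum \<epsilon> ((\<sigma>, A, B) # l) x y" for x y
      by (simp add: R'_def c_def)
    show ?thesis
    proof (intro exI[of _ "(\<sigma>, A, B) # l"] conjI)
      show "set ((\<sigma>, A, B) # l) \<subseteq> UNIV \<times> Pow {..<n} \<times> Pow {..<n}" using l AB by simp
      show "\<forall>S\<subseteq>{..<n}. \<forall>T\<subseteq>{..<n}.
          \<bar>\<Sum>x\<in>S. \<Sum>y\<in>T. R x y - rect_sum \<epsilon> ((\<sigma>, A, B) # l) x y\<bar> \<le> \<epsilon> * (real n)\<^sup>2"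
        using l3 unfolding eq .
    qed (use l in simp)
  qed
qed

section \<open>Bernoulli products\<close>

definition bern :: "'e set \<Rightarrow> ('e \<Rightarrow> real) \<Rightarrow> 'e set \<Rightarrow> real" where
  "bern E q X = (\<Prod>e\<in>E. if e \<in> X then q e else 1 - q e)"

lemma bern_nonneg: "(\<And>e. e \<in> E \<Longrightarrow> q e \<in> {0..1}) \<Longrightarrow> bern E q X \<ge> 0"
  by (auto simp: bern_def intro!: prod_nonneg)

lemma bern_pos: "0 < p \<Longrightarrow> p < 1 \<Longrightarrow> bern E (\<lambda>_. p) X > 0"
  by (auto simp: bern_def intro!: prod_pos)

text \<open>Write each factor as \<open>q e + (1 - q e)\<close>, drop the second term for
  \<open>e\<close> in \<open>F\<close>, and expand over subsets: the surviving terms are those with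
  \<open>F \<subseteq> X\<close>.\<close>

lemma sum_bern_superset:
  assumes E: "finite E" and F: "F \<subseteq> E"
  shows "(\<Sum>X\<in>Pow E. of_bool (F \<subseteq> X) * bern E q X) = (\<Prod>e\<in>F. q e)"
proof -
  have "(\<Prod>e\<in>F. q e) = (\<Prod>e\<in>E. q e + (if e \<in> F then 0 else 1 - q e))"
    by (rule prod.mono_neutral_cong_left) (use E F in auto)
  also have "\<dots> = (\<Sum>X\<in>Pow E. (\<Prod>e\<in>X. q e) * (\<Prod>e\<in>E - X. if e \<in> F then 0 else 1 - q e))"
    by (rule prod_add[OF E])
  also have "\<dots> = (\<Sum>X\<in>Pow E. of_bool (F \<subseteq> X) * bern E q X)"
  proof (rule sum.cong)
    fix X assume X: "X \<in> Pow E"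
    show "(\<Prod>e\<in>X. q e) * (\<Prod>e\<in>E - X. if e \<in> F then 0 else 1 - q e) = of_bool (F \<subseteq> X) * bern E q X"
    proof (cases "F \<subseteq> X")
      case True
      have "E \<inter> {e. e \<in> X} = X" "E \<inter> - {e. e \<in> X} = E - X" using X by auto
      then have "bern E q X = (\<Prod>e\<in>X. q e) * (\<Prod>e\<in>E - X. 1 - q e)"
        using E by (simp add: bern_def prod.If_cases)
      moreover have "(\<Prod>e\<in>E - X. if e \<in> F then 0 else 1 - q e) = (\<Prod>e\<in>E - X. 1 - q e)"
        using True by (intro prod.cong) auto
      ultimately show ?thesis using True by simp
    next
      case False
      then obtain e where "e \<in> F" "e \<notin> X" by blast
      then have "(\<Prod>e\<in>E - X. if e \<in> F then 0 else 1 - q e) = 0"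
        using E F by (intro prod_zero) auto
      then show ?thesis using False by simp
    qed
  qed simp
  finally show ?thesis by simp
qed

lemma sum_bern: "finite E \<Longrightarrow> (\<Sum>X\<in>Pow E. bern E q X) = 1"
  using sum_bern_superset[of E "{}" q] by simp

lemma sum_bern_mem:
  assumes "finite E" "e \<in> E"
  shows "(\<Sum>X\<in>Pow E. bern E q X * (if e \<in> X then a else b)) = q e * a + (1 - q e) * b"
proof -
  have "(\<Sum>X\<in>Pow E. bern E q X * (if e \<in> X then a else b))
      = (\<Sum>X\<in>Pow E. b * bern E q X + (a - b) * (of_bool ({e} \<subseteq> X) * bern E q X))"
    by (intro sum.cong) (auto simp: algebra_simps)
  also have "\<dots> = b + (a - b) * q e"
    using assms sum_bern[of E q] sum_bern_superset[of E "{e}" q]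
    by (simp add: sum.distrib flip: sum_distrib_left)
  finally show ?thesis by (simp add: algebra_simps)
qed

text \<open>Superadditivity of relative entropy over product measures, applied to the measure conditioned
  on \<open>S\<close>; \<open>w\<close> is the vector of its marginals.\<close>

lemma conditional_entropy_bound:
  assumes E: "finite E" and p: "0 < p" "p < 1" and S: "S \<subseteq> Pow E" "S \<noteq> {}"
    and Z: "Z = (\<Sum>X\<in>S. bern E (\<lambda>_. p) X)"
    and w: "\<And>e. w e = (\<Sum>X\<in>S. of_bool (e \<in> X) * bern E (\<lambda>_. p) X) / Z"
  shows "ln Z \<le> - (\<Sum>e\<in>E. rel_entropy p (w e))" and "Z > 0" and "w e \<in> {0..1}"
proof -
  define P where "P = bern E (\<lambda>_. p)"
  have P: "P X > 0" for X using bern_pos[OF p] by (simp add: P_def)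
  have fS: "finite S" using E S finite_subset by (metis finite_Pow_iff)
  show Z0: "Z > 0" unfolding Z using S fS P by (intro sum_pos) (auto simp: P_def)
  define \<mu> where "\<mu> X = P X / Z" for X
  have \<mu>: "\<mu> X > 0" for X using P Z0 by (simp add: \<mu>_def)
  have \<mu>1: "(\<Sum>X\<in>S. \<mu> X) = 1" using Z Z0 by (simp add: \<mu>_def P_def flip: sum_divide_distrib)
  have w\<mu>: "w e = (\<Sum>X\<in>S. if e \<in> X then \<mu> X else 0)" for e
    unfolding w \<mu>_def P_def sum_divide_distrib by (intro sum.cong) auto
  have w\<mu>': "1 - w e = (\<Sum>X\<in>S. if e \<in> X then 0 else \<mu> X)" for e
    unfolding w\<mu> \<mu>1[symmetric] sum_subtractf[symmetric] by (intro sum.cong) auto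
  have w0: "w e \<ge> 0" for e unfolding w\<mu> using \<mu> by (intro sum_nonneg) (auto intro: less_imp_le)
  have w1: "1 - w e \<ge> 0" for e unfolding w\<mu>' using \<mu> by (intro sum_nonneg) (auto intro: less_imp_le)
  show w01: "w e \<in> {0..1}" for e using w0[of e] w1[of e] by simp
  \<comment> \<open>Every edge set in \<open>S\<close> has positive mass under the product of the
    marginals, so the logarithms below are genuine.\<close>
  have wpos: "(if e \<in> X then w e else 1 - w e) > 0" if X: "X \<in> S" for X e
  proof (cases "e \<in> X")
    case True
    have "w e > 0" unfolding w\<mu> using \<mu> True X fS
      by (intro sum_pos2[of S X]) (auto intro: less_imp_le)
    then show ?thesis using True by simp
  next
    case False
    have "1 - w e > 0" unfolding w\<mu>' using \<mu> False X fS
      by (intro sum_pos2[of S X]) (auto intro: less_imp_le)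
    then show ?thesis using False by simp
  qed
  define q where "q = bern E w"
  have q: "q X > 0" if "X \<in> S" for X
    unfolding q_def bern_def using wpos[OF that] by (intro prod_pos) auto
  define a where "a e = ln p - ln (w e)" for e
  define b where "b e = ln (1 - p) - ln (1 - w e)" for e
  have ratio: "ln (\<mu> X / q X) = (\<Sum>e\<in>E. if e \<in> X then a e else b e) - ln Z" if X: "X \<in> S" for X
  proof -
    have "ln (P X) = (\<Sum>e\<in>E. ln (if e \<in> X then p else 1 - p))"
      unfolding P_def bern_def using E p by (intro ln_prod) auto
    moreover have "ln (q X) = (\<Sum>e\<in>E. ln (if e \<in> X then w e else 1 - w e))"
      unfolding q_def bern_def by (rule ln_prod[OF E]) (metis wpos[OF X] less_irrefl)
    ultimately have "ln (P X) - ln (q X) = (\<Sum>e\<in>E. if e \<in> X then a e else b e)"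
      by (auto simp: a_def b_def simp flip: sum_subtractf intro!: sum.cong)
    then show ?thesis using P[of X] q[OF X] Z0 by (simp add: \<mu>_def ln_div ln_mult)
  qed
  \<comment> \<open>\<open>\<mu>\<close> has mass 1 on \<open>S\<close>, the product of its
    marginals at most 1. With Gibbs' inequality this makes the relative entropy of
    \<open>\<mu>\<close> to that product nonnegative, and this entropy splits over edges.\<close>
  have "0 \<le> (\<Sum>X\<in>S. \<mu> X - q X)"
  proof -
    have "(\<Sum>X\<in>S. q X) \<le> (\<Sum>X\<in>Pow E. q X)"
      using S E w01 by (intro sum_mono2) (auto simp: q_def intro!: bern_nonneg)
    then show ?thesis using sum_bern[OF E, of w] \<mu>1 by (simp add: sum_subtractf q_def)
  qed
  also have "\<dots> \<le> (\<Sum>X\<in>S. \<mu> X * ln (\<mu> X / q X))"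
    using \<mu> q by (intro sum_mono mult_ln_ratio_ge(1)) (auto intro: less_imp_le)
  also have "\<dots> = (\<Sum>X\<in>S. (\<Sum>e\<in>E. \<mu> X * (if e \<in> X then a e else b e)) - ln Z * \<mu> X)"
    by (intro sum.cong) (auto simp: ratio sum_distrib_left algebra_simps)
  also have "\<dots> = (\<Sum>e\<in>E. \<Sum>X\<in>S. \<mu> X * (if e \<in> X then a e else b e)) - ln Z"
    unfolding sum_subtractf sum.swap[of _ E S] sum_distrib_left[of "ln Z" \<mu> S, symmetric] \<mu>1 by simp
  also have "(\<Sum>e\<in>E. \<Sum>X\<in>S. \<mu> X * (if e \<in> X then a e else b e)) = (\<Sum>e\<in>E. w e * a e + (1 - w e) * b e)"
  proof (rule sum.cong)
    fix e
    show "(\<Sum>X\<in>S. \<mu> X * (if e \<in> X then a e else b e)) = w e * a e + (1 - w e) * b e"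
      unfolding w\<mu>' unfolding w\<mu> sum_distrib_right sum.distrib[symmetric] by (intro sum.cong) auto
  qed simp
  also have "\<dots> = - (\<Sum>e\<in>E. rel_entropy p (w e))"
    unfolding sum_negf[symmetric]
    by (intro sum.cong refl, subst rel_entropy_expand[OF p w01]) (simp add: a_def b_def algebra_simps)
  finally show "ln Z \<le> - (\<Sum>e\<in>E. rel_entropy p (w e))" by simp
qed

text \<open>The relative entropy of the tilted measure to the base measure is the entropy sum. It is
  split along \<open>S\<close>: the complement contributes at least \<open>Z - \<beta>\<close>, and
  on \<open>S\<close> comparison with the normalised mass \<open>P X / Z\<close> gives at least
  \<open>\<beta> - 1 - \<beta> * ln Z\<close>. Adding these leaves an error below 1.\<close>

lemma tilting_bound:
  assumes E: "finite E" and p: "0 < p" "p < 1" and S: "S \<subseteq> Pow E" "S \<noteq> {}"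
    and w: "\<And>e. e \<in> E \<Longrightarrow> w e \<in> {0..1}"
  shows "(\<Sum>X\<in>S. bern E w X) * - ln (\<Sum>X\<in>S. bern E (\<lambda>_. p) X) \<le> (\<Sum>e\<in>E. rel_entropy p (w e)) + 1"
proof -
  define P where "P = bern E (\<lambda>_. p)"
  define q where "q = bern E w"
  define Z where "Z = (\<Sum>X\<in>S. P X)"
  define \<beta> where "\<beta> = (\<Sum>X\<in>S. q X)"
  have P: "P X > 0" for X using bern_pos[OF p] by (simp add: P_def)
  have q: "q X \<ge> 0" for X using bern_nonneg w by (auto simp: q_def)
  have fS: "finite S" using E S finite_subset by (metis finite_Pow_iff)
  have Z0: "Z > 0" unfolding Z_def using S fS P by (intro sum_pos) auto
  have sumP: "(\<Sum>X\<in>Pow E. P X) = 1" "(\<Sum>X\<in>Pow E. q X) = 1" using sum_bern[OF E] by (auto simp: P_def q_def)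
  have "(\<Sum>X\<in>Pow E. q X * ln (q X / P X)) = (\<Sum>e\<in>E. rel_entropy p (w e))"
  proof -
    have "(\<Sum>X\<in>Pow E. q X * ln (q X / P X))
        = (\<Sum>X\<in>Pow E. \<Sum>e\<in>E. q X * (if e \<in> X then ln (w e / p) else ln ((1 - w e) / (1 - p))))"
    proof (rule sum.cong)
      fix X
      show "q X * ln (q X / P X) = (\<Sum>e\<in>E. q X * (if e \<in> X then ln (w e / p) else ln ((1 - w e) / (1 - p))))"
      proof (cases "q X = 0")
        case False
        have pos: "(if e \<in> X then w e else 1 - w e) > 0" if "e \<in> E" for e
        proof -
          have "(if e \<in> X then w e else 1 - w e) \<noteq> 0"
            using False E that by (auto simp: q_def bern_def)
          then show ?thesis using w[OF that] by (auto split: if_splits)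
        qed
        have "q X / P X = (\<Prod>e\<in>E. if e \<in> X then w e / p else (1 - w e) / (1 - p))"
          unfolding q_def P_def bern_def prod_dividef[symmetric] by (intro prod.cong) auto
        also have "ln \<dots> = (\<Sum>e\<in>E. ln (if e \<in> X then w e / p else (1 - w e) / (1 - p)))"
        proof (rule ln_prod[OF E])
          fix e assume "e \<in> E"
          then show "(if e \<in> X then w e / p else (1 - w e) / (1 - p)) \<noteq> 0"
            using pos[of e] p by (auto split: if_splits)
        qed
        also have "\<dots> = (\<Sum>e\<in>E. if e \<in> X then ln (w e / p) else ln ((1 - w e) / (1 - p)))"
          by (intro sum.cong) auto
        finally show ?thesis by (simp add: sum_distrib_left)
      qed simp
    qed simp
    also have "\<dots> = (\<Sum>e\<in>E. \<Sum>X\<in>Pow E. q X * (if e \<in> X then ln (w e / p) else ln ((1 - w e) / (1 - p))))"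
      by (rule sum.swap)
    also have "\<dots> = (\<Sum>e\<in>E. rel_entropy p (w e))"
      unfolding q_def by (intro sum.cong refl) (simp add: sum_bern_mem[OF E] rel_entropy_def)
    finally show ?thesis .
  qed
  moreover have "(\<Sum>X\<in>Pow E. q X * ln (q X / P X)) = (\<Sum>X\<in>Pow E - S. q X * ln (q X / P X)) + (\<Sum>X\<in>S. q X * ln (q X / P X))"
    using S E by (intro sum.subset_diff) auto
  moreover have "(\<Sum>X\<in>Pow E - S. q X * ln (q X / P X)) \<ge> Z - \<beta>"
  proof -
    have "(\<Sum>X\<in>Pow E - S. q X * ln (q X / P X)) \<ge> (\<Sum>X\<in>Pow E - S. q X - P X)"
      using P q by (intro sum_mono mult_ln_ratio_ge(1)) auto
    moreover have "(\<Sum>X\<in>Pow E - S. q X - P X) = Z - \<beta>"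
      using sumP S E by (simp add: sum_subtractf sum_diff Z_def \<beta>_def)
    ultimately show ?thesis by simp
  qed
  moreover have "(\<Sum>X\<in>S. q X * ln (q X / P X)) \<ge> \<beta> - 1 - \<beta> * ln Z"
  proof -
    have "(\<Sum>X\<in>S. q X * ln (q X / P X)) \<ge> (\<Sum>X\<in>S. q X - P X / Z - q X * ln Z)"
    proof (rule sum_mono)
      fix X
      have "q X * ln (q X / (P X / Z)) \<ge> q X - P X / Z"
        using P q Z0 by (intro mult_ln_ratio_ge(1)) auto
      moreover have "q X * ln (q X / (P X / Z)) = q X * ln (q X / P X) + q X * ln Z"
      proof (cases "q X = 0")
        case False
        then have "q X > 0" using q[of X] by simp
        then show ?thesis using P[of X] Z0 by (simp add: ln_div ln_mult algebra_simps)
      qed simp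
      ultimately show "q X - P X / Z - q X * ln Z \<le> q X * ln (q X / P X)" by simp
    qed
    moreover have "(\<Sum>X\<in>S. q X - P X / Z - q X * ln Z) = \<beta> - 1 - \<beta> * ln Z"
      using Z0 by (simp add: sum_subtractf \<beta>_def Z_def flip: sum_divide_distrib sum_distrib_right)
    ultimately show ?thesis by simp
  qed
  ultimately have "\<beta> * - ln Z \<le> (\<Sum>e\<in>E. rel_entropy p (w e)) + 1" using Z0 by simp
  then show ?thesis by (simp add: \<beta>_def Z_def P_def q_def)
qed

lemma prob_random_graph:
  assumes p: "0 < p" "p < 1"
  shows "measure (measure_pmf (random_graph n p)) {G. Q G}
    = (\<Sum>X\<in>{X \<in> Pow (all_edges {..<n}). Q ({..<n}, X)}. bern (all_edges {..<n}) (\<lambda>_. p) X)"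
proof -
  let ?E = "all_edges {..<n}"
  let ?M = "Pi_pmf ?E False (\<lambda>_. bernoulli_pmf p)"
  let ?f = "\<lambda>\<omega>. ({..<n}, {e \<in> ?E. \<omega> e})"
  define S where "S = {X \<in> Pow ?E. Q ({..<n}, X)}"
  have fE: "finite ?E" by (rule finite_all_edges)
  have "measure (measure_pmf (random_graph n p)) {G. Q G} = measure (measure_pmf ?M) {\<omega>. Q (?f \<omega>)}"
    unfolding random_graph_def by (simp add: vimage_def)
  also have "\<dots> = measure (measure_pmf ?M) ((\<lambda>X e. e \<in> X) ` S)"
  \<comment> \<open>Almost surely the outcome takes the default value \<open>False\<close> off the
    potential edges, so it is the characteristic function of an edge set.\<close>
  proof (rule measure_pmf.finite_measure_eq_AE)
    show "AE \<omega> in measure_pmf ?M. (\<omega> \<in> {\<omega>. Q (?f \<omega>)}) = (\<omega> \<in> (\<lambda>X e. e \<in> X) ` S)"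
    proof (rule AE_pmfI)
      fix \<omega> assume "\<omega> \<in> set_pmf ?M"
      then have "\<omega> \<in> {f. \<forall>x. x \<notin> ?E \<longrightarrow> f x = False}" using set_Pi_pmf_subset[OF fE] by (rule subsetD[rotated])
      then have out: "\<omega> e = False" if "e \<notin> ?E" for e using that by blast
      have eq: "\<omega> = (\<lambda>e. e \<in> {e \<in> ?E. \<omega> e})" using out by (auto simp: fun_eq_iff)
      have eq2: "{e \<in> ?E. e \<in> X} = X" if "X \<in> S" for X using that by (auto simp: S_def)
      show "(\<omega> \<in> {\<omega>. Q (?f \<omega>)}) = (\<omega> \<in> (\<lambda>X e. e \<in> X) ` S)"
      proof
        assume "\<omega> \<in> {\<omega>. Q (?f \<omega>)}"
        then have "{e \<in> ?E. \<omega> e} \<in> S" by (auto simp: S_def)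
        then show "\<omega> \<in> (\<lambda>X e. e \<in> X) ` S" by (subst eq) (rule imageI)
      next
        assume "\<omega> \<in> (\<lambda>X e. e \<in> X) ` S"
        then obtain X where X: "X \<in> S" "\<omega> = (\<lambda>e. e \<in> X)" by blast
        then show "\<omega> \<in> {\<omega>. Q (?f \<omega>)}" using eq2[OF X(1)] by (simp add: S_def)
      qed
    qed
  qed auto
  also have "\<dots> = (\<Sum>\<omega>\<in>(\<lambda>X e. e \<in> X) ` S. pmf ?M \<omega>)"
    using fE by (intro measure_measure_pmf_finite finite_imageI) (simp add: S_def)
  also have "\<dots> = (\<Sum>X\<in>S. pmf ?M (\<lambda>e. e \<in> X))"
    by (subst sum.reindex) (auto simp: inj_on_def fun_eq_iff)
  also have "\<dots> = (\<Sum>X\<in>S. bern ?E (\<lambda>_. p) X)"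
  proof (rule sum.cong)
    fix X assume "X \<in> S"
    then have "pmf ?M (\<lambda>e. e \<in> X) = (\<Prod>e\<in>?E. pmf (bernoulli_pmf p) (e \<in> X))"
      using fE by (subst pmf_Pi') (auto simp: S_def)
    also have "\<dots> = bern ?E (\<lambda>_. p) X"
      unfolding bern_def using p by (intro prod.cong) auto
    finally show "pmf ?M (\<lambda>e. e \<in> X) = bern ?E (\<lambda>_. p) X" .
  qed simp
  finally show ?thesis by (simp add: S_def)
qed

section \<open>Concentration and the lower bound\<close>

text \<open>An injective map sends distinct edges of \<open>H\<close> to distinct pairs of vertices,
  so the expectation is a product over the edges.\<close>

lemma expectation_hom_product:
  fixes H :: "'a graph" and \<phi> :: "'a \<Rightarrow> nat" and n :: nat
  assumes H: "finite_simple_graph H" and \<phi>: "\<phi> \<in> verts H \<rightarrow>\<^sub>E {..<n}" and inj: "inj_on \<phi> (verts H)"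
  shows "(\<Sum>X\<in>Pow (all_edges {..<n}). of_bool ((`) \<phi> ` edges H \<subseteq> X) * bern (all_edges {..<n}) w X)
    = (\<Prod>e\<in>edges H. w (\<phi> ` e))"
proof -
  have sub: "e \<subseteq> verts H" "card e = 2" if "e \<in> edges H" for e
    using H that by (auto simp: finite_simple_graph_def all_edges_def)
  have "(`) \<phi> ` edges H \<subseteq> all_edges {..<n}"
  proof (rule image_subsetI)
    fix e assume e: "e \<in> edges H"
    have "card (\<phi> ` e) = 2" using sub[OF e] inj by (simp add: card_image inj_on_subset)
    moreover have "\<phi> ` e \<subseteq> {..<n}" using sub[OF e] \<phi> by (auto simp: PiE_iff)
    ultimately show "\<phi> ` e \<in> all_edges {..<n}" by (simp add: all_edges_def)
  qed
  then have "(\<Sum>X\<in>Pow (all_edges {..<n}). of_bool ((`) \<phi> ` edges H \<subseteq> X) * bern (all_edges {..<n}) w X)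
    = (\<Prod>f\<in>(`) \<phi> ` edges H. w f)"
    by (rule sum_bern_superset[OF finite_all_edges])
  also have "inj_on ((`) \<phi>) (edges H)"
    using sub inj by (intro inj_onI) (metis inj_on_image_eq_iff)
  then have "(\<Prod>f\<in>(`) \<phi> ` edges H. w f) = (\<Prod>e\<in>edges H. w (\<phi> ` e))"
    by (simp add: prod.reindex)
  finally show ?thesis .
qed

text \<open>Vertex-disjoint images have disjoint edge sets, hence independent events. If some image
  is not a potential edge, both sides are 0.\<close>

lemma expectation_hom_pair:
  fixes H :: "'a graph" and \<phi> \<psi> :: "'a \<Rightarrow> nat" and n :: nat
  assumes H: "finite_simple_graph H"
    and disj: "\<And>a b. a \<in> verts H \<Longrightarrow> b \<in> verts H \<Longrightarrow> \<phi> a \<noteq> \<psi> b"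
  defines "E \<equiv> all_edges {..<n}"
  shows "(\<Sum>X\<in>Pow E. of_bool ((`) \<phi> ` edges H \<subseteq> X) * of_bool ((`) \<psi> ` edges H \<subseteq> X) * bern E w X)
    = (\<Sum>X\<in>Pow E. of_bool ((`) \<phi> ` edges H \<subseteq> X) * bern E w X)
      * (\<Sum>X\<in>Pow E. of_bool ((`) \<psi> ` edges H \<subseteq> X) * bern E w X)"
proof -
  have fE: "finite E" unfolding E_def by (rule finite_all_edges)
  define F where "F = (`) \<phi> ` edges H"
  define F' where "F' = (`) \<psi> ` edges H"
  have "F \<inter> F' = {}"
  proof (rule ccontr)
    assume "F \<inter> F' \<noteq> {}"
    then obtain e e' where e: "e \<in> edges H" "e' \<in> edges H" "\<phi> ` e = \<psi> ` e'" by (auto simp: F_def F'_def)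
    obtain a b where ab: "e = {a, b}" "a \<in> verts H" using edge_cases[OF H e(1)] by metis
    have "\<phi> a \<in> \<psi> ` e'" using e(3) ab by auto
    then obtain c where "c \<in> e'" "\<phi> a = \<psi> c" by auto
    moreover have "e' \<subseteq> verts H" using H e by (auto simp: finite_simple_graph_def all_edges_def)
    ultimately show False using disj ab by auto
  qed
  have split: "of_bool (F \<subseteq> X) * of_bool (F' \<subseteq> X) = (of_bool (F \<union> F' \<subseteq> X) :: real)" for X by auto
  have zero: "(\<Sum>X\<in>Pow E. of_bool (G \<subseteq> X) * bern E w X) = 0" if "\<not> G \<subseteq> E" for G
    using that by (intro sum.neutral ballI) auto
  have "(\<Sum>X\<in>Pow E. of_bool (F \<union> F' \<subseteq> X) * bern E w X)
    = (\<Sum>X\<in>Pow E. of_bool (F \<subseteq> X) * bern E w X) * (\<Sum>X\<in>Pow E. of_bool (F' \<subseteq> X) * bern E w X)"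
  proof (cases "F \<union> F' \<subseteq> E")
    case True
    then have "finite F" "finite F'" using fE finite_subset by auto
    then show ?thesis
      using sum_bern_superset[OF fE, of F w] sum_bern_superset[OF fE, of F' w]
        sum_bern_superset[OF fE True, of w] True \<open>F \<inter> F' = {}\<close>
      by (simp add: prod.union_disjoint)
  next
    case False
    then have "\<not> F \<subseteq> E \<or> \<not> F' \<subseteq> E" by auto
    then show ?thesis using zero[OF False] zero[of F] zero[of F'] by auto
  qed
  then show ?thesis by (simp only: F_def[symmetric] F'_def[symmetric] split)
qed

text \<open>Chebyshev's inequality. Non-injective maps lower the mean by at most \<open>c\<close>,
  hence by at most one \<open>\<epsilon>\<close>; the other \<open>\<epsilon>\<close> is the
  deviation. The variance is at most \<open>c\<close>, since only pairs of maps with a common vertex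
  are correlated.\<close>

lemma density_concentration:
  assumes H: "finite_simple_graph H" and n: "n > 0" and w: "\<And>e. w e \<in> {0..1}" and \<epsilon>: "\<epsilon> > 0"
    and t: "\<tau> + 2 * \<epsilon> \<le> weighted_density H n w"
    and small: "(real (card (verts H)))\<^sup>2 / real n \<le> \<epsilon>"
  shows "(\<Sum>X\<in>{X \<in> Pow (all_edges {..<n}). \<tau> \<le> weighted_density H n (\<lambda>e. of_bool (e \<in> X))}.
           bern (all_edges {..<n}) w X) \<ge> 1 - ((real (card (verts H)))\<^sup>2 / real n) / \<epsilon>\<^sup>2"
proof -
  define E where "E = all_edges {..<n}"
  define B where "B = bern E w"
  define N where "N = real n ^ card (verts H)"
  define c where "c = (real (card (verts H)))\<^sup>2 / real n"
  define \<Phi> where "\<Phi> = verts H \<rightarrow>\<^sub>E {..<n}"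
  define Y where "Y \<phi> X = (of_bool ((`) \<phi> ` edges H \<subseteq> X) :: real)" for \<phi> :: "'a \<Rightarrow> nat" and X
  define T where "T X = weighted_density H n (\<lambda>e. of_bool (e \<in> X))" for X
  define g where "g \<phi> = (\<Sum>X\<in>Pow E. Y \<phi> X * B X)" for \<phi>
  have fin: "finite (verts H)" "finite (edges H)" using H finite_edges[OF H] by (auto simp: finite_simple_graph_def)
  have fE: "finite E" unfolding E_def by (rule finite_all_edges)
  have f\<Phi>: "finite \<Phi>" unfolding \<Phi>_def using fin by (intro finite_PiE) auto
  have N: "N > 0" using n by (simp add: N_def)
  have c\<Phi>: "real (card \<Phi>) = N" using fin by (simp add: \<Phi>_def N_def card_funcsetE)
  have B0: "B X \<ge> 0" for X using w by (auto simp: B_def intro!: bern_nonneg)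
  have B1: "(\<Sum>X\<in>Pow E. B X) = 1" unfolding B_def by (rule sum_bern[OF fE])
  have Y01: "0 \<le> Y \<phi> X" "Y \<phi> X \<le> 1" for \<phi> X by (auto simp: Y_def)
  have T: "T X = (\<Sum>\<phi>\<in>\<Phi>. Y \<phi> X) / N" for X
  proof -
    have "(\<Prod>e\<in>F. of_bool (\<phi> ` e \<in> X)) = (of_bool ((`) \<phi> ` F \<subseteq> X) :: real)" if "finite F" for F and \<phi> :: "'a \<Rightarrow> nat"
      using that by (induction F rule: finite_induct) auto
    then show ?thesis using fin by (simp add: T_def weighted_density_def hom_sum_def \<Phi>_def N_def Y_def)
  qed
  have g01: "0 \<le> g \<phi>" "g \<phi> \<le> 1" for \<phi>
  proof -
    show "0 \<le> g \<phi>" unfolding g_def using Y01 B0 by (intro sum_nonneg mult_nonneg_nonneg)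
    have "g \<phi> \<le> (\<Sum>X\<in>Pow E. B X)" unfolding g_def using Y01 B0 by (intro sum_mono mult_left_le_one_le)
    then show "g \<phi> \<le> 1" using B1 by simp
  qed
  define m where "m = (\<Sum>X\<in>Pow E. T X * B X)"
  have m: "m = (\<Sum>\<phi>\<in>\<Phi>. g \<phi>) / N"
    unfolding m_def T g_def by (subst sum.swap) (simp add: sum_distrib_right sum_divide_distrib)
  have m_ge: "m \<ge> weighted_density H n w - c"
  proof -
    define I where "I = {\<phi> \<in> \<Phi>. inj_on \<phi> (verts H)}"
    have "hom_sum H n w \<le> (\<Sum>\<phi>\<in>I. \<Prod>e\<in>edges H. w (\<phi> ` e)) + (\<Sum>\<phi>\<in>\<Phi> - I. 1)"
    proof -
      have "hom_sum H n w = (\<Sum>\<phi>\<in>\<Phi> - I. \<Prod>e\<in>edges H. w (\<phi> ` e)) + (\<Sum>\<phi>\<in>I. \<Prod>e\<in>edges H. w (\<phi> ` e))"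
        unfolding hom_sum_def \<Phi>_def[symmetric] using f\<Phi> by (intro sum.subset_diff) (auto simp: I_def)
      moreover have "(\<Sum>\<phi>\<in>\<Phi> - I. \<Prod>e\<in>edges H. w (\<phi> ` e)) \<le> (\<Sum>\<phi>\<in>\<Phi> - I. 1)"
        using w by (intro sum_mono prod_le_1) auto
      ultimately show ?thesis by simp
    qed
    also have "(\<Sum>\<phi>\<in>I. \<Prod>e\<in>edges H. w (\<phi> ` e)) = (\<Sum>\<phi>\<in>I. g \<phi>)"
      unfolding g_def Y_def B_def E_def
      by (intro sum.cong refl expectation_hom_product[OF H, symmetric]) (auto simp: I_def \<Phi>_def)
    also have "(\<Sum>\<phi>\<in>I. g \<phi>) \<le> (\<Sum>\<phi>\<in>\<Phi>. g \<phi>)"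
      using f\<Phi> g01 by (intro sum_mono2) (auto simp: I_def)
    also have "(\<Sum>\<phi>\<in>\<Phi> - I. 1) \<le> c * N"
    proof -
      have "\<Phi> - I = {\<phi> \<in> verts H \<rightarrow>\<^sub>E {..<n}. \<not> inj_on \<phi> (verts H)}" by (auto simp: I_def \<Phi>_def)
      then show ?thesis using card_maps_not_inj[OF fin(1) n] by (simp add: c_def N_def)
    qed
    finally have "hom_sum H n w / N \<le> ((\<Sum>\<phi>\<in>\<Phi>. g \<phi>) + c * N) / N" using N by (simp add: divide_right_mono)
    then show ?thesis using N by (simp add: m weighted_density_def N_def[symmetric] add_divide_distrib)
  qed
  have second: "(\<Sum>X\<in>Pow E. (T X)\<^sup>2 * B X) \<le> m\<^sup>2 + c"
  proof -
    define M where "M = {(\<phi>, \<psi>) \<in> \<Phi> \<times> \<Phi>. \<exists>a\<in>verts H. \<exists>b\<in>verts H. \<phi> a = \<psi> b}"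
    have M: "M \<subseteq> \<Phi> \<times> \<Phi>" by (auto simp: M_def)
    define G where "G z = (\<Sum>X\<in>Pow E. Y (fst z) X * Y (snd z) X * B X)" for z
    have "(\<Sum>X\<in>Pow E. (T X)\<^sup>2 * B X) = (\<Sum>X\<in>Pow E. \<Sum>z\<in>\<Phi> \<times> \<Phi>. Y (fst z) X * Y (snd z) X * B X / N\<^sup>2)"
    proof (rule sum.cong)
      fix X
      have "(\<Sum>\<phi>\<in>\<Phi>. Y \<phi> X)\<^sup>2 = (\<Sum>z\<in>\<Phi> \<times> \<Phi>. Y (fst z) X * Y (snd z) X)"
        by (simp add: power2_eq_square sum_product sum.cartesian_product case_prod_unfold)
      then show "(T X)\<^sup>2 * B X = (\<Sum>z\<in>\<Phi> \<times> \<Phi>. Y (fst z) X * Y (snd z) X * B X / N\<^sup>2)"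
        by (simp add: T power_divide flip: sum_divide_distrib sum_distrib_right)
    qed simp
    also have "\<dots> = (\<Sum>z\<in>\<Phi> \<times> \<Phi>. G z) / N\<^sup>2"
      unfolding G_def by (subst sum.swap) (simp flip: sum_divide_distrib)
    also have "(\<Sum>z\<in>\<Phi> \<times> \<Phi>. G z) \<le> (\<Sum>z\<in>\<Phi> \<times> \<Phi>. g (fst z) * g (snd z) + of_bool (z \<in> M))"
    proof (rule sum_mono)
      fix z assume z: "z \<in> \<Phi> \<times> \<Phi>"
      show "G z \<le> g (fst z) * g (snd z) + of_bool (z \<in> M)"
      proof (cases "z \<in> M")
        case True
        have "G z \<le> (\<Sum>X\<in>Pow E. B X)"
          unfolding G_def
        proof (rule sum_mono)
          fix X
          have "0 \<le> Y (fst z) X * Y (snd z) X" by (rule mult_nonneg_nonneg[OF Y01(1) Y01(1)])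
          moreover have "Y (fst z) X * Y (snd z) X \<le> 1" by (rule mult_le_one[OF Y01(2) Y01(1) Y01(2)])
          ultimately show "Y (fst z) X * Y (snd z) X * B X \<le> B X" by (rule mult_left_le_one_le[OF B0])
        qed
        then have "G z \<le> 1" using B1 by simp
        moreover have "0 \<le> g (fst z) * g (snd z)" using g01 by (intro mult_nonneg_nonneg) auto
        ultimately show ?thesis using True by simp
      next
        case False
        then have "fst z a \<noteq> snd z b" if "a \<in> verts H" "b \<in> verts H" for a b
          using z that by (cases z) (auto simp: M_def)
        then have "G z = g (fst z) * g (snd z)"
          unfolding G_def g_def Y_def B_def E_def by (rule expectation_hom_pair[OF H])
        then show ?thesis by simp
      qed
    qed
    also have "\<dots> = (\<Sum>\<phi>\<in>\<Phi>. g \<phi>)\<^sup>2 + real (card M)"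
    proof -
      have "(\<Sum>z\<in>\<Phi> \<times> \<Phi>. g (fst z) * g (snd z)) = (\<Sum>\<phi>\<in>\<Phi>. g \<phi>)\<^sup>2"
        by (simp add: power2_eq_square sum_product sum.cartesian_product case_prod_unfold)
      moreover have "(\<Sum>z\<in>\<Phi> \<times> \<Phi>. of_bool (z \<in> M)) = real (card M)"
        using f\<Phi> M by (simp add: of_bool_def sum.If_cases Int_absorb1)
      ultimately show ?thesis by (simp add: sum.distrib)
    qed
    also have "real (card M) \<le> c * N\<^sup>2"
      unfolding M_def \<Phi>_def c_def N_def by (rule card_map_pairs_meet[OF fin(1) n])
    finally have "(\<Sum>X\<in>Pow E. (T X)\<^sup>2 * B X) \<le> ((\<Sum>\<phi>\<in>\<Phi>. g \<phi>)\<^sup>2 + c * N\<^sup>2) / N\<^sup>2"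
      by (simp add: divide_right_mono)
    then show ?thesis using N by (simp add: m add_divide_distrib power_divide)
  qed
  have var: "(\<Sum>X\<in>Pow E. (T X - m)\<^sup>2 * B X) \<le> c"
  proof -
    have "(\<Sum>X\<in>Pow E. (T X - m)\<^sup>2 * B X) = (\<Sum>X\<in>Pow E. (T X)\<^sup>2 * B X - 2 * m * (T X * B X) + m\<^sup>2 * B X)"
      by (intro sum.cong) (auto simp: power2_eq_square algebra_simps)
    also have "\<dots> = (\<Sum>X\<in>Pow E. (T X)\<^sup>2 * B X) - 2 * m * m + m\<^sup>2"
      using B1 by (simp add: sum.distrib sum_subtractf m_def flip: sum_distrib_left)
    finally show ?thesis using second by (simp add: power2_eq_square)
  qed
  define S where "S = {X \<in> Pow E. \<tau> \<le> T X}"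
  have fS: "S \<subseteq> Pow E" by (auto simp: S_def)
  have "\<epsilon>\<^sup>2 * (\<Sum>X\<in>Pow E - S. B X) \<le> (\<Sum>X\<in>Pow E - S. (T X - m)\<^sup>2 * B X)"
    unfolding sum_distrib_left
  proof (intro sum_mono mult_right_mono B0)
    fix X assume "X \<in> Pow E - S"
    then have "T X < \<tau>" by (auto simp: S_def)
    then have "m - T X \<ge> \<epsilon>" using m_ge t small by (simp add: c_def)
    then have "\<epsilon>\<^sup>2 \<le> (m - T X)\<^sup>2" using \<epsilon> by (intro power_mono) auto
    then show "\<epsilon>\<^sup>2 \<le> (T X - m)\<^sup>2" by (simp add: power2_commute)
  qed
  also have "\<dots> \<le> (\<Sum>X\<in>Pow E. (T X - m)\<^sup>2 * B X)" using fE B0 by (intro sum_mono2) auto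
  finally have "\<epsilon>\<^sup>2 * (\<Sum>X\<in>Pow E - S. B X) \<le> c" using var by simp
  then have "(\<Sum>X\<in>Pow E - S. B X) \<le> c / \<epsilon>\<^sup>2" using \<epsilon> by (simp add: pos_le_divide_eq mult.commute)
  moreover have "(\<Sum>X\<in>Pow E. B X) = (\<Sum>X\<in>Pow E - S. B X) + (\<Sum>X\<in>S. B X)"
    using fS fE by (intro sum.subset_diff) auto
  ultimately show ?thesis using B1 by (simp add: S_def T_def E_def B_def c_def)
qed

definition tail_prob :: "real \<Rightarrow> 'a graph \<Rightarrow> real \<Rightarrow> nat \<Rightarrow> real" where
  "tail_prob p H \<tau> n = (\<Sum>X\<in>{X \<in> Pow (all_edges {..<n}). \<tau> \<le> weighted_density H n (\<lambda>e. of_bool (e \<in> X))}.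
     bern (all_edges {..<n}) (\<lambda>_. p) X)"

text \<open>All ordered pairs count, the diagonal included, so that the value is invariant under
  blow-up.\<close>

definition step_entropy :: "real \<Rightarrow> nat \<Rightarrow> (nat set \<Rightarrow> real) \<Rightarrow> real" where
  "step_entropy p n w = (\<Sum>x<n. \<Sum>y<n. rel_entropy p (w {x, y})) / (real n)\<^sup>2"

lemma step_entropy_nonneg:
  assumes "0 < p" "p < 1" "\<And>e. w e \<in> {0..1}"
  shows "step_entropy p n w \<ge> 0"
  unfolding step_entropy_def using assms by (intro divide_nonneg_nonneg sum_nonneg rel_entropy_nonneg) auto

text \<open>The weights on \<open>n\<close> vertices serve as a template for every large
  \<open>m\<close>: blow them up, pad with weight \<open>p\<close>, which has entropy 0, and tilt to
  the result. Concentration makes the event likely under the tilted measure.\<close>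

lemma tail_prob_lower:
  assumes p: "0 < p" "p < 1" and H: "finite_simple_graph H" and n: "n > 0"
    and w: "\<And>e. w e \<in> {0..1}" and \<tau>: "\<tau> < weighted_density H n w" and \<eta>: "\<eta> > 0"
  shows "\<forall>\<^sub>F m in sequentially. tail_prob p H \<tau> m > 0 \<and>
    - ln (tail_prob p H \<tau> m) \<le> real (m choose 2) * (step_entropy p n w + \<eta>)"
proof -
  define v where "v = card (verts H)"
  define t where "t = weighted_density H n w"
  \<comment> \<open>One third of the gap is lost to the padding, two thirds to
    concentration.\<close>
  define \<epsilon> where "\<epsilon> = (t - \<tau>) / 3"
  define J where "J = step_entropy p n w"
  define c where "c = (real v)\<^sup>2 / \<epsilon>\<^sup>2"
  have \<epsilon>: "\<epsilon> > 0" "\<tau> + 3 * \<epsilon> = t" using \<tau> by (auto simp: \<epsilon>_def t_def field_simps)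
  have J0: "J \<ge> 0" unfolding J_def by (rule step_entropy_nonneg[OF p w])
  have t0: "t \<ge> 0" unfolding t_def using w by (intro weighted_density_nonneg) auto
  have "(\<lambda>m. (1 - real n / real m) ^ v * t) \<longlonglongrightarrow> (1 - 0) ^ v * t"
    by (intro tendsto_intros)
  then have ev1: "\<forall>\<^sub>F m in sequentially. (1 - real n / real m) ^ v * t > \<tau> + 2 * \<epsilon>"
    by (rule order_tendstoD) (use \<epsilon> in simp)
  have "(\<lambda>m. (real v)\<^sup>2 / real m) \<longlonglongrightarrow> 0" by real_asymp
  then have ev2: "\<forall>\<^sub>F m in sequentially. (real v)\<^sup>2 / real m < \<epsilon>"
    by (rule order_tendstoD) (use \<epsilon> in simp)
  have "(\<lambda>m. c / real m) \<longlonglongrightarrow> 0" by real_asymp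
  then have ev3: "\<forall>\<^sub>F m in sequentially. c / real m < 1" by (rule order_tendstoD) simp
  \<comment> \<open>Three vanishing losses at once: the failure probability \<open>c / m\<close>,
    the ratio of \<open>m choose 2\<close> to \<open>m\<^sup>2 / 2\<close>, and the summand 1 of
    \<open>tilting_bound\<close>. The limit is \<open>\<eta> / 2\<close>.\<close>
  have l4: "(\<lambda>m. (1 - c / real m) * ((1 - 1 / real m) / 2 * (J + \<eta>)) - (J / 2 + 1 / (real m)\<^sup>2)) \<longlonglongrightarrow>
      (1 - 0) * ((1 - 0) / 2 * (J + \<eta>)) - (J / 2 + 0)"
  proof -
    have "(\<lambda>m. c / real m) \<longlonglongrightarrow> 0" "(\<lambda>m. 1 / real m) \<longlonglongrightarrow> 0" "(\<lambda>m. 1 / (real m)\<^sup>2) \<longlonglongrightarrow> 0"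
      by real_asymp+
    then show ?thesis by (intro tendsto_intros) auto
  qed
  have ev4: "\<forall>\<^sub>F m in sequentially.
      (1 - c / real m) * ((1 - 1 / real m) / 2 * (J + \<eta>)) - (J / 2 + 1 / (real m)\<^sup>2) > 0"
    by (rule order_tendstoD(1)[OF l4]) (use \<eta> in \<open>simp add: field_simps\<close>)
  show ?thesis
    using ev1 ev2 ev3 ev4 eventually_ge_at_top[of n]
  proof eventually_elim
    case (elim m)
    have m: "m > 0" using n elim by simp
    define q where "q = m div n"
    have qm: "q * n \<le> m" by (simp add: q_def)
    have qm2: "m - n \<le> q * n" using div_mult_mod_eq[of m n] mod_less_divisor[OF n, of m] unfolding q_def by linarith
    define \<pi> where "\<pi> e = (\<lambda>x. x mod n) ` e" for e :: "nat set"
    define w' where "w' e = (if e \<subseteq> {..<q * n} then w (\<pi> e) else p)" for e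
    have w': "w' e \<in> {0..1}" for e using w p by (auto simp: w'_def)
    have "real q ^ v * hom_sum H n w \<le> hom_sum H m w'"
      unfolding v_def using H w w' n qm
      by (intro hom_sum_blow_up) (auto simp: finite_simple_graph_def all_edges_def w'_def \<pi>_def)
    then have "real q ^ v * (t * real n ^ v) / real m ^ v \<le> weighted_density H m w'"
      using n by (simp add: t_def weighted_density_def v_def divide_right_mono)
    moreover have "real q ^ v * (t * real n ^ v) / real m ^ v = (real (q * n) / real m) ^ v * t"
      by (simp add: power_divide power_mult_distrib)
    moreover have "(real (q * n) / real m) ^ v * t \<ge> (1 - real n / real m) ^ v * t"
    proof (intro mult_right_mono power_mono t0)
      have "real m - real n \<le> real (q * n)" using qm2 by linarith
      then have "(real m - real n) / real m \<le> real (q * n) / real m" by (intro divide_right_mono) auto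
      then show "1 - real n / real m \<le> real (q * n) / real m" using m by (simp add: diff_divide_distrib)
      show "0 \<le> 1 - real n / real m" using elim m by simp
    qed
    ultimately have t': "\<tau> + 2 * \<epsilon> \<le> weighted_density H m w'" using elim by linarith
    define E where "E = all_edges {..<m}"
    define S where "S = {X \<in> Pow E. \<tau> \<le> weighted_density H m (\<lambda>e. of_bool (e \<in> X))}"
    define \<beta> where "\<beta> = (\<Sum>X\<in>S. bern E w' X)"
    have \<beta>: "\<beta> \<ge> 1 - c / real m"
      using density_concentration[OF H m w' \<epsilon>(1) t'] elim by (simp add: v_def c_def \<beta>_def S_def E_def mult.commute)
    then have \<beta>0: "\<beta> > 0" using elim by linarith
    have S: "S \<noteq> {}" "S \<subseteq> Pow E"
    proof -
      show "S \<noteq> {}" using \<beta>0 unfolding \<beta>_def by (intro notI) simp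
      show "S \<subseteq> Pow E" by (auto simp: S_def)
    qed
    have tp: "tail_prob p H \<tau> m = (\<Sum>X\<in>S. bern E (\<lambda>_. p) X)" by (simp add: tail_prob_def S_def E_def)
    have fE: "finite E" unfolding E_def by (rule finite_all_edges)
    have pos: "tail_prob p H \<tau> m > 0"
      unfolding tp using S fE finite_subset[OF S(2)] by (intro sum_pos bern_pos p) auto
    have le1: "tail_prob p H \<tau> m \<le> 1"
    proof -
      have "tail_prob p H \<tau> m \<le> (\<Sum>X\<in>Pow E. bern E (\<lambda>_. p) X)"
        unfolding tp using S fE p by (intro sum_mono2 bern_nonneg) auto
      then show ?thesis using sum_bern[OF fE] by simp
    qed
    have ent: "(\<Sum>e\<in>E. rel_entropy p (w' e)) \<le> (real m)\<^sup>2 / 2 * J"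
    proof -
      have "2 * (\<Sum>e\<in>E. rel_entropy p (w' e)) = (\<Sum>x<m. \<Sum>y\<in>{..<m} - {x}. rel_entropy p (w' {x, y}))"
        unfolding E_def by (rule sum_all_edges)
      also have "\<dots> \<le> (\<Sum>x<m. \<Sum>y<m. rel_entropy p (w' {x, y}))"
        using p w' by (intro sum_mono sum_mono2 rel_entropy_nonneg) auto
      also have "\<dots> = (\<Sum>x<q * n. \<Sum>y<q * n. rel_entropy p (w {x mod n, y mod n}))"
      proof -
        have row: "(\<Sum>y<m. rel_entropy p (w' {x, y})) = (\<Sum>y<q * n. rel_entropy p (w {x mod n, y mod n}))"
          if "x < q * n" for x
          by (rule sum.mono_neutral_cong_right) (use that qm p in \<open>auto simp: w'_def \<pi>_def\<close>)
        have zero: "(\<Sum>y<m. rel_entropy p (w' {x, y})) = 0" if "\<not> x < q * n" for x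
          using that p by (intro sum.neutral) (auto simp: w'_def)
        show ?thesis
        proof (rule sum.mono_neutral_cong_right)
          show "{..<q * n} \<subseteq> {..<m}" using qm by auto
          show "\<forall>x\<in>{..<m} - {..<q * n}. (\<Sum>y<m. rel_entropy p (w' {x, y})) = 0"
            by (intro ballI zero) simp
        qed (simp_all only: finite_lessThan lessThan_iff row)
      qed
      also have "\<dots> = (real q)\<^sup>2 * (\<Sum>x<n. \<Sum>y<n. rel_entropy p (w {x, y}))"
      proof -
        have "(\<Sum>x<q * n. \<Sum>y<q * n. rel_entropy p (w {x mod n, y mod n}))
            = (\<Sum>x<q * n. real q * (\<Sum>y<n. rel_entropy p (w {x mod n, y})))"
          by (intro sum.cong refl sum_mod_blocks)
        also have "\<dots> = real q * (\<Sum>x<n. real q * (\<Sum>y<n. rel_entropy p (w {x, y})))"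
          by (rule sum_mod_blocks)
        finally show ?thesis by (simp add: power2_eq_square sum_distrib_left mult.assoc)
      qed
      also have "\<dots> = (real (q * n))\<^sup>2 * J"
        using n by (simp add: J_def step_entropy_def power_mult_distrib)
      also have "\<dots> \<le> (real m)\<^sup>2 * J"
        using qm J0 by (intro mult_right_mono power_mono) (auto simp flip: of_nat_mult)
      finally show ?thesis by simp
    qed
    have "\<beta> * - ln (tail_prob p H \<tau> m) \<le> (\<Sum>e\<in>E. rel_entropy p (w' e)) + 1"
      unfolding \<beta>_def tp by (rule tilting_bound[OF fE p S(2) S(1) w'])
    also have "\<dots> \<le> (real m)\<^sup>2 / 2 * J + 1" using ent by simp
    also have "\<dots> = (real m)\<^sup>2 * (J / 2 + 1 / (real m)\<^sup>2)" using m by (simp add: field_simps)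
    also have "\<dots> \<le> (real m)\<^sup>2 * ((1 - c / real m) * ((1 - 1 / real m) / 2 * (J + \<eta>)))"
      using elim by (intro mult_left_mono) auto
    also have "\<dots> = (1 - c / real m) * (real (m choose 2) * (J + \<eta>))"
      using m by (simp add: real_choose_2 power2_eq_square field_simps)
    finally have "\<beta> * - ln (tail_prob p H \<tau> m) \<le> (1 - c / real m) * (real (m choose 2) * (J + \<eta>))" .
    moreover have "(1 - c / real m) * - ln (tail_prob p H \<tau> m) \<le> \<beta> * - ln (tail_prob p H \<tau> m)"
      using \<beta> pos le1 by (intro mult_right_mono) (auto simp: ln_le_zero_iff)
    ultimately have "(1 - c / real m) * - ln (tail_prob p H \<tau> m) \<le> (1 - c / real m) * (real (m choose 2) * (J + \<eta>))"
      by linarith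
    moreover have "0 < 1 - c / real m" using elim by simp
    ultimately have "- ln (tail_prob p H \<tau> m) \<le> real (m choose 2) * (J + \<eta>)"
      by (rule mult_left_le_imp_le)
    then show ?case using pos by (simp add: J_def)
  qed
qed

section \<open>The upper bound\<close>

definition cut_approx :: "real \<Rightarrow> nat \<Rightarrow> nat set set \<Rightarrow> (nat set \<Rightarrow> real) \<Rightarrow> bool" where
  "cut_approx \<epsilon> n X w \<longleftrightarrow> (\<forall>e. w e \<in> {0..1}) \<and> (\<forall>e. e \<notin> all_edges {..<n} \<longrightarrow> w e = 0) \<and>
     (\<forall>A\<subseteq>{..<n}. \<forall>B\<subseteq>{..<n}.
        \<bar>\<Sum>x\<in>A. \<Sum>y\<in>B. w {x, y} - of_bool ({x, y} \<in> X)\<bar> \<le> \<epsilon> * (real n)\<^sup>2)"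

text \<open>Pigeonhole: sort the members of \<open>S\<close> by their regularity list, keep the
  likeliest class, and let \<open>w\<close> be its conditional mean. The number \<open>k\<close> of
  rectangles depends only on \<open>\<epsilon>\<close>, so the logarithm of the number of lists is
  linear in \<open>n\<close>.\<close>

lemma upper_bound_by_mean:
  assumes p: "0 < p" "p < 1" and \<epsilon>: "\<epsilon> > 0"
  shows "\<exists>K\<ge>0. \<forall>n>0. \<forall>S\<subseteq>Pow (all_edges {..<n}). S \<noteq> {} \<longrightarrow>
    (\<exists>X\<in>S. \<exists>w. cut_approx \<epsilon> n X w \<and> ln (\<Sum>X\<in>S. bern (all_edges {..<n}) (\<lambda>_. p) X)
        \<le> K * real n + K - (\<Sum>e\<in>all_edges {..<n}. rel_entropy p (w e)))"
proof -
  \<comment> \<open>Enough steps for the energy of an indicator, which is at most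
    \<open>n\<^sup>2\<close>. Accuracy \<open>\<epsilon> / 2\<close> is taken because two members of
    a class are compared through their common list.\<close>
  define k where "k = nat \<lceil>1 / (\<epsilon> / 2)\<^sup>2\<rceil>"
  have k: "real k * (\<epsilon> / 2)\<^sup>2 \<ge> 1"
  proof -
    have "real k \<ge> 1 / (\<epsilon> / 2)\<^sup>2" unfolding k_def by linarith
    then show ?thesis using \<epsilon> by (simp add: field_simps)
  qed
  define K where "K = 2 * real k"
  show ?thesis
  proof (intro exI[of _ K] conjI allI impI)
    show "K \<ge> 0" by (simp add: K_def)
    fix n :: nat and S :: "nat set set set"
    assume n: "n > 0" and S: "S \<subseteq> Pow (all_edges {..<n})" "S \<noteq> {}"
    define E where "E = all_edges {..<n}"
    define P where "P = bern E (\<lambda>_. p)"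
    have fE: "finite E" unfolding E_def by (rule finite_all_edges)
    have fS: "finite S" using S fE finite_subset unfolding E_def by (metis finite_Pow_iff)
    have P: "P X > 0" for X unfolding P_def by (rule bern_pos[OF p])
    define L where "L = {l. set l \<subseteq> (UNIV :: bool set) \<times> Pow {..<n} \<times> Pow {..<n} \<and> length l = k}"
    have cardL: "card L = (2 * (2 ^ n * 2 ^ n)) ^ k"
      unfolding L_def by (subst card_lists_length_eq) (auto simp: card_cartesian_product card_Pow)
    define good where "good X l \<longleftrightarrow> l \<in> L \<and> (\<forall>A\<subseteq>{..<n}. \<forall>B\<subseteq>{..<n}.
        \<bar>\<Sum>x\<in>A. \<Sum>y\<in>B. of_bool ({x, y} \<in> X) - rect_sum (\<epsilon> / 2) l x y\<bar> \<le> \<epsilon> / 2 * (real n)\<^sup>2)" for X l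
    have "\<exists>l. good X l" for X
    proof -
      have "(\<Sum>x<n. \<Sum>y<n. (of_bool ({x, y} \<in> X) :: real)\<^sup>2) \<le> (\<Sum>x<n. \<Sum>y<n. 1)"
        by (intro sum_mono) auto
      also have "\<dots> = 1 * (real n)\<^sup>2" by (simp add: power2_eq_square)
      also have "\<dots> \<le> real k * (\<epsilon> / 2)\<^sup>2 * (real n)\<^sup>2" by (intro mult_right_mono k) auto
      finally show ?thesis
        using weak_regularity[of "\<epsilon> / 2" "\<lambda>x y. of_bool ({x, y} \<in> X)" n k] \<epsilon>
        unfolding good_def L_def mem_Collect_eq conj_assoc by simp
    qed
    then have "\<forall>X. \<exists>l. good X l" ..
    then obtain l where "\<forall>X. good X (l X)" by (rule choice[THEN exE])
    then have l: "l X \<in> L" and l2: "A\<subseteq>{..<n} \<Longrightarrow> B\<subseteq>{..<n} \<Longrightarrow>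
        \<bar>\<Sum>x\<in>A. \<Sum>y\<in>B. of_bool ({x, y} \<in> X) - rect_sum (\<epsilon> / 2) (l X) x y\<bar> \<le> \<epsilon> / 2 * (real n)\<^sup>2" for X A B
      by (simp_all only: good_def)
    define Q where "Q c = (\<Sum>X\<in>{X \<in> S. l X = c}. P X)" for c
    have fin: "finite (Q ` l ` S)" "Q ` l ` S \<noteq> {}" using fS S by auto
    obtain c where c: "c \<in> l ` S" "Max (Q ` l ` S) = Q c" using Max_in[OF fin] by (rule imageE)
    have cmax: "Q c' \<le> Q c" if "c' \<in> l ` S" for c' unfolding c(2)[symmetric] using fin that by (intro Max_ge) auto
    have finL: "finite L" unfolding L_def by (rule finite_lists_length_eq) auto
    have "(\<Sum>X\<in>S. P X) = (\<Sum>c'\<in>l ` S. Q c')"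
      unfolding Q_def by (rule sum.image_gen[OF fS])
    also have "\<dots> \<le> (\<Sum>c'\<in>l ` S. Q c)" by (intro sum_mono cmax)
    also have "\<dots> = real (card (l ` S)) * Q c" by simp
    also have "\<dots> \<le> real (card L) * Q c"
    proof (rule mult_right_mono)
      show "real (card (l ` S)) \<le> real (card L)"
        using l finL by (intro of_nat_mono card_mono) auto
      show "Q c \<ge> 0" unfolding Q_def using P by (intro sum_nonneg) (auto intro: less_imp_le)
    qed
    finally have PS: "(\<Sum>X\<in>S. P X) \<le> real (card L) * Q c" .
    define Sc where "Sc = {X \<in> S. l X = c}"
    obtain X where X: "X \<in> Sc" using c by (auto simp: Sc_def)
    have Sc: "Sc \<subseteq> Pow E" "Sc \<noteq> {}" "finite Sc" using S X fS by (auto simp: Sc_def E_def)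
    define w where "w e = (\<Sum>X\<in>Sc. of_bool (e \<in> X) * P X) / Q c" for e
    have Qc: "Q c = (\<Sum>X\<in>Sc. P X)" by (simp add: Q_def Sc_def)
    note ceb = conditional_entropy_bound[OF fE p Sc(1,2) Qc[unfolded P_def] w_def[unfolded P_def]]
    have Q0: "Q c > 0" by (rule ceb(2))
    have "ln (\<Sum>X\<in>S. P X) \<le> ln (real (card L) * Q c)"
      using PS P S fS by (intro ln_mono sum_pos) auto
    also have "\<dots> = ln (real (card L)) + ln (Q c)"
      using Q0 by (subst ln_mult) (auto simp: cardL)
    also have "ln (real (card L)) \<le> K * real n + K"
    proof -
      have "(2::nat) * (2 ^ n * 2 ^ n) = 2 ^ (2 * n + 1)" by (simp add: mult_2 power_add)
      then have "card L = 2 ^ ((2 * n + 1) * k)" by (simp only: cardL power_mult)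
      then have "real (card L) = 2 ^ (k * (2 * n + 1))" by (simp only: mult.commute of_nat_power of_nat_numeral)
      then have "ln (real (card L)) = real (k * (2 * n + 1)) * ln 2" by (simp add: ln_realpow)
      also have "\<dots> \<le> real (k * (2 * n + 1)) * 1" using ln_2_less_1 by (intro mult_left_mono) auto
      also have "\<dots> \<le> K * real n + K" by (simp add: K_def algebra_simps)
      finally show ?thesis .
    qed
    finally have ent: "ln (\<Sum>X\<in>S. P X) \<le> K * real n + K - (\<Sum>e\<in>E. rel_entropy p (w e))"
      using ceb(1) by simp
    have cut: "\<bar>\<Sum>x\<in>A. \<Sum>y\<in>B. w {x, y} - of_bool ({x, y} \<in> X)\<bar> \<le> \<epsilon> * (real n)\<^sup>2"
      if AB: "A \<subseteq> {..<n}" "B \<subseteq> {..<n}" for A B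
    proof -
      define \<Delta> where "\<Delta> Y = (\<Sum>x\<in>A. \<Sum>y\<in>B. of_bool ({x, y} \<in> Y) - of_bool ({x, y} \<in> X) :: real)" for Y
      have \<Delta>: "\<bar>\<Delta> Y\<bar> \<le> \<epsilon> * (real n)\<^sup>2" if "Y \<in> Sc" for Y
      proof -
        have "l Y = l X" using that X by (simp add: Sc_def)
        then have "\<Delta> Y = (\<Sum>x\<in>A. \<Sum>y\<in>B. of_bool ({x, y} \<in> Y) - rect_sum (\<epsilon> / 2) (l Y) x y)
          - (\<Sum>x\<in>A. \<Sum>y\<in>B. of_bool ({x, y} \<in> X) - rect_sum (\<epsilon> / 2) (l X) x y)"
          by (simp add: \<Delta>_def flip: sum_subtractf)
        then show ?thesis using l2[OF AB, of Y] l2[OF AB, of X] by linarith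
      qed
      \<comment> \<open>The deviation of the mean from \<open>X\<close> is the average over the
        class of the deviations of its members, each of cut norm at most
        \<open>\<epsilon>\<close>.\<close>
      have "w e - of_bool (e \<in> X) = (\<Sum>Y\<in>Sc. (of_bool (e \<in> Y) - of_bool (e \<in> X)) * P Y) / Q c" for e
      proof -
        have "of_bool (e \<in> X) = (\<Sum>Y\<in>Sc. of_bool (e \<in> X) * P Y) / Q c"
          using Q0 Qc by (simp flip: sum_distrib_left)
        then show ?thesis by (simp add: w_def left_diff_distrib sum_subtractf diff_divide_distrib)
      qed
      then have "(\<Sum>x\<in>A. \<Sum>y\<in>B. w {x, y} - of_bool ({x, y} \<in> X))
          = (\<Sum>x\<in>A. \<Sum>y\<in>B. \<Sum>Y\<in>Sc. (of_bool ({x, y} \<in> Y) - of_bool ({x, y} \<in> X)) * P Y) / Q c"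
        by (simp add: sum_divide_distrib)
      also have "(\<Sum>x\<in>A. \<Sum>y\<in>B. \<Sum>Y\<in>Sc. (of_bool ({x, y} \<in> Y) - of_bool ({x, y} \<in> X)) * P Y)
          = (\<Sum>Y\<in>Sc. \<Delta> Y * P Y)"
        unfolding \<Delta>_def sum_distrib_right by (simp only: sum.swap[of _ Sc B] sum.swap[of _ Sc A])
      also have "\<bar>(\<Sum>Y\<in>Sc. \<Delta> Y * P Y) / Q c\<bar> \<le> (\<Sum>Y\<in>Sc. \<epsilon> * (real n)\<^sup>2 * P Y) / Q c"
      proof -
        have "\<bar>\<Sum>Y\<in>Sc. \<Delta> Y * P Y\<bar> \<le> (\<Sum>Y\<in>Sc. \<bar>\<Delta> Y * P Y\<bar>)" by (rule sum_abs)
        also have "\<dots> \<le> (\<Sum>Y\<in>Sc. \<epsilon> * (real n)\<^sup>2 * P Y)"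
        proof (rule sum_mono)
          fix Y assume "Y \<in> Sc"
          then show "\<bar>\<Delta> Y * P Y\<bar> \<le> \<epsilon> * (real n)\<^sup>2 * P Y"
            using \<Delta>[of Y] P[of Y] by (simp add: abs_mult)
        qed
        finally show ?thesis using Q0 by (simp add: divide_right_mono)
      qed
      also have "\<dots> = \<epsilon> * (real n)\<^sup>2" using Q0 Qc by (simp flip: sum_distrib_left)
      finally show ?thesis .
    qed
    have w0: "w e = 0" if "e \<notin> E" for e
      unfolding w_def using that Sc(1) by (simp, intro disjI1 sum.neutral) auto
    have "cut_approx \<epsilon> n X w"
      unfolding cut_approx_def using ceb(3) w0 cut by (auto simp: E_def)
    moreover have "X \<in> S" using X by (simp add: Sc_def)
    ultimately show "\<exists>X\<in>S. \<exists>w. cut_approx \<epsilon> n X w \<and> ln (\<Sum>X\<in>S. bern (all_edges {..<n}) (\<lambda>_. p) X)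
        \<le> K * real n + K - (\<Sum>e\<in>all_edges {..<n}. rel_entropy p (w e))"
      using ent by (auto simp: E_def P_def)
  qed
qed

section \<open>Events of the random graph\<close>

lemma prob_density_event:
  assumes p: "0 < p" "p < 1" and H: "finite_simple_graph H"
  shows "measure (measure_pmf (random_graph n p)) {G. hom_density H G \<ge> \<tau>} = tail_prob p H \<tau> n"
  unfolding prob_random_graph[OF p, where Q = "\<lambda>G. hom_density H G \<ge> \<tau>"] hom_density_eq[OF H] tail_prob_def ..

lemma edges_between_eq:
  assumes "finite A" "finite B"
  shows "real (edges_between (V, X) A B) = (\<Sum>a\<in>A. \<Sum>b\<in>B. of_bool ({a, b} \<in> X))"
proof -
  have "{(a, b). a \<in> A \<and> b \<in> B \<and> {a, b} \<in> X} = (A \<times> B) \<inter> {(a, b). {a, b} \<in> X}" by auto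
  then have "real (edges_between (V, X) A B) = (\<Sum>z\<in>A \<times> B. of_bool (z \<in> {(a, b). {a, b} \<in> X}))"
    using assms by (simp add: edges_between_def of_bool_def sum.If_cases)
  also have "\<dots> = (\<Sum>a\<in>A. \<Sum>b\<in>B. of_bool ({a, b} \<in> X))"
    unfolding sum.cartesian_product by (intro sum.cong) auto
  finally show ?thesis .
qed

lemma edges_between_diff_eq:
  assumes "finite A" "finite B"
  shows "real (edges_between (V, X) A B) - s * real (card A) * real (card B)
    = (\<Sum>a\<in>A. \<Sum>b\<in>B. of_bool ({a, b} \<in> X) - s)"
  unfolding edges_between_eq[OF assms] by (simp add: sum_subtractf)

lemma cut_dist_const_ge:
  assumes n: "n > 0" and AB: "A \<subseteq> {..<n}" "B \<subseteq> {..<n}"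
  shows "\<bar>\<Sum>a\<in>A. \<Sum>b\<in>B. of_bool ({a, b} \<in> X) - s\<bar> \<le> cut_dist_const ({..<n}, X) s * (real n)\<^sup>2"
proof -
  let ?f = "\<lambda>(A, B). 1 / (real n)\<^sup>2 * \<bar>real (edges_between ({..<n}, X) A B) - s * real (card A) * real (card B)\<bar>"
  have "?f (A, B) \<le> cut_dist_const ({..<n}, X) s"
    unfolding cut_dist_const_def fst_conv card_lessThan
    by (rule cSUP_upper) (use AB in \<open>auto intro!: bdd_above_finite\<close>)
  moreover have "finite A" "finite B" using AB finite_subset by auto
  ultimately have "\<bar>\<Sum>a\<in>A. \<Sum>b\<in>B. of_bool ({a, b} \<in> X) - s\<bar> / (real n)\<^sup>2 \<le> cut_dist_const ({..<n}, X) s"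
    by (simp add: edges_between_diff_eq)
  then show ?thesis using n by (simp add: field_simps)
qed

lemma cut_dist_const_nonneg: "(n::nat) > 0 \<Longrightarrow> cut_dist_const ({..<n}, X) s \<ge> 0"
  using cut_dist_const_ge[of n "{}" "{}" X s] by (simp add: zero_le_mult_iff)

text \<open>The supremum ranges over finitely many pairs and is a maximum, so strictness
  survives.\<close>

lemma cut_dist_const_less:
  assumes n: "n > 0"
    and AB: "\<And>A B. A \<subseteq> {..<n} \<Longrightarrow> B \<subseteq> {..<n} \<Longrightarrow> \<bar>\<Sum>a\<in>A. \<Sum>b\<in>B. of_bool ({a, b} \<in> X) - s\<bar> < \<epsilon> * (real n)\<^sup>2"
  shows "cut_dist_const ({..<n}, X) s < \<epsilon>"
proof -
  let ?f = "\<lambda>(A, B). 1 / (real n)\<^sup>2 * \<bar>real (edges_between ({..<n}, X) A B) - s * real (card A) * real (card B)\<bar>"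
  let ?D = "Pow {..<n} \<times> Pow {..<n}"
  have fin: "finite (?f ` ?D)" "?f ` ?D \<noteq> {}" by auto
  have "cut_dist_const ({..<n}, X) s = Max (?f ` ?D)"
    unfolding cut_dist_const_def fst_conv snd_conv card_lessThan using fin by (rule cSup_eq_Max)
  also have "\<dots> < \<epsilon>"
    unfolding Max_less_iff[OF fin]
  proof (rule ballI)
    fix y assume "y \<in> ?f ` ?D"
    then obtain A B where y: "y = ?f (A, B)" and sub: "A \<subseteq> {..<n}" "B \<subseteq> {..<n}" by auto
    have "finite A" "finite B" using sub finite_subset by auto
    then have "y = \<bar>\<Sum>a\<in>A. \<Sum>b\<in>B. of_bool ({a, b} \<in> X) - s\<bar> / (real n)\<^sup>2"
      unfolding y by (simp add: edges_between_diff_eq)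
    then show "y < \<epsilon>" using AB[OF sub] n by (simp add: pos_divide_less_eq)
  qed
  finally show ?thesis .
qed

lemma cond_prob_pmf_ge:
  assumes pos: "measure (measure_pmf M) {G. B G} > 0"
    and le: "measure (measure_pmf M) {G. \<not> A G \<and> B G} \<le> \<delta> * measure (measure_pmf M) {G. B G}"
  shows "\<P>(G in measure_pmf M. A G \<bar> B G) \<ge> 1 - \<delta>"
proof -
  have "{G. B G} = {G. A G \<and> B G} \<union> {G. \<not> A G \<and> B G}" by auto
  then have "measure (measure_pmf M) {G. B G}
      = measure (measure_pmf M) {G. A G \<and> B G} + measure (measure_pmf M) {G. \<not> A G \<and> B G}"
    by (simp add: measure_pmf.finite_measure_Union disjoint_iff)
  then have "measure (measure_pmf M) {G. A G \<and> B G} \<ge> (1 - \<delta>) * measure (measure_pmf M) {G. B G}"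
    using le by (simp add: algebra_simps)
  then show ?thesis using pos by (simp add: cond_prob_def pos_le_divide_eq)
qed

lemma choose_2_ge: "n \<ge> 2 \<Longrightarrow> real (n choose 2) \<ge> (real n)\<^sup>2 / 4"
proof -
  assume n: "n \<ge> 2"
  then have "real n * (real n - 1) \<ge> real n * (real n / 2)" by (intro mult_left_mono) auto
  then show ?thesis by (simp add: real_choose_2 power2_eq_square)
qed

lemma choose_2_le: "2 * real (n choose 2) \<le> (real n)\<^sup>2"
  by (simp add: real_choose_2 power2_eq_square algebra_simps)

lemma linear_le_choose_2:
  fixes K \<eta> :: real
  assumes "\<eta> > 0" "K \<ge> 0"
  shows "\<forall>\<^sub>F n in sequentially. K * real n + K \<le> \<eta> * real (n choose 2)"
  using eventually_ge_at_top[of 2] eventually_ge_at_top[of "nat \<lceil>8 * K / \<eta>\<rceil>"]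
proof eventually_elim
  case (elim n)
  have "8 * K / \<eta> \<le> real n" using elim by linarith
  then have "8 * K \<le> \<eta> * real n" using assms by (simp add: field_simps)
  then have "8 * K * real n \<le> \<eta> * real n * real n" by (intro mult_right_mono) auto
  moreover have "K * 1 \<le> K * real n" using elim assms by (intro mult_left_mono) auto
  moreover have "\<eta> * ((real n)\<^sup>2 / 4) \<le> \<eta> * real (n choose 2)"
    using choose_2_ge[of n] elim assms by (intro mult_left_mono) auto
  ultimately show ?case by (simp add: power2_eq_square)
qed

lemma double_sum_off_diagonal:
  fixes f :: "nat set \<Rightarrow> real"
  assumes "\<And>x. f {x} = 0"
  shows "(\<Sum>x<n. \<Sum>y<n. f {x, y}) = 2 * (\<Sum>e\<in>all_edges {..<n}. f e)"
proof -
  have "(\<Sum>y<n. f {x, y}) = (\<Sum>y\<in>{..<n} - {x}. f {x, y})" if "x \<in> {..<n}" for x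
    using that assms by (subst sum.remove[of _ x]) auto
  then show ?thesis unfolding sum_all_edges by (rule sum.cong[OF refl])
qed

text \<open>Finner's inequality inverted: \<open>\<epsilon>\<close> is so small that
  \<open>(r ^ m - \<epsilon>) ^ d\<close> still exceeds \<open>(r ^ d - c) ^ m\<close>. The diagonal
  adds nothing since \<open>w\<close> vanishes on singletons, and passing from
  \<open>n\<^sup>2\<close> to \<open>2 * (n choose 2)\<close> goes in the favourable
  direction.\<close>

lemma density_large_imp_power_sum_large:
  assumes H: "finite_simple_graph H" and reg: "regular d H" and d: "d > 0"
    and e: "card (edges H) > 0" and r: "0 < r" and c: "c > 0"
  shows "\<exists>\<epsilon>>0. \<forall>n>0. \<forall>w. (\<forall>e. w e \<in> {0..1}) \<longrightarrow> (\<forall>e. e \<notin> all_edges {..<n} \<longrightarrow> w e = 0) \<longrightarrow>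
    weighted_density H n w \<ge> r ^ card (edges H) - \<epsilon> \<longrightarrow>
    (\<Sum>e\<in>all_edges {..<n}. w e ^ d) \<ge> (r ^ d - c) * real (n choose 2)"
proof (cases "r ^ d - c \<le> 0")
  case True
  then have "(r ^ d - c) * real (n choose 2) \<le> 0" for n by (simp add: mult_nonpos_nonneg)
  moreover have "(\<Sum>e\<in>all_edges {..<n}. w e ^ d) \<ge> 0" if "\<forall>e. w e \<in> {0..1}" for w :: "nat set \<Rightarrow> real" and n
    using that by (intro sum_nonneg) auto
  ultimately show ?thesis by (intro exI[of _ 1]) (auto intro: order.trans)
next
  case False
  define m where "m = card (edges H)"
  define q where "q = r ^ d - c"
  have q: "0 < q" "q < r ^ d" using False c by (auto simp: q_def)
  have "q ^ m < (r ^ d) ^ m" using q e by (intro power_strict_mono) (auto simp: m_def)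
  also have "\<dots> = (r ^ m - 0) ^ d" by (simp add: mult.commute flip: power_mult)
  finally have lt: "q ^ m < (r ^ m - 0) ^ d" .
  have "((\<lambda>\<epsilon>. (r ^ m - \<epsilon>) ^ d) \<longlongrightarrow> (r ^ m - 0) ^ d) (at_right 0)" by (intro tendsto_intros)
  then have "\<forall>\<^sub>F \<epsilon> in at_right 0. q ^ m < (r ^ m - \<epsilon>) ^ d" using lt by (rule order_tendstoD)
  moreover have "\<forall>\<^sub>F \<epsilon> in at_right 0. \<epsilon> \<in> {0<..<r ^ m}"
    using r by (intro eventually_at_right_real) auto
  ultimately have "\<forall>\<^sub>F \<epsilon> in at_right 0. q ^ m < (r ^ m - \<epsilon>) ^ d \<and> \<epsilon> \<in> {0<..<r ^ m}" by (rule eventually_conj)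
  then obtain \<epsilon> where \<epsilon>: "q ^ m < (r ^ m - \<epsilon>) ^ d" "0 < \<epsilon>" "\<epsilon> < r ^ m"
    using eventually_happens[of _ "at_right (0::real)"] by (auto simp: trivial_limit_at_right_real)
  show ?thesis
  proof (intro exI[of _ \<epsilon>] conjI allI impI \<epsilon>(2))
    fix n :: nat and w :: "nat set \<Rightarrow> real"
    assume n: "n > 0" and w: "\<forall>e. w e \<in> {0..1}" and w0: "\<forall>e. e \<notin> all_edges {..<n} \<longrightarrow> w e = 0"
      and t: "weighted_density H n w \<ge> r ^ card (edges H) - \<epsilon>"
    define A where "A = (\<Sum>x<n. \<Sum>y<n. w {x, y} ^ d) / (real n)\<^sup>2"
    have A0: "A \<ge> 0" unfolding A_def using w by (intro divide_nonneg_nonneg sum_nonneg) auto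
    have "q ^ m < (r ^ m - \<epsilon>) ^ d" by (rule \<epsilon>)
    also have "\<dots> \<le> weighted_density H n w ^ d" using t \<epsilon> by (intro power_mono) (auto simp: m_def)
    also have "\<dots> \<le> A ^ m"
      unfolding A_def m_def using w by (intro weighted_density_le H reg d n) auto
    finally have "q < A" by (rule power_less_imp_less_base[OF _ A0])
    moreover have "(\<Sum>x<n. \<Sum>y<n. w {x, y} ^ d) = 2 * (\<Sum>e\<in>all_edges {..<n}. w e ^ d)"
      by (rule double_sum_off_diagonal[where f = "\<lambda>e. w e ^ d"]) (use w0 d in \<open>auto simp: all_edges_def\<close>)
    ultimately have "q * (real n)\<^sup>2 < 2 * (\<Sum>e\<in>all_edges {..<n}. w e ^ d)"
      using n by (simp add: A_def field_simps)
    moreover have "q * (2 * real (n choose 2)) \<le> q * (real n)\<^sup>2"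
      using q choose_2_le[of n] by (intro mult_left_mono) auto
    ultimately show "(\<Sum>e\<in>all_edges {..<n}. w e ^ d) \<ge> (r ^ d - c) * real (n choose 2)"
      by (simp add: q_def)
  qed
qed

text \<open>The template is one vertex whose diagonal weight \<open>x\<close> lies slightly above
  \<open>r\<close>: \<open>tail_prob_lower\<close> demands a strict excess of density, and
  continuity of the entropy makes it cheap.\<close>

lemma tail_prob_constant_lower:
  assumes p: "0 < p" "p \<le> r" "r < 1" and H: "finite_simple_graph H"
    and e: "card (edges H) > 0" and \<eta>: "\<eta> > 0"
  shows "\<forall>\<^sub>F m in sequentially. tail_prob p H (r ^ card (edges H)) m > 0 \<and>
    - ln (tail_prob p H (r ^ card (edges H)) m) \<le> real (m choose 2) * (rel_entropy p r + \<eta>)"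
proof -
  have p1: "p < 1" and r0: "0 < r" using p by auto
  have "isCont (rel_entropy p) r"
    using DERIV_rel_entropy[OF p(1) p1 r0 p(3)] by (rule DERIV_isCont)
  then have "((\<lambda>x. rel_entropy p x) \<longlongrightarrow> rel_entropy p r) (at_right r)"
    by (auto simp: isCont_def intro: filterlim_mono at_le)
  then have "\<forall>\<^sub>F x in at_right r. rel_entropy p x < rel_entropy p r + \<eta> / 2"
    by (rule order_tendstoD) (use \<eta> in simp)
  moreover have "\<forall>\<^sub>F x in at_right r. x \<in> {r<..<1}" using p by (intro eventually_at_right_real)
  ultimately have "\<forall>\<^sub>F x in at_right r. rel_entropy p x < rel_entropy p r + \<eta> / 2 \<and> x \<in> {r<..<1}"
    by (rule eventually_conj)
  then obtain x where x: "rel_entropy p x < rel_entropy p r + \<eta> / 2" "r < x" "x < 1"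
    using eventually_happens[of _ "at_right r"] by (auto simp: trivial_limit_at_right_real)
  have "r ^ card (edges H) < x ^ card (edges H)" using x r0 e by (intro power_strict_mono) auto
  also have "\<dots> = weighted_density H 1 (\<lambda>_. x)"
    using H by (simp add: weighted_density_const finite_simple_graph_def)
  finally have "\<forall>\<^sub>F m in sequentially. tail_prob p H (r ^ card (edges H)) m > 0 \<and>
    - ln (tail_prob p H (r ^ card (edges H)) m) \<le> real (m choose 2) * (step_entropy p 1 (\<lambda>_. x) + \<eta> / 2)"
    using x r0 \<eta> by (intro tail_prob_lower[OF p(1) p1 H]) auto
  then show ?thesis
  proof eventually_elim
    case (elim m)
    have "real (m choose 2) * (step_entropy p 1 (\<lambda>_. x) + \<eta> / 2) \<le> real (m choose 2) * (rel_entropy p r + \<eta>)"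
      using x by (intro mult_left_mono) (auto simp: step_entropy_def)
    then show ?case using elim by linarith
  qed
qed

section \<open>Replica symmetry\<close>

lemma counting_lower:
  assumes H: "finite_simple_graph H" and n: "n > 0"
    and w: "cut_approx (\<epsilon> / (real (card (edges H)) + 1)) n X w"
    and \<tau>: "\<tau> \<le> weighted_density H n (\<lambda>e. of_bool (e \<in> X))" and \<epsilon>: "\<epsilon> > 0"
  shows "weighted_density H n w \<ge> \<tau> - \<epsilon>"
proof -
  have "\<bar>weighted_density H n w - weighted_density H n (\<lambda>e. of_bool (e \<in> X))\<bar>
      \<le> real (card (edges H)) * (\<epsilon> / (real (card (edges H)) + 1))"
    using w unfolding cut_approx_def by (intro counting_lemma[OF H n]) simp_all
  also have "\<dots> \<le> \<epsilon>" using \<epsilon> by (simp add: field_simps)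
  finally show ?thesis using \<tau> by linarith
qed

text \<open>The supporting line is summed over the edges; \<open>c\<close> is chosen so that the
  slope turns the defect in the power sum into at most \<open>\<eta> / 2\<close>. Positivity is a
  premise because \<open>ln 0\<close> is 0, which would violate the bound.\<close>

lemma tail_prob_symmetric_upper:
  assumes p: "0 < p" "p \<le> r" "r < 1" and H: "finite_simple_graph H" and reg: "regular d H" and d: "d > 0"
    and e: "card (edges H) > 0" and \<eta>: "\<eta> > 0" and s: "s \<ge> 0"
    and supp: "\<And>y. y \<in> {0..1} \<Longrightarrow> rel_entropy p r + s * (y ^ d - r ^ d) \<le> rel_entropy p y"
  shows "\<forall>\<^sub>F n in sequentially. tail_prob p H (r ^ card (edges H)) n > 0 \<longrightarrow>
     ln (tail_prob p H (r ^ card (edges H)) n) \<le> - real (n choose 2) * (rel_entropy p r - \<eta>)"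
proof -
  have p1: "p < 1" and r0: "0 < r" using p by auto
  define c where "c = \<eta> / (2 * (s + 1))"
  have c: "c > 0" "s * c \<le> \<eta> / 2" using \<eta> s by (auto simp: c_def field_simps)
  obtain \<epsilon> where \<epsilon>: "\<epsilon> > 0" and power_sum: "\<And>n w. n > 0 \<Longrightarrow> (\<forall>e. w e \<in> {0..1}) \<Longrightarrow>
      (\<forall>e. e \<notin> all_edges {..<n} \<longrightarrow> w e = 0) \<Longrightarrow> weighted_density H n w \<ge> r ^ card (edges H) - \<epsilon> \<Longrightarrow>
      (\<Sum>e\<in>all_edges {..<n}. w e ^ d) \<ge> (r ^ d - c) * real (n choose 2)"
    using density_large_imp_power_sum_large[OF H reg d e r0 c(1)] by blast
  have "\<epsilon> / (real (card (edges H)) + 1) > 0" using \<epsilon> by simp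
  from upper_bound_by_mean[OF p(1) p1 this] obtain K where K: "K \<ge> 0"
    and ub0: "\<forall>n>0. \<forall>S\<subseteq>Pow (all_edges {..<n}). S \<noteq> {} \<longrightarrow>
    (\<exists>X\<in>S. \<exists>w. cut_approx (\<epsilon> / (real (card (edges H)) + 1)) n X w \<and> ln (\<Sum>X\<in>S. bern (all_edges {..<n}) (\<lambda>_. p) X)
        \<le> K * real n + K - (\<Sum>e\<in>all_edges {..<n}. rel_entropy p (w e)))"
    by (elim exE conjE)
  note ub = ub0[rule_format]
  have "\<eta> / 2 > 0" using \<eta> by simp
  from linear_le_choose_2[OF this K] eventually_gt_at_top[of 0] show ?thesis
  proof eventually_elim
    case (elim n)
    show ?case
    proof
    assume pos: "tail_prob p H (r ^ card (edges H)) n > 0"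
    define S where "S = {X \<in> Pow (all_edges {..<n}). r ^ card (edges H) \<le> weighted_density H n (\<lambda>e. of_bool (e \<in> X))}"
    have "S \<noteq> {}" using pos unfolding tail_prob_def S_def[symmetric] by (intro notI) simp
    have Ssub: "S \<subseteq> Pow (all_edges {..<n})" by (auto simp: S_def)
    obtain w X where X: "X \<in> S" and ca: "cut_approx (\<epsilon> / (real (card (edges H)) + 1)) n X w"
      and ln: "ln (\<Sum>X\<in>S. bern (all_edges {..<n}) (\<lambda>_. p) X)
        \<le> K * real n + K - (\<Sum>e\<in>all_edges {..<n}. rel_entropy p (w e))"
      using ub[OF elim(2) Ssub \<open>S \<noteq> {}\<close>] by (elim bexE exE conjE)
    have w: "w e \<in> {0..1}" "e \<notin> all_edges {..<n} \<Longrightarrow> w e = 0" for e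
      using ca by (auto simp: cut_approx_def)
    have "weighted_density H n w \<ge> r ^ card (edges H) - \<epsilon>"
      using X by (intro counting_lower[OF H elim(2) ca _ \<epsilon>]) (auto simp: S_def)
    then have ps: "(\<Sum>e\<in>all_edges {..<n}. w e ^ d) \<ge> (r ^ d - c) * real (n choose 2)"
      using w by (intro power_sum elim(2)) auto
    have "(\<Sum>e\<in>all_edges {..<n}. rel_entropy p (w e))
        \<ge> (\<Sum>e\<in>all_edges {..<n}. rel_entropy p r + s * (w e ^ d - r ^ d))"
      by (intro sum_mono supp w)
    moreover have "(\<Sum>e\<in>all_edges {..<n}. rel_entropy p r + s * (w e ^ d - r ^ d))
        = real (n choose 2) * rel_entropy p r + s * ((\<Sum>e\<in>all_edges {..<n}. w e ^ d) - r ^ d * real (n choose 2))"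
      by (simp add: sum.distrib sum_subtractf card_all_edges flip: sum_distrib_left)
    moreover have "s * ((\<Sum>e\<in>all_edges {..<n}. w e ^ d) - r ^ d * real (n choose 2)) \<ge> s * (- c * real (n choose 2))"
      using ps s by (intro mult_left_mono) (auto simp: algebra_simps)
    moreover have "s * c * real (n choose 2) \<le> \<eta> / 2 * real (n choose 2)"
      using c by (intro mult_right_mono) auto
    ultimately have "(\<Sum>e\<in>all_edges {..<n}. rel_entropy p (w e)) \<ge> real (n choose 2) * rel_entropy p r - \<eta> / 2 * real (n choose 2)"
      by (simp add: mult.assoc)
    then show "ln (tail_prob p H (r ^ card (edges H)) n) \<le> - real (n choose 2) * (rel_entropy p r - \<eta>)"
      using ln elim(1) unfolding tail_prob_def S_def by (simp add: algebra_simps)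
    qed
  qed
qed

text \<open>The mean \<open>w\<close> of a far class must cost more than
  \<open>rel_entropy p r + c\<close> per edge: otherwise stability puts \<open>w\<close> close to
  \<open>r\<close> in the 1-norm, and then the class member \<open>X\<close>, which is cut-close to
  \<open>w\<close>, would not be far. Half of \<open>c\<close> absorbs the error linear in
  \<open>n\<close>.\<close>

lemma cut_far_upper:
  assumes p: "0 < p" "p \<le> r" "r < 1" and H: "finite_simple_graph H" and reg: "regular d H" and d: "d \<ge> 2"
    and e: "card (edges H) > 0" and \<epsilon>: "\<epsilon> > 0"
    and supp: "\<And>y. y \<in> {0..1} \<Longrightarrow> rel_entropy p r + s * (y ^ d - r ^ d) \<le> rel_entropy p y"
  shows "\<exists>a>0. \<forall>\<^sub>F n in sequentially.
     (\<Sum>X\<in>{X \<in> Pow (all_edges {..<n}). \<not> cut_dist_const ({..<n}, X) r < \<epsilon> \<and>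
          r ^ card (edges H) \<le> weighted_density H n (\<lambda>e. of_bool (e \<in> X))}. bern (all_edges {..<n}) (\<lambda>_. p) X)
      \<le> exp (- real (n choose 2) * (rel_entropy p r + a))"
proof -
  have p1: "p < 1" and r0: "0 < r" using p by auto
  have "\<epsilon> / 8 > 0" using \<epsilon> by simp
  from entropy_stability[OF p d this supp, where 'b = "nat set"] obtain c where c: "c > 0"
    and stab: "\<And>(E :: nat set set) w. finite E \<Longrightarrow> (\<forall>e\<in>E. w e \<in> {0..1}) \<Longrightarrow>
       (\<Sum>e\<in>E. w e ^ d) \<ge> (r ^ d - c) * real (card E) \<Longrightarrow>
       (\<Sum>e\<in>E. rel_entropy p (w e)) \<le> (rel_entropy p r + c) * real (card E) \<Longrightarrow>
       (\<Sum>e\<in>E. \<bar>w e - r\<bar>) \<le> \<epsilon> / 8 * real (card E)"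
    by blast
  have "d > 0" using d by simp
  obtain \<epsilon>0 where \<epsilon>0: "\<epsilon>0 > 0" and power_sum0: "\<And>n w. n > 0 \<Longrightarrow> (\<forall>e. w e \<in> {0..1}) \<Longrightarrow>
      (\<forall>e. e \<notin> all_edges {..<n} \<longrightarrow> w e = 0) \<Longrightarrow> weighted_density H n w \<ge> r ^ card (edges H) - \<epsilon>0 \<Longrightarrow>
      (\<Sum>e\<in>all_edges {..<n}. w e ^ d) \<ge> (r ^ d - c) * real (n choose 2)"
    using density_large_imp_power_sum_large[OF H reg \<open>d > 0\<close> e r0 c(1)] by blast
  \<comment> \<open>The final distance is at most \<open>\<epsilon> / 8\<close> from stability,
    \<open>\<epsilon> / 4\<close> from the diagonal and \<open>\<epsilon> / 4\<close> from the cut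
    approximation.\<close>
  define \<epsilon>1 where "\<epsilon>1 = min \<epsilon>0 (\<epsilon> / 4)"
  define \<epsilon>2 where "\<epsilon>2 = \<epsilon>1 / (real (card (edges H)) + 1)"
  have \<epsilon>1: "\<epsilon>1 > 0" using \<epsilon> \<epsilon>0 by (simp add: \<epsilon>1_def)
  have \<epsilon>2: "\<epsilon>2 > 0" "\<epsilon>2 \<le> \<epsilon> / 4"
  proof -
    show "\<epsilon>2 > 0" using \<epsilon>1 by (simp add: \<epsilon>2_def)
    have "\<epsilon>2 \<le> \<epsilon>1 / 1" unfolding \<epsilon>2_def using \<epsilon>1 by (intro divide_left_mono) auto
    then show "\<epsilon>2 \<le> \<epsilon> / 4" by (simp add: \<epsilon>1_def)
  qed
  from upper_bound_by_mean[OF p(1) p1 \<epsilon>2(1)] obtain K where K: "K \<ge> 0"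
    and ub0: "\<forall>n>0. \<forall>S\<subseteq>Pow (all_edges {..<n}). S \<noteq> {} \<longrightarrow>
    (\<exists>X\<in>S. \<exists>w. cut_approx (\<epsilon>2) n X w \<and> ln (\<Sum>X\<in>S. bern (all_edges {..<n}) (\<lambda>_. p) X)
        \<le> K * real n + K - (\<Sum>e\<in>all_edges {..<n}. rel_entropy p (w e)))"
    by (elim exE conjE)
  note ub = ub0[rule_format]
  have "c / 2 > 0" using c by simp
  have ev: "\<forall>\<^sub>F n in sequentially. real n > 4 / \<epsilon>"
    by (rule eventually_sequentiallyI[of "nat \<lceil>4 / \<epsilon>\<rceil> + 1"]) linarith
  show ?thesis
  proof (intro exI[of _ "c / 2"] conjI \<open>c / 2 > 0\<close>)
    from linear_le_choose_2[OF \<open>c / 2 > 0\<close> K] eventually_gt_at_top[of 0] ev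
    show "\<forall>\<^sub>F n in sequentially.
     (\<Sum>X\<in>{X \<in> Pow (all_edges {..<n}). \<not> cut_dist_const ({..<n}, X) r < \<epsilon> \<and>
          r ^ card (edges H) \<le> weighted_density H n (\<lambda>e. of_bool (e \<in> X))}. bern (all_edges {..<n}) (\<lambda>_. p) X)
      \<le> exp (- real (n choose 2) * (rel_entropy p r + c / 2))"
    proof eventually_elim
      case (elim n)
      define E where "E = all_edges {..<n}"
      define S where "S = {X \<in> Pow E. \<not> cut_dist_const ({..<n}, X) r < \<epsilon> \<and>
          r ^ card (edges H) \<le> weighted_density H n (\<lambda>e. of_bool (e \<in> X))}"
      have fE: "finite E" unfolding E_def by (rule finite_all_edges)
      have "(\<Sum>X\<in>S. bern E (\<lambda>_. p) X) \<le> exp (- real (n choose 2) * (rel_entropy p r + c / 2))"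
      proof (cases "S = {}")
        case False
        have Ssub: "S \<subseteq> Pow E" by (auto simp: S_def)
        obtain w X where X: "X \<in> S" and ca: "cut_approx \<epsilon>2 n X w"
          and ln: "ln (\<Sum>X\<in>S. bern E (\<lambda>_. p) X)
            \<le> K * real n + K - (\<Sum>e\<in>E. rel_entropy p (w e))"
          using ub[OF elim(2) Ssub[unfolded E_def] False] unfolding E_def by (elim bexE exE conjE)
        have w: "w e \<in> {0..1}" "e \<notin> E \<Longrightarrow> w e = 0" for e
          using ca by (auto simp: cut_approx_def E_def)
        have cut: "\<bar>\<Sum>x\<in>A. \<Sum>y\<in>B. w {x, y} - of_bool ({x, y} \<in> X)\<bar> \<le> \<epsilon>2 * (real n)\<^sup>2"
          if "A \<subseteq> {..<n}" "B \<subseteq> {..<n}" for A B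
          using ca that unfolding cut_approx_def by blast
        have "weighted_density H n w \<ge> r ^ card (edges H) - \<epsilon>1"
          using X by (intro counting_lower[OF H elim(2) ca[unfolded \<epsilon>2_def] _ \<epsilon>1]) (auto simp: S_def)
        then have "weighted_density H n w \<ge> r ^ card (edges H) - \<epsilon>0" by (simp add: \<epsilon>1_def)
        then have ps: "(\<Sum>e\<in>E. w e ^ d) \<ge> (r ^ d - c) * real (card E)"
          using power_sum0[OF elim(2), of w] w by (auto simp: E_def card_all_edges)
        have big: "(\<Sum>e\<in>E. rel_entropy p (w e)) > (rel_entropy p r + c) * real (card E)"
        proof (rule ccontr)
          assume "\<not> ?thesis"
          then have "(\<Sum>e\<in>E. \<bar>w e - r\<bar>) \<le> \<epsilon> / 8 * real (card E)"
            using w by (intro stab[OF fE _ ps]) auto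
          moreover have "\<epsilon> / 8 * (2 * real (card E)) \<le> \<epsilon> / 8 * (real n)\<^sup>2"
            using choose_2_le[of n] \<epsilon> by (intro mult_left_mono) (auto simp: E_def card_all_edges)
          ultimately have L1: "2 * (\<Sum>e\<in>E. \<bar>w e - r\<bar>) \<le> \<epsilon> / 8 * (real n)\<^sup>2" by simp
          \<comment> \<open>The diagonal of \<open>w\<close> is 0 rather than \<open>r\<close>; it
            adds at most 1 in each row, a negligible \<open>n\<close> in total.\<close>
          have full: "(\<Sum>x<n. \<Sum>y<n. \<bar>w {x, y} - r\<bar>) \<le> 2 * (\<Sum>e\<in>E. \<bar>w e - r\<bar>) + real n"
          proof -
            have "(\<Sum>y<n. \<bar>w {x, y} - r\<bar>) \<le> (\<Sum>y\<in>{..<n} - {x}. \<bar>w {x, y} - r\<bar>) + 1" if "x \<in> {..<n}" for x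
            proof -
              have "w {x} = 0" using w(2)[of "{x}"] by (simp add: E_def all_edges_def)
              then show ?thesis using that p r0 by (subst sum.remove[of _ x]) auto
            qed
            then have "(\<Sum>x<n. \<Sum>y<n. \<bar>w {x, y} - r\<bar>) \<le> (\<Sum>x<n. (\<Sum>y\<in>{..<n} - {x}. \<bar>w {x, y} - r\<bar>) + 1)"
              by (rule sum_mono)
            also have "\<dots> = 2 * (\<Sum>e\<in>E. \<bar>w e - r\<bar>) + real n"
              using sum_all_edges[of "\<lambda>e. \<bar>w e - r\<bar>" n] by (simp add: sum.distrib E_def)
            finally show ?thesis .
          qed
          have n4: "real n < \<epsilon> / 4 * (real n)\<^sup>2"
          proof -
            have "4 < \<epsilon> * real n" using elim(3) \<epsilon> by (simp add: field_simps)
            then have "4 * real n < \<epsilon> * real n * real n" using elim(2) by (intro mult_strict_right_mono) auto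
            then show ?thesis by (simp add: power2_eq_square)
          qed
          have "cut_dist_const ({..<n}, X) r < \<epsilon>"
          proof (rule cut_dist_const_less[OF elim(2)])
            fix A B assume AB: "A \<subseteq> {..<n}" "B \<subseteq> {..<n}"
            have "(\<Sum>a\<in>A. \<Sum>b\<in>B. of_bool ({a, b} \<in> X) - r)
              = (\<Sum>a\<in>A. \<Sum>b\<in>B. w {a, b} - r) - (\<Sum>a\<in>A. \<Sum>b\<in>B. w {a, b} - of_bool ({a, b} \<in> X))"
              by (simp flip: sum_subtractf)
            moreover have "\<bar>\<Sum>a\<in>A. \<Sum>b\<in>B. w {a, b} - r\<bar> \<le> (\<Sum>x<n. \<Sum>y<n. \<bar>w {x, y} - r\<bar>)"
            proof -
              have "\<bar>\<Sum>a\<in>A. \<Sum>b\<in>B. w {a, b} - r\<bar> \<le> (\<Sum>a\<in>A. \<bar>\<Sum>b\<in>B. w {a, b} - r\<bar>)" by (rule sum_abs)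
              also have "\<dots> \<le> (\<Sum>a\<in>A. \<Sum>b\<in>B. \<bar>w {a, b} - r\<bar>)" by (intro sum_mono sum_abs)
              also have "\<dots> \<le> (\<Sum>a\<in>A. \<Sum>y<n. \<bar>w {a, y} - r\<bar>)" using AB by (intro sum_mono sum_mono2) auto
              also have "\<dots> \<le> (\<Sum>x<n. \<Sum>y<n. \<bar>w {x, y} - r\<bar>)" using AB by (intro sum_mono2 sum_nonneg) auto
              finally show ?thesis .
            qed
            ultimately have "\<bar>\<Sum>a\<in>A. \<Sum>b\<in>B. of_bool ({a, b} \<in> X) - r\<bar>
                \<le> (\<Sum>x<n. \<Sum>y<n. \<bar>w {x, y} - r\<bar>) + \<epsilon>2 * (real n)\<^sup>2"
              using cut[OF AB] by linarith
            also have "\<dots> < \<epsilon> / 8 * (real n)\<^sup>2 + \<epsilon> / 4 * (real n)\<^sup>2 + \<epsilon> / 4 * (real n)\<^sup>2"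
            proof -
              have "\<epsilon>2 * (real n)\<^sup>2 \<le> \<epsilon> / 4 * (real n)\<^sup>2" using \<epsilon>2 by (intro mult_right_mono) auto
              then show ?thesis using L1 full n4 by linarith
            qed
            also have "\<dots> \<le> \<epsilon> * (real n)\<^sup>2" using \<epsilon> by simp
            finally show "\<bar>\<Sum>a\<in>A. \<Sum>b\<in>B. of_bool ({a, b} \<in> X) - r\<bar> < \<epsilon> * (real n)\<^sup>2" .
          qed
          then show False using X by (simp add: S_def)
        qed
        have pos: "(\<Sum>X\<in>S. bern E (\<lambda>_. p) X) > 0"
          using False finite_subset[OF Ssub] fE p p1 by (intro sum_pos bern_pos) auto
        have "ln (\<Sum>X\<in>S. bern E (\<lambda>_. p) X) \<le> - real (n choose 2) * (rel_entropy p r + c / 2)"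
          using ln big elim(1) by (simp add: E_def card_all_edges algebra_simps)
        then show ?thesis using pos by (metis exp_le_cancel_iff exp_ln)
      qed simp
      then show ?case by (simp only: S_def E_def)
    qed
  qed
qed

section \<open>Existence of the limit\<close>

text \<open>\<open>Inf Y\<close> is the limit superior. The hypothesis makes
  \<open>x n + \<eta>\<close> an eventual upper bound for all large \<open>n\<close>, so the limit
  inferior is no smaller.\<close>

lemma convergent_if_almost_decreasing:
  fixes x :: "nat \<Rightarrow> real"
  assumes x0: "\<And>n. x n \<ge> 0" and dec: "\<And>\<eta>. \<eta> > 0 \<Longrightarrow> \<forall>\<^sub>F n in sequentially. \<forall>\<^sub>F m in sequentially. x m \<le> x n + \<eta>"
  shows "\<exists>L. x \<longlonglongrightarrow> L"
proof -
  define Y where "Y = {y. \<forall>\<^sub>F n in sequentially. x n \<le> y}"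
  have bdd: "bdd_below Y"
  proof (rule bdd_belowI[of _ 0])
    fix y assume "y \<in> Y"
    then obtain n where "x n \<le> y" unfolding Y_def using eventually_happens[of _ sequentially] by auto
    then show "0 \<le> y" using x0[of n] by linarith
  qed
  have "Y \<noteq> {}"
  proof -
    obtain n where "\<forall>\<^sub>F m in sequentially. x m \<le> x n + 1"
      using eventually_happens[OF dec[of 1]] by auto
    then show ?thesis by (auto simp: Y_def)
  qed
  have "x \<longlonglongrightarrow> Inf Y"
  proof (rule order_tendstoI)
    fix a assume a: "a < Inf Y"
    have "\<forall>\<^sub>F n in sequentially. \<forall>\<^sub>F m in sequentially. x m \<le> x n + (Inf Y - a) / 2"
      using a by (intro dec) simp
    then show "\<forall>\<^sub>F n in sequentially. a < x n"
    proof eventually_elim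
      case (elim n)
      then have "Inf Y \<le> x n + (Inf Y - a) / 2" by (intro cInf_lower bdd) (simp add: Y_def)
      then show ?case using a by (simp add: field_simps)
    qed
  next
    fix a assume "Inf Y < a"
    then obtain y where "y \<in> Y" "y < a" using cInf_lessD[OF \<open>Y \<noteq> {}\<close>] by blast
    then show "\<forall>\<^sub>F n in sequentially. x n < a"
      unfolding Y_def by (auto elim: eventually_mono)
  qed
  then show ?thesis ..
qed

lemma tail_prob_le_1:
  assumes "0 < p" "p < 1" shows "tail_prob p H \<tau> n \<le> 1" and "tail_prob p H \<tau> n \<ge> 0"
proof -
  let ?E = "all_edges {..<n}"
  have "tail_prob p H \<tau> n \<le> (\<Sum>X\<in>Pow ?E. bern ?E (\<lambda>_. p) X)"
    unfolding tail_prob_def using assms finite_all_edges by (intro sum_mono2 bern_nonneg) auto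
  then show "tail_prob p H \<tau> n \<le> 1" using sum_bern[OF finite_all_edges] by simp
  show "tail_prob p H \<tau> n \<ge> 0"
    unfolding tail_prob_def using assms by (intro sum_nonneg bern_nonneg) auto
qed

text \<open>The upper bound at \<open>n\<close> produces weights of nearly the cost
  \<open>x n\<close>, and the lower bound uses them as a template for all large \<open>m\<close>. In
  between, a push towards 1 restores a density strictly above \<open>\<tau>\<close>. The three
  thirds of \<open>\<eta>\<close> pay for the linear error, the push and the lower bound; the limit
  itself is not identified.\<close>

lemma tail_prob_almost_decreasing:
  assumes p: "0 < p" "p < 1" and \<tau>: "\<tau> < 1" and H: "finite_simple_graph H"
    and pos: "\<forall>\<^sub>F n in sequentially. tail_prob p H \<tau> n > 0" and \<eta>: "\<eta> > 0"
  defines "x n \<equiv> - ln (tail_prob p H \<tau> n) / real (n choose 2)"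
  shows "\<forall>\<^sub>F n in sequentially. \<forall>\<^sub>F m in sequentially. x m \<le> x n + \<eta>"
proof -
  let ?e = "card (edges H)"
  have "uniformly_continuous_on {0..1} (rel_entropy p)"
    by (intro compact_uniformly_continuous continuous_on_rel_entropy p) auto
  then obtain \<delta>0 where \<delta>0: "\<delta>0 > 0"
    and uc: "\<And>a b. a \<in> {0..1} \<Longrightarrow> b \<in> {0..1} \<Longrightarrow> \<bar>b - a\<bar> < \<delta>0 \<Longrightarrow> \<bar>rel_entropy p b - rel_entropy p a\<bar> < \<eta> / 3"
    using \<eta> unfolding uniformly_continuous_on_def dist_real_def by (metis divide_pos_pos zero_less_numeral)
  define \<delta> where "\<delta> = min (\<delta>0 / 2) 1"
  have \<delta>: "0 < \<delta>" "\<delta> \<le> 1" "\<delta> < \<delta>0" using \<delta>0 by (auto simp: \<delta>_def)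
  define D where "D = \<delta> ^ ?e"
  have D: "0 < D" "D \<le> 1" using \<delta> by (auto simp: D_def power_le_one)
  \<comment> \<open>Half of the gain \<open>(1 - \<tau>) * D\<close> that the push yields at density
    \<open>\<tau>\<close>.\<close>
  define \<epsilon> where "\<epsilon> = (1 - \<tau>) * D / 2"
  have \<epsilon>: "\<epsilon> > 0" using D \<tau> by (simp add: \<epsilon>_def)
  have "\<epsilon> / (real ?e + 1) > 0" using \<epsilon> by simp
  from upper_bound_by_mean[OF p this] obtain K where K: "K \<ge> 0"
    and ub0: "\<forall>n>0. \<forall>S\<subseteq>Pow (all_edges {..<n}). S \<noteq> {} \<longrightarrow>
    (\<exists>X\<in>S. \<exists>w. cut_approx (\<epsilon> / (real ?e + 1)) n X w \<and> ln (\<Sum>X\<in>S. bern (all_edges {..<n}) (\<lambda>_. p) X)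
        \<le> K * real n + K - (\<Sum>e\<in>all_edges {..<n}. rel_entropy p (w e)))"
    by (elim exE conjE)
  note ub = ub0[rule_format]
  have "\<eta> / 3 > 0" using \<eta> by simp
  from linear_le_choose_2[OF this K] eventually_ge_at_top[of 2] pos
  show ?thesis
  proof eventually_elim
    case (elim n)
    have n: "n > 0" using elim by simp
    have C: "real (n choose 2) > 0"
    proof -
      have "(real n)\<^sup>2 / 4 > 0" using n by simp
      then show ?thesis using choose_2_ge[OF elim(2)] by linarith
    qed
    define E where "E = all_edges {..<n}"
    define S where "S = {X \<in> Pow E. \<tau> \<le> weighted_density H n (\<lambda>e. of_bool (e \<in> X))}"
    have tp: "tail_prob p H \<tau> n = (\<Sum>X\<in>S. bern E (\<lambda>_. p) X)" by (simp only: tail_prob_def S_def E_def)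
    have S: "S \<noteq> {}" using elim(3) unfolding tp by (intro notI) simp
    have Ssub: "S \<subseteq> Pow (all_edges {..<n})" by (auto simp: S_def E_def)
    obtain w X where X: "X \<in> S" and ca: "cut_approx (\<epsilon> / (real ?e + 1)) n X w"
      and ln: "ln (tail_prob p H \<tau> n) \<le> K * real n + K - (\<Sum>e\<in>E. rel_entropy p (w e))"
      using ub[OF n Ssub S] unfolding tp E_def by (elim bexE exE conjE)
    have w: "w e \<in> {0..1}" "e \<notin> E \<Longrightarrow> w e = 0" for e
      using ca by (auto simp: cut_approx_def E_def)
    have t: "weighted_density H n w \<ge> \<tau> - \<epsilon>"
      using X by (intro counting_lower[OF H n ca _ \<epsilon>]) (auto simp: S_def)
    \<comment> \<open>Raising the diagonal from 0 to \<open>p\<close> makes its entropy 0, and the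
      density can only grow.\<close>
    define w1 where "w1 e = (if e \<in> E then w e else p)" for e
    have w1: "w1 e \<in> {0..1}" for e using w p by (auto simp: w1_def)
    have t1: "weighted_density H n w1 \<ge> \<tau> - \<epsilon>"
    proof -
      have "weighted_density H n w \<le> weighted_density H n w1"
        using w p by (intro weighted_density_mono) (auto simp: w1_def)
      then show ?thesis using t by simp
    qed
    define w2 where "w2 e = w1 e + \<delta> * (1 - w1 e)" for e
    have w2: "w2 e \<in> {0..1}" and w2_close: "\<bar>w2 e - w1 e\<bar> < \<delta>0" for e
    proof -
      have a: "0 \<le> w1 e" "w1 e \<le> 1" using w1[of e] by auto
      have "\<delta> * (1 - w1 e) \<le> 1 * (1 - w1 e)" by (rule mult_right_mono) (use a \<delta> in auto)
      moreover have "\<delta> * (1 - w1 e) \<le> \<delta> * 1" by (rule mult_left_mono) (use a \<delta> in auto)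
      moreover have "0 \<le> \<delta> * (1 - w1 e)" using a \<delta> by simp
      ultimately have b: "0 \<le> \<delta> * (1 - w1 e)" "\<delta> * (1 - w1 e) \<le> 1 - w1 e" "\<delta> * (1 - w1 e) \<le> \<delta>"
        by simp_all
      show "w2 e \<in> {0..1}" using a b by (simp add: w2_def)
      have "\<bar>w2 e - w1 e\<bar> = \<delta> * (1 - w1 e)" using b(1) by (simp add: w2_def)
      also have "\<dots> < \<delta>0" by (rule order.strict_trans1[OF b(3) \<delta>(3)])
      finally show "\<bar>w2 e - w1 e\<bar> < \<delta>0" .
    qed
    have t2: "\<tau> < weighted_density H n w2"
    proof -
      let ?t = "weighted_density H n w1"
      have "?t + (1 - ?t) * D \<le> weighted_density H n w2"
        unfolding w2_def D_def using \<delta> by (intro weighted_density_perturb[OF H n w1]) auto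
      moreover have "(\<tau> - \<epsilon>) * (1 - D) \<le> ?t * (1 - D)" using t1 D by (intro mult_right_mono) auto
      moreover have "\<epsilon> * (1 - D) \<le> \<epsilon>" using \<epsilon> D by (simp add: mult_left_le)
      moreover have "\<epsilon> < (1 - \<tau>) * D" using D \<tau> by (simp add: \<epsilon>_def)
      ultimately show ?thesis by (simp add: algebra_simps)
    qed
    have ent1: "step_entropy p n w1 \<le> (\<Sum>e\<in>E. rel_entropy p (w e)) / real (n choose 2)"
    proof -
      have "(\<Sum>x<n. \<Sum>y<n. rel_entropy p (w1 {x, y})) = 2 * (\<Sum>e\<in>E. rel_entropy p (w1 e))"
        unfolding E_def by (rule double_sum_off_diagonal) (simp add: w1_def E_def all_edges_def)
      also have "(\<Sum>e\<in>E. rel_entropy p (w1 e)) = (\<Sum>e\<in>E. rel_entropy p (w e))"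
        by (intro sum.cong) (auto simp: w1_def)
      finally have eq: "step_entropy p n w1 = 2 * (\<Sum>e\<in>E. rel_entropy p (w e)) / (real n)\<^sup>2"
        by (simp add: step_entropy_def)
      have "(\<Sum>e\<in>E. rel_entropy p (w e)) \<ge> 0" using w p by (intro sum_nonneg rel_entropy_nonneg) auto
      then have "2 * (\<Sum>e\<in>E. rel_entropy p (w e)) / (real n)\<^sup>2 \<le> 2 * (\<Sum>e\<in>E. rel_entropy p (w e)) / (2 * real (n choose 2))"
        using choose_2_le[of n] C n by (intro divide_left_mono) auto
      then show ?thesis unfolding eq by simp
    qed
    have ent2: "step_entropy p n w2 \<le> step_entropy p n w1 + \<eta> / 3"
    proof -
      have "(\<Sum>x<n. \<Sum>y<n. rel_entropy p (w2 {x, y})) \<le> (\<Sum>x<n. \<Sum>y<n. rel_entropy p (w1 {x, y}) + \<eta> / 3)"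
      proof (intro sum_mono)
        fix x y
        show "rel_entropy p (w2 {x, y}) \<le> rel_entropy p (w1 {x, y}) + \<eta> / 3"
          using uc[OF w1 w2 w2_close, of "{x, y}"] by linarith
      qed
      also have "\<dots> = (\<Sum>x<n. \<Sum>y<n. rel_entropy p (w1 {x, y})) + (real n)\<^sup>2 * (\<eta> / 3)"
        by (simp add: sum.distrib power2_eq_square)
      finally have "(\<Sum>x<n. \<Sum>y<n. rel_entropy p (w2 {x, y})) / (real n)\<^sup>2
          \<le> ((\<Sum>x<n. \<Sum>y<n. rel_entropy p (w1 {x, y})) + (real n)\<^sup>2 * (\<eta> / 3)) / (real n)\<^sup>2"
        by (intro divide_right_mono) auto
      also have "\<dots> = step_entropy p n w1 + \<eta> / 3" using n by (simp add: step_entropy_def add_divide_distrib)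
      finally show ?thesis by (simp add: step_entropy_def)
    qed
    have "(\<Sum>e\<in>E. rel_entropy p (w e)) \<le> - ln (tail_prob p H \<tau> n) + \<eta> / 3 * real (n choose 2)"
      using ln elim(1) by linarith
    then have "(\<Sum>e\<in>E. rel_entropy p (w e)) / real (n choose 2) \<le> (- ln (tail_prob p H \<tau> n) + \<eta> / 3 * real (n choose 2)) / real (n choose 2)"
      using C by (intro divide_right_mono) auto
    also have "\<dots> = x n + \<eta> / 3" using C unfolding x_def by (simp add: field_simps)
    finally have J: "step_entropy p n w2 + \<eta> / 3 \<le> x n + \<eta>" using ent1 ent2 by linarith
    have "\<forall>\<^sub>F m in sequentially. tail_prob p H \<tau> m > 0 \<and>
      - ln (tail_prob p H \<tau> m) \<le> real (m choose 2) * (step_entropy p n w2 + \<eta> / 3)"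
      using \<eta> by (intro tail_prob_lower[OF p H n w2 t2]) auto
    then show ?case
      using eventually_ge_at_top[of 2]
    proof eventually_elim
      case (elim m)
      have "(real m)\<^sup>2 / 4 > 0" using elim by simp
      then have Cm: "real (m choose 2) > 0" using choose_2_ge[OF elim(2)] by linarith
      have "- ln (tail_prob p H \<tau> m) \<le> real (m choose 2) * (x n + \<eta>)"
        using elim J Cm by (smt (verit) mult_left_mono)
      then show ?case unfolding x_def[of m] pos_divide_le_eq[OF Cm] by (simp add: mult.commute)
    qed
  qed
qed

section \<open>Symmetry breaking\<close>

text \<open>The convex combination that hits \<open>x0\<close> exactly has strictly smaller height.
  A slightly larger weight on \<open>x2\<close> gains strictly in \<open>x\<close> and keeps the
  strict inequality in \<open>h\<close>; a rational weight in that range has the multiplicities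
  \<open>i\<close> and \<open>j\<close>.\<close>

lemma exists_integer_weights:
  fixes h0 h1 h2 x0 x1 x2 :: real
  assumes x: "x1 < x0" "x0 < x2" and h: "h1 * (x2 - x0) + h2 * (x0 - x1) < h0 * (x2 - x1)"
  obtains i j :: nat where "i + j > 0" "real i * x1 + real j * x2 > real (i + j) * x0"
    "real i * h1 + real j * h2 < real (i + j) * h0"
proof -
  define l where "l = (x0 - x1) / (x2 - x1)"
  have l: "0 < l" "l < 1" using x by (auto simp: l_def)
  have lx: "l * (x2 - x1) = x0 - x1" using x by (simp add: l_def)
  have lh: "(1 - l) * h1 + l * h2 < h0"
  proof -
    have "((1 - l) * h1 + l * h2) * (x2 - x1) = h1 * ((x2 - x1) - l * (x2 - x1)) + h2 * (l * (x2 - x1))"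
      by (simp add: algebra_simps)
    also have "\<dots> < h0 * (x2 - x1)" using h unfolding lx by simp
    finally show ?thesis using x by simp
  qed
  have "((\<lambda>b. (1 - b) * h1 + b * h2) \<longlongrightarrow> (1 - l) * h1 + l * h2) (at_right l)" by (intro tendsto_intros)
  then have "\<forall>\<^sub>F b in at_right l. (1 - b) * h1 + b * h2 < h0" using lh by (rule order_tendstoD)
  then obtain u where u: "u > l" "\<And>b. l < b \<Longrightarrow> b < u \<Longrightarrow> (1 - b) * h1 + b * h2 < h0"
    unfolding eventually_at_right_field by blast
  have "l < min u 1" using u l by simp
  then obtain b where b: "b \<in> \<rat>" "l < b" "b < min u 1" using Rats_dense_in_real by blast
  obtain m n where mn: "n \<noteq> 0" "\<bar>b\<bar> = real m / real n" using Rats_abs_nat_div_natE[OF b(1)] by metis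
  have bn: "b = real m / real n" using mn b l by simp
  have "m \<le> n" using b bn mn by (simp add: divide_less_eq)
  then have ri: "real (n - m) = real n - real m" by (rule of_nat_diff)
  have nb: "real m = real n * b" "real n - real m = real n * (1 - b)" using mn by (auto simp: bn field_simps)
  have sum: "real (n - m + m) = real n" using \<open>m \<le> n\<close> by simp
  show ?thesis
  proof (rule that[of "n - m" m])
    show "n - m + m > 0" using mn \<open>m \<le> n\<close> by simp
    have "(1 - b) * x1 + b * x2 = x1 + b * (x2 - x1)" by (simp add: algebra_simps)
    also have "\<dots> > x1 + l * (x2 - x1)" using b x by simp
    finally have "(1 - b) * x1 + b * x2 > x0" using lx by simp
    then have "real n * ((1 - b) * x1 + b * x2) > real n * x0" using mn by simp
    then show "real (n - m) * x1 + real m * x2 > real (n - m + m) * x0"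
      unfolding ri sum nb by (simp add: algebra_simps)
    have "(1 - b) * h1 + b * h2 < h0" using u b by auto
    then have "real n * ((1 - b) * h1 + b * h2) < real n * h0" using mn by simp
    then show "real (n - m) * h1 + real m * h2 < real (n - m + m) * h0"
      unfolding ri sum nb by (simp add: algebra_simps)
  qed
qed

text \<open>\<open>Min\<close> and \<open>Max\<close> detect unordered pairs with exactly one end
  below \<open>K\<close>; the weight depends on that end only.\<close>

definition star_pattern :: "nat \<Rightarrow> (nat \<Rightarrow> real) \<Rightarrow> real \<Rightarrow> nat set \<Rightarrow> real" where
  "star_pattern K u r e = (if Min e < K \<and> \<not> Max e < K then u (Min e) else r)"

lemma star_pattern_pair:
  "star_pattern K u r {x, y} = (if x < K \<and> \<not> y < K then u x else if y < K \<and> \<not> x < K then u y else r)"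
  by (auto simp: star_pattern_def min_def max_def)

text \<open>Only the mixed pairs differ from the constant \<open>r\<close>. Each special vertex
  meets \<open>N - K\<close> others, counted in both orders, so the total change is
  \<open>2 * (N - K)\<close> times the sum of \<open>D\<close>, which is negative.\<close>

lemma step_entropy_star_pattern:
  assumes N: "K < N" and less: "(\<Sum>x<K. rel_entropy p (u x)) < real K * rel_entropy p r"
  shows "step_entropy p N (star_pattern K u r) < rel_entropy p r"
proof -
  define h where "h = rel_entropy p r"
  define D where "D x = rel_entropy p (u x) - h" for x
  have off: "(\<Sum>x<N. \<Sum>y<N. of_bool (x < K) * of_bool (\<not> y < K) * D x) = real (N - K) * (\<Sum>x<K. D x)"
  proof -
    have "(\<Sum>y<N. of_bool (\<not> y < K)) = real (N - K)"
    proof -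
      have "{..<N} \<inter> {y. \<not> y < K} = {K..<N}" by auto
      then show ?thesis by (simp add: of_bool_def sum.If_cases)
    qed
    then have "(\<Sum>x<N. \<Sum>y<N. of_bool (x < K) * of_bool (\<not> y < K) * D x) = (\<Sum>x<N. of_bool (x < K) * D x * real (N - K))"
      by (intro sum.cong refl) (simp add: mult_ac flip: sum_distrib_left sum_distrib_right)
    also have "\<dots> = (\<Sum>x<K. D x * real (N - K))"
      using N by (intro sum.mono_neutral_cong_right) auto
    also have "\<dots> = (\<Sum>x<K. D x) * real (N - K)" by (rule sum_distrib_right[symmetric])
    finally show ?thesis by (simp only: mult.commute)
  qed
  have "(\<Sum>x<N. \<Sum>y<N. rel_entropy p (star_pattern K u r {x, y}))
      = (\<Sum>x<N. \<Sum>y<N. h + of_bool (x < K) * of_bool (\<not> y < K) * D x + of_bool (y < K) * of_bool (\<not> x < K) * D y)"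
    by (intro sum.cong refl) (auto simp: star_pattern_pair D_def h_def)
  also have "\<dots> = (real N)\<^sup>2 * h + real (N - K) * (\<Sum>x<K. D x)
      + (\<Sum>x<N. \<Sum>y<N. of_bool (y < K) * of_bool (\<not> x < K) * D y)"
    unfolding sum.distrib off by (simp add: power2_eq_square)
  also have "(\<Sum>x<N. \<Sum>y<N. of_bool (y < K) * of_bool (\<not> x < K) * D y) = real (N - K) * (\<Sum>x<K. D x)"
    by (subst sum.swap) (rule off)
  finally have "(\<Sum>x<N. \<Sum>y<N. rel_entropy p (star_pattern K u r {x, y})) = (real N)\<^sup>2 * h + 2 * (real (N - K) * (\<Sum>x<K. D x))"
    by simp
  moreover have "real (N - K) * (\<Sum>x<K. D x) < 0"
    using less N by (intro mult_pos_neg) (auto simp: D_def sum_subtractf h_def)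
  ultimately have "(\<Sum>x<N. \<Sum>y<N. rel_entropy p (star_pattern K u r {x, y})) < (real N)\<^sup>2 * h" by linarith
  then show ?thesis using N by (simp add: step_entropy_def h_def field_simps)
qed

text \<open>Only the maps sending at most one vertex to the first \<open>K\<close> positions are counted.\<close>

lemma hom_sum_star_pattern_ge:
  assumes H: "finite_simple_graph H" and reg: "regular d H" and N: "K \<le> N"
    and u: "\<And>x. u x \<ge> 0" and r: "r \<ge> 0"
  shows "hom_sum H N (star_pattern K u r) \<ge> real (N - K) ^ card (verts H) * r ^ card (edges H)
    + real (card (verts H)) * (real (N - K) ^ (card (verts H) - 1) * r ^ (card (edges H) - d) * (\<Sum>x<K. u x ^ d))"
proof -
  define w where "w = star_pattern K u r"
  have fin: "finite (verts H)" "finite (edges H)" using H finite_edges[OF H] by (auto simp: finite_simple_graph_def)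
  have w0: "w e \<ge> 0" for e using u r by (simp add: w_def star_pattern_def)
  define F where "F \<phi> = (\<Prod>e\<in>edges H. w (\<phi> ` e))" for \<phi> :: "'a \<Rightarrow> nat"
  have F0: "F \<phi> \<ge> 0" for \<phi> unfolding F_def using w0 by (intro prod_nonneg) auto
  define \<Phi>0 where "\<Phi>0 = verts H \<rightarrow>\<^sub>E {K..<N}"
  define \<Phi> where "\<Phi> v = (\<Pi>\<^sub>E a\<in>verts H. if a = v then {..<K} else {K..<N})" for v
  have f0: "finite \<Phi>0" unfolding \<Phi>0_def using fin by (intro finite_PiE) auto
  have f1: "finite (\<Phi> v)" for v unfolding \<Phi>_def using fin by (intro finite_PiE) auto
  have sub0: "\<Phi>0 \<subseteq> verts H \<rightarrow>\<^sub>E {..<N}" unfolding \<Phi>0_def by (intro PiE_mono) auto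
  have sub1: "\<Phi> v \<subseteq> verts H \<rightarrow>\<^sub>E {..<N}" for v unfolding \<Phi>_def using N by (intro PiE_mono) auto
  have mem1: "\<phi> v < K" if "\<phi> \<in> \<Phi> v" "v \<in> verts H" for \<phi> v
    using PiE_mem[OF that[unfolded \<Phi>_def]] by simp
  have mem1': "\<not> \<phi> a < K" if "\<phi> \<in> \<Phi> v" "a \<in> verts H" "a \<noteq> v" for \<phi> v a
    using PiE_mem[OF that(1,2)[unfolded \<Phi>_def]] that(3) by simp
  have mem0: "\<not> \<phi> a < K" if "\<phi> \<in> \<Phi>0" "a \<in> verts H" for \<phi> a
    using PiE_mem[OF that[unfolded \<Phi>0_def]] by simp
  have disj0: "\<Phi>0 \<inter> (\<Union>v\<in>verts H. \<Phi> v) = {}" using mem0 mem1 by blast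
  have disj1: "\<Phi> v \<inter> \<Phi> v' = {}" if "v \<in> verts H" "v' \<in> verts H" "v \<noteq> v'" for v v'
    using mem1 mem1' that by blast
  have sum0: "(\<Sum>\<phi>\<in>\<Phi>0. F \<phi>) = real (N - K) ^ card (verts H) * r ^ card (edges H)"
  proof -
    have "F \<phi> = r ^ card (edges H)" if "\<phi> \<in> \<Phi>0" for \<phi>
    proof -
      have "w (\<phi> ` e) = r" if e: "e \<in> edges H" for e
      proof -
        obtain a b where ab: "e = {a, b}" "a \<in> verts H" "b \<in> verts H" using edge_cases[OF H e] by metis
        then show ?thesis using mem0[OF \<open>\<phi> \<in> \<Phi>0\<close>] by (simp add: w_def star_pattern_pair)
      qed
      then show ?thesis by (simp add: F_def)
    qed
    then show ?thesis using fin by (simp add: \<Phi>0_def card_funcsetE)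
  qed
  have sum1: "(\<Sum>\<phi>\<in>\<Phi> v. F \<phi>) = real (N - K) ^ (card (verts H) - 1) * r ^ (card (edges H) - d) * (\<Sum>x<K. u x ^ d)"
    if v: "v \<in> verts H" for v
  proof -
    define Ev where "Ev = {e \<in> edges H. v \<in> e}"
    have Ev: "Ev \<subseteq> edges H" "card Ev = d" using reg v by (auto simp: Ev_def regular_def degree_def)
    have "F \<phi> = r ^ (card (edges H) - d) * u (\<phi> v) ^ d" if \<phi>: "\<phi> \<in> \<Phi> v" for \<phi>
    proof -
      have in_Ev: "w (\<phi> ` e) = u (\<phi> v)" if e: "e \<in> Ev" for e
      proof -
        obtain a b where ab: "e = {a, b}" "a \<noteq> b" "a \<in> verts H" "b \<in> verts H"
          using edge_cases[OF H, of e] e by (auto simp: Ev_def)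
        have "v = a \<or> v = b" using e ab by (auto simp: Ev_def)
        then show ?thesis
          using ab mem1[OF \<phi> v] mem1'[OF \<phi>] by (auto simp: w_def star_pattern_pair)
      qed
      have out_Ev: "w (\<phi> ` e) = r" if e: "e \<in> edges H - Ev" for e
      proof -
        obtain a b where ab: "e = {a, b}" "a \<in> verts H" "b \<in> verts H"
          using edge_cases[OF H, of e] e by (metis DiffD1)
        have "a \<noteq> v" "b \<noteq> v" using e ab by (auto simp: Ev_def)
        then show ?thesis using ab mem1'[OF \<phi>] by (simp add: w_def star_pattern_pair)
      qed
      have "F \<phi> = (\<Prod>e\<in>edges H - Ev. w (\<phi> ` e)) * (\<Prod>e\<in>Ev. w (\<phi> ` e))"
        unfolding F_def by (rule prod.subset_diff[OF Ev(1) fin(2)])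
      also have "\<dots> = r ^ (card (edges H) - d) * u (\<phi> v) ^ d"
        using in_Ev out_Ev Ev finite_subset[OF Ev(1) fin(2)] by (simp add: card_Diff_subset)
      finally show ?thesis .
    qed
    \<comment> \<open>Exactly \<open>d\<close> edges of \<open>H\<close> meet \<open>v\<close>, and
      only they see the special weight. The remaining sum factorises over the vertices of
      \<open>H\<close>.\<close>
    then have "(\<Sum>\<phi>\<in>\<Phi> v. F \<phi>) = r ^ (card (edges H) - d) * (\<Sum>\<phi>\<in>\<Phi> v. u (\<phi> v) ^ d)"
      by (simp add: sum_distrib_left)
    also have "(\<Sum>\<phi>\<in>\<Phi> v. u (\<phi> v) ^ d) = (\<Sum>\<phi>\<in>\<Phi> v. \<Prod>a\<in>verts H. if a = v then u (\<phi> a) ^ d else 1)"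
      using fin v by (simp add: prod.delta)
    also have "\<dots> = (\<Prod>a\<in>verts H. \<Sum>x\<in>(if a = v then {..<K} else {K..<N}). if a = v then u x ^ d else 1)"
      unfolding \<Phi>_def using fin by (intro prod_sum_PiE[symmetric]) auto
    also have "\<dots> = (\<Prod>a\<in>verts H. if a = v then (\<Sum>x<K. u x ^ d) else real (N - K))"
      by (intro prod.cong) auto
    also have "\<dots> = (\<Sum>x<K. u x ^ d) * (\<Prod>a\<in>verts H - {v}. real (N - K))"
      using fin v by (subst prod.remove[of _ v]) auto
    also have "(\<Prod>a\<in>verts H - {v}. real (N - K)) = real (N - K) ^ (card (verts H) - 1)"
      using fin v by simp
    finally show ?thesis by (simp add: mult_ac)
  qed
  have "(\<Sum>\<phi>\<in>\<Phi>0. F \<phi>) + (\<Sum>v\<in>verts H. \<Sum>\<phi>\<in>\<Phi> v. F \<phi>) = (\<Sum>\<phi>\<in>\<Phi>0 \<union> (\<Union>v\<in>verts H. \<Phi> v). F \<phi>)"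
    using fin f0 f1 disj0 disj1 by (subst sum.union_disjoint) (auto simp: sum.UNION_disjoint)
  also have "\<dots> \<le> (\<Sum>\<phi>\<in>verts H \<rightarrow>\<^sub>E {..<N}. F \<phi>)"
    using fin sub0 sub1 F0 by (intro sum_mono2 finite_PiE) auto
  also have "\<dots> = hom_sum H N w" by (simp add: hom_sum_def F_def)
  finally show ?thesis using sum0 sum1 by (simp add: w_def)
qed

text \<open>Expansion in \<open>1 / N\<close>: avoiding the special vertices loses about
  \<open>v * K / N * r ^ m\<close>, and placing one vertex of \<open>H\<close> on them gains
  \<open>v / N * r ^ (m - d)\<close> times the sum of \<open>u x ^ d\<close>. The excess
  \<open>c\<close> of that sum over \<open>K * r ^ d\<close> decides; Bernoulli's inequality bounds
  the higher-order terms.\<close>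

lemma weighted_density_star_pattern:
  assumes H: "finite_simple_graph H" and reg: "regular d H" and V: "verts H \<noteq> {}"
    and u: "\<And>x. u x \<ge> 0" and r: "r > 0" and big: "(\<Sum>x<K. u x ^ d) > real K * r ^ d"
  shows "\<forall>\<^sub>F N in sequentially. weighted_density H N (star_pattern K u r) > r ^ card (edges H)"
proof -
  define v where "v = card (verts H)"
  define m where "m = card (edges H)"
  define c where "c = (\<Sum>x<K. u x ^ d) - real K * r ^ d"
  have fin: "finite (verts H)" "finite (edges H)" using H finite_edges[OF H] by (auto simp: finite_simple_graph_def)
  have v: "v > 0" using V fin by (simp add: v_def card_gt_0_iff)
  have c: "c > 0" using big by (simp add: c_def)
  have dm: "d \<le> m"
  proof -
    obtain a where "a \<in> verts H" using V by blast
    then have "d = card {e \<in> edges H. a \<in> e}" using reg by (simp add: regular_def degree_def)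
    also have "\<dots> \<le> m" unfolding m_def using fin by (intro card_mono) auto
    finally show ?thesis .
  qed
  then have rm: "r ^ m = r ^ (m - d) * r ^ d" by (metis le_add_diff_inverse2 power_add)
  \<comment> \<open>The lower bound obtained for the density is
    \<open>r ^ m + v / N * g N\<close>.\<close>
  define g where "g N = (1 - real v * (real K / real N)) * (r ^ (m - d) * c) - real v * (real K)\<^sup>2 * r ^ m / real N" for N
  have "g \<longlonglongrightarrow> (1 - real v * 0) * (r ^ (m - d) * c) - 0"
  proof -
    have a: "(\<lambda>N. real K / real N) \<longlonglongrightarrow> 0" "(\<lambda>N. real v * (real K)\<^sup>2 * r ^ m / real N) \<longlonglongrightarrow> 0"
      by (rule lim_const_over_n)+
    show ?thesis unfolding g_def by (intro tendsto_intros a)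
  qed
  then have "\<forall>\<^sub>F N in sequentially. g N > 0"
    by (rule order_tendstoD) (use c r in simp)
  then show ?thesis
    using eventually_gt_at_top[of K]
  proof eventually_elim
    case (elim N)
    then have N: "N > 0" by simp
    define \<kappa> where "\<kappa> = real K / real N"
    have \<kappa>: "0 \<le> \<kappa>" "\<kappa> \<le> 1" using elim by (auto simp: \<kappa>_def)
    have NK: "real (N - K) = real N * (1 - \<kappa>)" using elim by (simp add: \<kappa>_def field_simps)
    have bern_v: "(1 - \<kappa>) ^ v \<ge> 1 - real v * \<kappa>"
      using Bernoulli_inequality[of "- \<kappa>" v] \<kappa> by simp
    have bern_v1: "(1 - \<kappa>) ^ (v - 1) \<ge> 1 - real v * \<kappa>"
    proof -
      have "(1 - \<kappa>) ^ v \<le> (1 - \<kappa>) ^ (v - 1)" using \<kappa> by (intro power_decreasing) auto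
      then show ?thesis using bern_v by simp
    qed
    define T where "T = r ^ (m - d) * (\<Sum>x<K. u x ^ d)"
    have T: "T = real K * r ^ m + r ^ (m - d) * c" by (simp add: T_def c_def rm algebra_simps)
    have T0: "T \<ge> 0" unfolding T using r c by simp
    have Nv: "real N ^ v = real N * real N ^ (v - 1)" using v by (cases v) auto
    have "hom_sum H N (star_pattern K u r) \<ge> real (N - K) ^ v * r ^ m + real v * (real (N - K) ^ (v - 1) * T)"
      using hom_sum_star_pattern_ge[OF H reg _ u, of K N r] elim r by (simp add: v_def m_def T_def mult.assoc)
    also have "real (N - K) ^ v * r ^ m + real v * (real (N - K) ^ (v - 1) * T)
        = real N ^ v * ((1 - \<kappa>) ^ v * r ^ m + real v * ((1 - \<kappa>) ^ (v - 1) * (T / real N)))"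
      unfolding NK power_mult_distrib Nv using N by (simp add: field_simps)
    finally have ge: "weighted_density H N (star_pattern K u r)
        \<ge> (1 - \<kappa>) ^ v * r ^ m + real v * ((1 - \<kappa>) ^ (v - 1) * (T / real N))"
      unfolding weighted_density_def v_def[symmetric] using N by (simp add: pos_le_divide_eq mult.commute)
    have "(1 - \<kappa>) ^ v * r ^ m \<ge> (1 - real v * \<kappa>) * r ^ m"
      using bern_v r by (intro mult_right_mono) auto
    moreover have "real v * ((1 - \<kappa>) ^ (v - 1) * (T / real N)) \<ge> real v * ((1 - real v * \<kappa>) * (T / real N))"
      using bern_v1 T0 by (intro mult_left_mono mult_right_mono) auto
    moreover have "(1 - real v * \<kappa>) * r ^ m + real v * ((1 - real v * \<kappa>) * (T / real N)) = r ^ m + real v / real N * g N"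
    proof -
      have "T / real N = \<kappa> * r ^ m + r ^ (m - d) * c / real N" by (simp add: T \<kappa>_def add_divide_distrib)
      moreover have "real v / real N * g N
         = real v * ((1 - real v * \<kappa>) * (r ^ (m - d) * c / real N)) - real v * (real v * (\<kappa> * (\<kappa> * r ^ m)))"
        using N by (simp add: g_def \<kappa>_def field_simps power2_eq_square)
      ultimately show ?thesis by (simp add: algebra_simps)
    qed
    moreover have "real v / real N * g N > 0" using v N elim by simp
    ultimately show ?case using ge by (simp add: m_def)
  qed
qed

lemma tail_prob_asymmetric_lower:
  assumes p: "0 < p" "p < 1" and r: "0 < r" "r < 1" and d: "d > 0"
    and H: "finite_simple_graph H" and reg: "regular d H" and V: "verts H \<noteq> {}"
    and ns: "\<nexists>s. \<forall>y\<in>{0..1}. rel_entropy p r + s * (y ^ d - r ^ d) \<le> rel_entropy p y"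
  shows "\<exists>c>0. \<forall>\<^sub>F m in sequentially. tail_prob p H (r ^ card (edges H)) m > 0 \<and>
    - ln (tail_prob p H (r ^ card (edges H)) m) \<le> real (m choose 2) * (rel_entropy p r - c)"
proof -
  obtain y1 y2 where y: "y1 \<in> {0..1}" "y2 \<in> {0..1}" "y1 ^ d < r ^ d" "r ^ d < y2 ^ d"
    and ent: "rel_entropy p y1 * (y2 ^ d - r ^ d) + rel_entropy p y2 * (r ^ d - y1 ^ d) < rel_entropy p r * (y2 ^ d - y1 ^ d)"
    by (rule no_support_imp_chord[OF p r d ns])
  obtain i j :: nat where ij: "i + j > 0" "real i * y1 ^ d + real j * y2 ^ d > real (i + j) * r ^ d"
    "real i * rel_entropy p y1 + real j * rel_entropy p y2 < real (i + j) * rel_entropy p r"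
    by (rule exists_integer_weights[OF y(3,4) ent])
  define K where "K = i + j"
  define u where "u x = (if x < i then y1 else y2)" for x :: nat
  have sumu: "(\<Sum>x<K. f (u x)) = real i * f y1 + real j * f y2" for f :: "real \<Rightarrow> real"
  proof -
    have "(\<Sum>x<K. f (u x)) = (\<Sum>x\<in>{..<i}. f (u x)) + (\<Sum>x\<in>{i..<K}. f (u x))"
      by (subst sum.union_disjoint[symmetric]) (auto simp: K_def intro!: sum.cong)
    also have "\<dots> = real i * f y1 + real j * f y2" by (simp add: u_def K_def)
    finally show ?thesis .
  qed
  have u01: "u x \<in> {0..1}" for x using y by (simp add: u_def)
  have u0: "u x \<ge> 0" for x using u01[of x] by simp
  have big: "(\<Sum>x<K. u x ^ d) > real K * r ^ d" using sumu[of "\<lambda>z. z ^ d"] ij by (simp add: K_def)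
  have small: "(\<Sum>x<K. rel_entropy p (u x)) < real K * rel_entropy p r"
    using sumu[of "rel_entropy p"] ij by (simp add: K_def)
  have "\<forall>\<^sub>F N in sequentially. weighted_density H N (star_pattern K u r) > r ^ card (edges H) \<and> K < N"
    by (intro eventually_conj weighted_density_star_pattern[OF H reg V u0 r(1) big] eventually_gt_at_top)
  then obtain N where N: "weighted_density H N (star_pattern K u r) > r ^ card (edges H)" "K < N"
    using eventually_happens[of _ sequentially] by auto
  define J where "J = step_entropy p N (star_pattern K u r)"
  have J: "J < rel_entropy p r" unfolding J_def by (rule step_entropy_star_pattern[OF N(2) small])
  \<comment> \<open>Half of the saving pays for the slack in \<open>tail_prob_lower\<close>.\<close>
  define c where "c = (rel_entropy p r - J) / 2"
  have c: "c > 0" "J + c = rel_entropy p r - c" using J by (auto simp: c_def field_simps)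
  have "star_pattern K u r e \<in> {0..1}" for e using u01 r by (simp add: star_pattern_def)
  then have "\<forall>\<^sub>F m in sequentially. tail_prob p H (r ^ card (edges H)) m > 0 \<and>
    - ln (tail_prob p H (r ^ card (edges H)) m) \<le> real (m choose 2) * (J + c)"
    unfolding J_def using N c(1) by (intro tail_prob_lower[OF p H]) auto
  then show ?thesis unfolding c(2) using c(1) by blast
qed

section \<open>Graphs near a constant\<close>

text \<open>No \<open>s\<close> is close both to 1, the value on an edge, and to 0, the value on the
  diagonal. This disposes of the finitely many small \<open>n\<close> in the statement for all
  \<open>n\<close>.\<close>

lemma inf_cut_dist_ge:
  assumes n: "n > 0" and X: "X \<subseteq> all_edges {..<n}" "X \<noteq> {}"
  shows "(INF s\<in>{0..1}. cut_dist_const ({..<n}, X) s) \<ge> 1 / (2 * (real n)\<^sup>2)"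
proof (rule cINF_greatest)
  fix s :: real assume s: "s \<in> {0..1}"
  obtain e where "e \<in> X" using X by blast
  then obtain a b where ab: "{a, b} \<in> X" "a < n" "b < n"
    using X by (force simp: all_edges_def card_2_iff)
  have "{a} \<notin> X" using X by (auto simp: all_edges_def)
  then have "\<bar>1 - s\<bar> \<le> cut_dist_const ({..<n}, X) s * (real n)\<^sup>2" "\<bar>0 - s\<bar> \<le> cut_dist_const ({..<n}, X) s * (real n)\<^sup>2"
    using cut_dist_const_ge[OF n, of "{a}" "{b}" X s] cut_dist_const_ge[OF n, of "{a}" "{a}" X s] ab by auto
  then have "1 / 2 \<le> cut_dist_const ({..<n}, X) s * (real n)\<^sup>2" using s by auto
  then show "1 / (2 * (real n)\<^sup>2) \<le> cut_dist_const ({..<n}, X) s" using n by (simp add: field_simps)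
qed auto

text \<open>Cut closeness to a constant \<open>s\<close> makes the density of \<open>H\<close>
  nearly \<open>s ^ m\<close> and the edge density nearly \<open>s\<close>. The first being at least
  \<open>r ^ m\<close> pushes \<open>s\<close>, and with it the second, almost up to
  \<open>r\<close>.\<close>

lemma near_constant_imp_dense:
  assumes H: "finite_simple_graph H" and r1: "0 < r1" "r1 < r" and e: "card (edges H) > 0"
  shows "\<exists>\<epsilon>>0. \<forall>n>0. \<forall>X\<subseteq>all_edges {..<n}.
     \<not> \<epsilon> < (INF s\<in>{0..1}. cut_dist_const ({..<n}, X) s) \<longrightarrow>
     r ^ card (edges H) \<le> weighted_density H n (\<lambda>e. of_bool (e \<in> X)) \<longrightarrow>
     r1 * real (n choose 2) \<le> (\<Sum>e\<in>all_edges {..<n}. of_bool (e \<in> X))"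
proof -
  define m where "m = card (edges H)"
  have "((\<lambda>\<epsilon>. (r ^ m - real m * (2 * \<epsilon>)) - (r1 + 2 * \<epsilon>) ^ m) \<longlongrightarrow>
      (r ^ m - real m * (2 * 0)) - (r1 + 2 * 0) ^ m) (at_right 0)"
    by (intro tendsto_intros)
  moreover have "r1 ^ m < r ^ m" using r1 e by (intro power_strict_mono) (auto simp: m_def)
  ultimately have "\<forall>\<^sub>F \<epsilon> in at_right 0. (r ^ m - real m * (2 * \<epsilon>)) - (r1 + 2 * \<epsilon>) ^ m > 0"
    by (intro order_tendstoD(1)) auto
  moreover have "\<forall>\<^sub>F \<epsilon> in at_right (0::real). \<epsilon> \<in> {0<..<1}" by (intro eventually_at_right_real) auto
  ultimately have "\<forall>\<^sub>F \<epsilon> in at_right 0. (r ^ m - real m * (2 * \<epsilon>)) - (r1 + 2 * \<epsilon>) ^ m > 0 \<and> \<epsilon> \<in> {0<..<1}"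
    by (rule eventually_conj)
  then obtain \<epsilon> where \<epsilon>: "(r1 + 2 * \<epsilon>) ^ m < r ^ m - real m * (2 * \<epsilon>)" "\<epsilon> > 0"
    using eventually_happens[of _ "at_right (0::real)"] by (auto simp: trivial_limit_at_right_real)
  show ?thesis
  proof (intro exI[of _ \<epsilon>] conjI allI impI \<epsilon>(2))
    fix n :: nat and X
    assume n: "n > 0" and X: "X \<subseteq> all_edges {..<n}"
      and inf: "\<not> \<epsilon> < (INF s\<in>{0..1}. cut_dist_const ({..<n}, X) s)"
      and t: "r ^ card (edges H) \<le> weighted_density H n (\<lambda>e. of_bool (e \<in> X))"
    \<comment> \<open>Doubling \<open>\<epsilon>\<close> yields an actual \<open>s\<close> from a
      bound on the infimum.\<close>
    have "(INF s\<in>{0..1}. cut_dist_const ({..<n}, X) s) < 2 * \<epsilon>" using inf \<epsilon> by simp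
    moreover have "bdd_below ((\<lambda>s. cut_dist_const ({..<n}, X) s) ` {0..1})"
      using cut_dist_const_nonneg[OF n] by (intro bdd_belowI[of _ 0]) auto
    ultimately obtain s where s: "s \<in> {0..1}" "cut_dist_const ({..<n}, X) s < 2 * \<epsilon>"
      by (subst (asm) cINF_less_iff) auto
    have cut: "\<bar>\<Sum>a\<in>A. \<Sum>b\<in>B. of_bool ({a, b} \<in> X) - s\<bar> \<le> 2 * \<epsilon> * (real n)\<^sup>2"
      if "A \<subseteq> {..<n}" "B \<subseteq> {..<n}" for A B
    proof -
      have "\<bar>\<Sum>a\<in>A. \<Sum>b\<in>B. of_bool ({a, b} \<in> X) - s\<bar> \<le> cut_dist_const ({..<n}, X) s * (real n)\<^sup>2"
        by (rule cut_dist_const_ge[OF n that])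
      also have "\<dots> \<le> 2 * \<epsilon> * (real n)\<^sup>2" using s by (intro mult_right_mono) auto
      finally show ?thesis .
    qed
    have "\<bar>weighted_density H n (\<lambda>e. of_bool (e \<in> X)) - weighted_density H n (\<lambda>_. s)\<bar> \<le> real m * (2 * \<epsilon>)"
      unfolding m_def using s cut by (intro counting_lemma[OF H n]) auto
    moreover have "weighted_density H n (\<lambda>_. s) = s ^ m"
      using H n by (simp add: weighted_density_const finite_simple_graph_def m_def)
    ultimately have "(r1 + 2 * \<epsilon>) ^ m < s ^ m" using t \<epsilon> by (simp add: m_def)
    then have s2: "r1 + 2 * \<epsilon> < s" by (rule power_less_imp_less_base) (use s in auto)
    have "(\<Sum>x<n. \<Sum>y<n. of_bool ({x, y} \<in> X) :: real) = 2 * (\<Sum>e\<in>all_edges {..<n}. of_bool (e \<in> X))"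
      by (rule double_sum_off_diagonal[where f = "\<lambda>e. of_bool (e \<in> X)"]) (use X in \<open>auto simp: all_edges_def\<close>)
    moreover have "(\<Sum>x<n. \<Sum>y<n. of_bool ({x, y} \<in> X) - s) = (\<Sum>x<n. \<Sum>y<n. of_bool ({x, y} \<in> X)) - s * (real n)\<^sup>2"
      by (simp add: sum_subtractf power2_eq_square)
    moreover have "(\<Sum>x<n. \<Sum>y<n. of_bool ({x, y} \<in> X) - s) \<ge> - (2 * \<epsilon> * (real n)\<^sup>2)"
      using abs_le_D2[OF cut[OF order_refl order_refl]] by simp
    ultimately have "2 * (\<Sum>e\<in>all_edges {..<n}. of_bool (e \<in> X)) \<ge> (s - 2 * \<epsilon>) * (real n)\<^sup>2"
      by (simp add: algebra_simps)
    moreover have "(s - 2 * \<epsilon>) * (real n)\<^sup>2 \<ge> r1 * (real n)\<^sup>2" using s2 by (intro mult_right_mono) auto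
    moreover have "r1 * (real n)\<^sup>2 \<ge> r1 * (2 * real (n choose 2))"
      using choose_2_le[of n] r1 by (intro mult_left_mono) auto
    ultimately show "r1 * real (n choose 2) \<le> (\<Sum>e\<in>all_edges {..<n}. of_bool (e \<in> X))" by simp
  qed
qed

text \<open>The number of edges is linear in the edge set, so its lower bound passes to the
  conditional mean, and Jensen's inequality for \<open>r1 \<ge> p\<close> finishes.\<close>

lemma dense_graphs_upper:
  assumes p: "0 < p" "p \<le> r1" "r1 < 1" and S: "S \<subseteq> Pow (all_edges {..<n})"
    and dense: "\<And>X. X \<in> S \<Longrightarrow> r1 * real (n choose 2) \<le> (\<Sum>e\<in>all_edges {..<n}. of_bool (e \<in> X))"
  shows "(\<Sum>X\<in>S. bern (all_edges {..<n}) (\<lambda>_. p) X) \<le> exp (- real (n choose 2) * rel_entropy p r1)"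
proof (cases "S = {}")
  case False
  define E where "E = all_edges {..<n}"
  define P where "P = bern E (\<lambda>_. p)"
  define Z where "Z = (\<Sum>X\<in>S. P X)"
  define w where "w e = (\<Sum>X\<in>S. of_bool (e \<in> X) * P X) / Z" for e
  have p1: "p < 1" using p by simp
  have P0: "P X > 0" for X unfolding P_def by (rule bern_pos[OF p(1) p1])
  have fE: "finite E" unfolding E_def by (rule finite_all_edges)
  have SE: "S \<subseteq> Pow E" using S by (simp add: E_def)
  note ceb = conditional_entropy_bound[OF fE p(1) p1 SE False Z_def[unfolded P_def] w_def[unfolded P_def]]
  have Z0: "Z > 0" by (rule ceb(2))
  have "(\<Sum>e\<in>E. w e) = (\<Sum>X\<in>S. P X * (\<Sum>e\<in>E. of_bool (e \<in> X))) / Z"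
    unfolding w_def sum_divide_distrib[symmetric]
    by (subst sum.swap) (simp add: sum_distrib_left mult.commute)
  also have "\<dots> \<ge> (\<Sum>X\<in>S. P X * (r1 * real (n choose 2))) / Z"
    using dense P0 Z0 unfolding E_def
    by (intro divide_right_mono sum_mono mult_left_mono) (auto intro: less_imp_le)
  also have "(\<Sum>X\<in>S. P X * (r1 * real (n choose 2))) / Z = r1 * real (card E)"
    using Z0 by (simp add: E_def card_all_edges Z_def flip: sum_distrib_right)
  finally have "(\<Sum>e\<in>E. rel_entropy p (w e)) \<ge> real (card E) * rel_entropy p r1"
    using ceb(3) by (intro rel_entropy_sum_ge p) auto
  then have "ln Z \<le> - real (n choose 2) * rel_entropy p r1"
    using ceb(1) by (simp add: E_def card_all_edges)
  then have "Z \<le> exp (- real (n choose 2) * rel_entropy p r1)" using Z0 by (metis exp_le_cancel_iff exp_ln)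
  then show ?thesis by (simp only: Z_def P_def E_def)
qed simp

section \<open>The two cases and the final statement\<close>

lemma replica_symmetric_case:
  fixes p r :: real and H :: "'a graph"
  assumes p: "0 < p" "p \<le> r" "r < 1" and d: "d \<ge> 2"
    and H: "finite_simple_graph H" and reg: "regular d H" and e: "card (edges H) > 0"
    and supp: "\<exists>s. \<forall>y\<in>{0..1}. rel_entropy p r + s * (y ^ d - r ^ d) \<le> rel_entropy p y"
  shows "(\<lambda>n. 1 / real (n choose 2) * ln (tail_prob p H (r ^ card (edges H)) n)) \<longlonglongrightarrow> - rel_entropy p r"
    and "\<epsilon> > 0 \<Longrightarrow> \<exists>C>0. \<forall>\<^sub>F n in sequentially.
       \<P>(G in measure_pmf (random_graph n p). cut_dist_const G r < \<epsilon> \<bar> hom_density H G \<ge> r ^ card (edges H))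
         \<ge> 1 - exp (- C * (real n)\<^sup>2)"
proof -
  define P where "P n = tail_prob p H (r ^ card (edges H)) n" for n
  define h where "h = rel_entropy p r"
  have p1: "p < 1" using p by simp
  from supp obtain s0 where s0: "\<forall>y\<in>{0..1}. rel_entropy p r + s0 * (y ^ d - r ^ d) \<le> rel_entropy p y" ..
  have "d > 0" using d by simp
  from support_slope_nonneg[OF p this s0] obtain s where s: "s \<ge> 0"
    and "\<forall>y\<in>{0..1}. rel_entropy p r + s * (y ^ d - r ^ d) \<le> rel_entropy p y"
    by (elim exE conjE)
  note supp' = this(2)[rule_format]
  have lower: "\<forall>\<^sub>F n in sequentially. P n > 0 \<and> - ln (P n) \<le> real (n choose 2) * (h + \<eta>)" if "\<eta> > 0" for \<eta>
    unfolding P_def h_def by (rule tail_prob_constant_lower[OF p H e that])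
  have upper: "\<forall>\<^sub>F n in sequentially. P n > 0 \<longrightarrow> ln (P n) \<le> - real (n choose 2) * (h - \<eta>)" if "\<eta> > 0" for \<eta>
    unfolding P_def h_def using d by (intro tail_prob_symmetric_upper[OF p H reg _ e that s supp']) auto
  show "(\<lambda>n. 1 / real (n choose 2) * ln (tail_prob p H (r ^ card (edges H)) n)) \<longlonglongrightarrow> - rel_entropy p r"
    unfolding P_def[symmetric] h_def[symmetric]
  proof (rule tendstoI)
    fix \<eta> :: real assume "\<eta> > 0"
    then have "\<eta> / 2 > 0" by simp
    from lower[OF this] upper[OF this] eventually_ge_at_top[of 2]
    show "\<forall>\<^sub>F n in sequentially. dist (1 / real (n choose 2) * ln (P n)) (- h) < \<eta>"
    proof eventually_elim
      case (elim n)
      define C where "C = real (n choose 2)"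
      have "(real n)\<^sup>2 / 4 > 0" using elim(3) by simp
      then have C: "C > 0" using choose_2_ge[OF elim(3)] unfolding C_def by linarith
      have "- C * (h + \<eta> / 2) \<le> ln (P n)" "ln (P n) \<le> - C * (h - \<eta> / 2)" using elim by (auto simp: C_def)
      then have "- (h + \<eta> / 2) * C \<le> ln (P n)" "ln (P n) \<le> - (h - \<eta> / 2) * C"
        by (simp_all add: algebra_simps)
      then have "- (h + \<eta> / 2) \<le> ln (P n) / C" "ln (P n) / C \<le> - (h - \<eta> / 2)"
        unfolding pos_le_divide_eq[OF C] pos_divide_le_eq[OF C] .
      then have "\<bar>ln (P n) / C + h\<bar> \<le> \<eta> / 2" by (intro abs_leI) linarith+
      then show ?case using \<open>\<eta> > 0\<close> by (simp add: dist_real_def C_def)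
    qed
  qed
  show "\<exists>C>0. \<forall>\<^sub>F n in sequentially.
       \<P>(G in measure_pmf (random_graph n p). cut_dist_const G r < \<epsilon> \<bar> hom_density H G \<ge> r ^ card (edges H))
         \<ge> 1 - exp (- C * (real n)\<^sup>2)" if \<epsilon>: "\<epsilon> > 0"
  proof -
    obtain a where a: "a > 0" and far: "\<forall>\<^sub>F n in sequentially.
     (\<Sum>X\<in>{X \<in> Pow (all_edges {..<n}). \<not> cut_dist_const ({..<n}, X) r < \<epsilon> \<and>
          r ^ card (edges H) \<le> weighted_density H n (\<lambda>e. of_bool (e \<in> X))}. bern (all_edges {..<n}) (\<lambda>_. p) X)
      \<le> exp (- real (n choose 2) * (h + a))"
      using cut_far_upper[OF p H reg d e \<epsilon> supp'] unfolding h_def by blast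
    show ?thesis
    \<comment> \<open>The far event has exponent \<open>h + a\<close> and the whole event at most
      \<open>h + a / 2\<close>; the ratio leaves \<open>a / 2\<close> per edge, and
      \<open>n choose 2\<close> is at least \<open>n\<^sup>2 / 4\<close>.\<close>
    proof (intro exI[of _ "a / 8"] conjI)
      show "a / 8 > 0" using a by simp
      have "a / 2 > 0" using a by simp
      from lower[OF this] far eventually_ge_at_top[of 2]
      show "\<forall>\<^sub>F n in sequentially.
         \<P>(G in measure_pmf (random_graph n p). cut_dist_const G r < \<epsilon> \<bar> hom_density H G \<ge> r ^ card (edges H))
         \<ge> 1 - exp (- (a / 8) * (real n)\<^sup>2)"
      proof eventually_elim
        case (elim n)
        let ?M = "measure_pmf (random_graph n p)"
        have ev: "measure ?M {G. hom_density H G \<ge> r ^ card (edges H)} = P n"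
          unfolding P_def by (rule prob_density_event[OF p(1) p1 H])
        have far_eq: "measure ?M {G. \<not> cut_dist_const G r < \<epsilon> \<and> hom_density H G \<ge> r ^ card (edges H)}
            = (\<Sum>X\<in>{X \<in> Pow (all_edges {..<n}). \<not> cut_dist_const ({..<n}, X) r < \<epsilon> \<and>
          r ^ card (edges H) \<le> weighted_density H n (\<lambda>e. of_bool (e \<in> X))}. bern (all_edges {..<n}) (\<lambda>_. p) X)"
          unfolding prob_random_graph[OF p(1) p1, where Q = "\<lambda>G. \<not> cut_dist_const G r < \<epsilon> \<and> hom_density H G \<ge> r ^ card (edges H)"]
            hom_density_eq[OF H] ..
        have "exp (- real (n choose 2) * (h + a / 2)) \<le> P n"
        proof -
          have "- real (n choose 2) * (h + a / 2) \<le> ln (P n)" using elim(1) by simp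
          then have "exp (- real (n choose 2) * (h + a / 2)) \<le> exp (ln (P n))" by simp
          then show ?thesis using elim(1) by simp
        qed
        then have "exp (- real (n choose 2) * (a / 2)) * exp (- real (n choose 2) * (h + a / 2))
            \<le> exp (- real (n choose 2) * (a / 2)) * P n"
          by (intro mult_left_mono) auto
        moreover have "exp (- real (n choose 2) * (a / 2)) * exp (- real (n choose 2) * (h + a / 2))
           = exp (- real (n choose 2) * (h + a))"
          by (simp add: field_simps flip: exp_add)
        ultimately have "measure ?M {G. \<not> cut_dist_const G r < \<epsilon> \<and> hom_density H G \<ge> r ^ card (edges H)}
            \<le> exp (- real (n choose 2) * (a / 2)) * measure ?M {G. hom_density H G \<ge> r ^ card (edges H)}"
          using elim(2) unfolding ev far_eq by linarith
        then have "\<P>(G in ?M. cut_dist_const G r < \<epsilon> \<bar> hom_density H G \<ge> r ^ card (edges H))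
            \<ge> 1 - exp (- real (n choose 2) * (a / 2))"
          using elim(1) ev by (intro cond_prob_pmf_ge) auto
        moreover have "exp (- real (n choose 2) * (a / 2)) \<le> exp (- (a / 8) * (real n)\<^sup>2)"
          using mult_right_mono[OF choose_2_ge[OF elim(3)], of "a / 2"] a by simp
        ultimately show ?case by linarith
      qed
    qed
  qed
qed

text \<open>Both claims rest on the saving \<open>c\<close> in the rate. Near-constant graphs in the
  event have edge density at least \<open>r1\<close>, which costs more than \<open>h - c / 2\<close>
  per edge, while the event costs at most \<open>h - c\<close>.\<close>

lemma symmetry_breaking_case:
  fixes p r :: real and H :: "'a graph"
  assumes p: "0 < p" "p \<le> r" "r < 1" and d: "d > 0"
    and H: "finite_simple_graph H" and reg: "regular d H" and e: "card (edges H) > 0" and V: "verts H \<noteq> {}"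
    and ns: "\<nexists>s. \<forall>y\<in>{0..1}. rel_entropy p r + s * (y ^ d - r ^ d) \<le> rel_entropy p y"
  shows "\<exists>L. ((\<lambda>n. 1 / real (n choose 2) * ln (tail_prob p H (r ^ card (edges H)) n)) \<longlonglongrightarrow> L) \<and> L > - rel_entropy p r"
    and "\<exists>\<epsilon>>0. \<exists>C>0. \<forall>n. \<P>(G in measure_pmf (random_graph n p). hom_density H G \<ge> r ^ card (edges H)) > 0 \<longrightarrow>
       \<P>(G in measure_pmf (random_graph n p). (INF s\<in>{0..1}. cut_dist_const G s) > \<epsilon> \<bar> hom_density H G \<ge> r ^ card (edges H))
         \<ge> 1 - exp (- C * (real n)\<^sup>2)"
proof -
  define \<tau> where "\<tau> = r ^ card (edges H)"
  define P where "P n = tail_prob p H \<tau> n" for n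
  define h where "h = rel_entropy p r"
  have p1: "p < 1" and r0: "0 < r" using p by auto
  have \<tau>: "0 < \<tau>" "\<tau> < 1" using r0 p e by (auto simp: \<tau>_def power_less_one_iff)
  obtain c where c: "c > 0" and lower: "\<forall>\<^sub>F n in sequentially. P n > 0 \<and> - ln (P n) \<le> real (n choose 2) * (h - c)"
    using tail_prob_asymmetric_lower[OF p(1) p1 r0 p(3) d H reg V ns] unfolding P_def h_def \<tau>_def by blast
  define x where "x n = - ln (P n) / real (n choose 2)" for n
  have "\<exists>L. x \<longlonglongrightarrow> L"
  proof (rule convergent_if_almost_decreasing)
    fix n
    have "ln (P n) \<le> 0"
      using tail_prob_le_1[OF p(1) p1, of H \<tau> n] by (cases "P n = 0") (auto simp: P_def ln_le_zero_iff)
    then show "x n \<ge> 0" unfolding x_def by (intro divide_nonneg_nonneg) auto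
  next
    fix \<eta> :: real assume "\<eta> > 0"
    moreover have "\<forall>\<^sub>F n in sequentially. tail_prob p H \<tau> n > 0"
      using lower unfolding P_def by (auto elim: eventually_mono)
    ultimately show "\<forall>\<^sub>F n in sequentially. \<forall>\<^sub>F m in sequentially. x m \<le> x n + \<eta>"
      unfolding x_def P_def by (intro tail_prob_almost_decreasing[OF p(1) p1 \<tau>(2) H])
  qed
  then obtain L where L: "x \<longlonglongrightarrow> L" by blast
  have "L \<le> h - c"
  proof (rule tendsto_upperbound[OF L])
    show "\<forall>\<^sub>F n in sequentially. x n \<le> h - c"
      using lower eventually_ge_at_top[of 2]
    proof eventually_elim
      case (elim n)
      have "(real n)\<^sup>2 / 4 > 0" using elim by simp
      then have C: "real (n choose 2) > 0" using choose_2_ge[OF elim(2)] by linarith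
      show ?case using elim unfolding x_def pos_divide_le_eq[OF C] by (simp add: mult.commute)
    qed
  qed auto
  moreover have "(\<lambda>n. 1 / real (n choose 2) * ln (P n)) \<longlonglongrightarrow> - L"
    using tendsto_minus[OF L] by (simp add: x_def)
  ultimately show "\<exists>L. ((\<lambda>n. 1 / real (n choose 2) * ln (tail_prob p H (r ^ card (edges H)) n)) \<longlonglongrightarrow> L) \<and> L > - rel_entropy p r"
    using c unfolding P_def h_def \<tau>_def by (intro exI[of _ "- L"]) auto
  \<comment> \<open>For \<open>p = r\<close> the zero slope would support; strictness leaves room
    for \<open>r1\<close> between \<open>p\<close> and \<open>r\<close>.\<close>
  have "p \<noteq> r"
  proof
    assume "p = r"
    then have "\<forall>y\<in>{0..1}. rel_entropy p r + 0 * (y ^ d - r ^ d) \<le> rel_entropy p y"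
      using rel_entropy_nonneg[OF p(1) p1] by auto
    then show False using ns by blast
  qed
  then have pr: "p < r" using p by simp
  obtain r1 where r1: "p \<le> r1" "r1 < r" "rel_entropy p r1 > h - c / 2"
  proof -
    have "isCont (rel_entropy p) r"
      using DERIV_rel_entropy[OF p(1) p1 r0 p(3)] by (rule DERIV_isCont)
    then have "((\<lambda>x. rel_entropy p x) \<longlongrightarrow> h) (at_left r)"
      unfolding h_def by (auto simp: isCont_def intro: filterlim_mono at_le)
    then have "\<forall>\<^sub>F x in at_left r. rel_entropy p x > h - c / 2"
      by (rule order_tendstoD) (use c in simp)
    moreover have "\<forall>\<^sub>F x in at_left r. x \<in> {p<..<r}" using pr by (intro eventually_at_left_real)
    ultimately have "\<forall>\<^sub>F x in at_left r. rel_entropy p x > h - c / 2 \<and> x \<in> {p<..<r}" by (rule eventually_conj)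
    then obtain x where "rel_entropy p x > h - c / 2" "p < x" "x < r"
      using eventually_happens[of _ "at_left r"] by (auto simp: trivial_limit_at_left_real)
    then show ?thesis by (intro that[of x]) auto
  qed
  have r10: "0 < r1" "r1 < 1" using r1 p by auto
  obtain \<epsilon>0 where \<epsilon>0: "\<epsilon>0 > 0" and dense0: "\<forall>n>0. \<forall>X\<subseteq>all_edges {..<n}.
     \<not> \<epsilon>0 < (INF s\<in>{0..1}. cut_dist_const ({..<n}, X) s) \<longrightarrow>
     \<tau> \<le> weighted_density H n (\<lambda>e. of_bool (e \<in> X)) \<longrightarrow>
     r1 * real (n choose 2) \<le> (\<Sum>e\<in>all_edges {..<n}. of_bool (e \<in> X))"
    using near_constant_imp_dense[OF H r10(1) r1(2) e] unfolding \<tau>_def by (elim exE conjE)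
  obtain N where N: "\<And>n. n \<ge> N \<Longrightarrow> P n > 0 \<and> - ln (P n) \<le> real (n choose 2) * (h - c)"
    using lower unfolding eventually_sequentially by blast
  define N' where "N' = max N 2"
  \<comment> \<open>The second bound lies below \<open>1 / (2 * (real n)\<^sup>2)\<close> for all
    \<open>n < N'\<close>; there \<open>inf_cut_dist_ge\<close> makes the bad event empty.\<close>
  define \<epsilon> where "\<epsilon> = min \<epsilon>0 (1 / (4 * (real N')\<^sup>2))"
  have N': "N' > 0" by (simp add: N'_def)
  have \<epsilon>: "\<epsilon> > 0" using \<epsilon>0 N' by (simp add: \<epsilon>_def)
  show "\<exists>\<epsilon>>0. \<exists>C>0. \<forall>n. \<P>(G in measure_pmf (random_graph n p). hom_density H G \<ge> r ^ card (edges H)) > 0 \<longrightarrow>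
       \<P>(G in measure_pmf (random_graph n p). (INF s\<in>{0..1}. cut_dist_const G s) > \<epsilon> \<bar> hom_density H G \<ge> r ^ card (edges H))
         \<ge> 1 - exp (- C * (real n)\<^sup>2)"
    unfolding \<tau>_def[symmetric]
  proof (rule exI[of _ \<epsilon>], rule conjI[OF \<epsilon>], rule exI[of _ "c / 8"], intro conjI allI impI)
    show "c / 8 > 0" using c by simp
    fix n
    let ?M = "measure_pmf (random_graph n p)"
    assume "\<P>(G in ?M. hom_density H G \<ge> \<tau>) > 0"
    then have pos: "measure ?M {G. hom_density H G \<ge> \<tau>} > 0" by simp
    have ev: "measure ?M {G. hom_density H G \<ge> \<tau>} = P n"
      unfolding P_def by (rule prob_density_event[OF p(1) p1 H])
    \<comment> \<open>On no vertices the density is a quotient by 0, hence 0 and below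
      \<open>\<tau>\<close>, so the event would be null.\<close>
    have n: "n > 0"
    proof (rule ccontr)
      assume "\<not> n > 0"
      then have "n = 0" by simp
      have "card (verts H) > 0" using V H by (simp add: finite_simple_graph_def card_gt_0_iff)
      then have "weighted_density H n w = 0" for w using \<open>n = 0\<close> by (simp add: weighted_density_def)
      then have "P n = 0" using \<tau> by (simp add: P_def tail_prob_def)
      then show False using pos ev by simp
    qed
    define S where "S = {X \<in> Pow (all_edges {..<n}). \<not> \<epsilon> < (INF s\<in>{0..1}. cut_dist_const ({..<n}, X) s) \<and>
      \<tau> \<le> weighted_density H n (\<lambda>e. of_bool (e \<in> X))}"
    have bad: "measure ?M {G. \<not> \<epsilon> < (INF s\<in>{0..1}. cut_dist_const G s) \<and> hom_density H G \<ge> \<tau>}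
        = (\<Sum>X\<in>S. bern (all_edges {..<n}) (\<lambda>_. p) X)"
      unfolding prob_random_graph[OF p(1) p1, where Q = "\<lambda>G. \<not> \<epsilon> < (INF s\<in>{0..1}. cut_dist_const G s) \<and> hom_density H G \<ge> \<tau>"]
        hom_density_eq[OF H] S_def ..
    have "measure ?M {G. \<not> \<epsilon> < (INF s\<in>{0..1}. cut_dist_const G s) \<and> hom_density H G \<ge> \<tau>}
        \<le> exp (- (c / 8) * (real n)\<^sup>2) * measure ?M {G. hom_density H G \<ge> \<tau>}"
    proof (cases "n \<ge> N'")
      case True
      then have n2: "n \<ge> 2" "n \<ge> N" by (auto simp: N'_def)
      have "(\<Sum>X\<in>S. bern (all_edges {..<n}) (\<lambda>_. p) X) \<le> exp (- real (n choose 2) * rel_entropy p r1)"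
      proof (rule dense_graphs_upper[OF p(1) r1(1) r10(2)])
        show "S \<subseteq> Pow (all_edges {..<n})" by (auto simp: S_def)
        fix X assume X: "X \<in> S"
        then have "\<not> \<epsilon> < (INF s\<in>{0..1}. cut_dist_const ({..<n}, X) s)" by (simp add: S_def)
        moreover have "\<epsilon> \<le> \<epsilon>0" by (simp add: \<epsilon>_def)
        ultimately have "\<not> \<epsilon>0 < (INF s\<in>{0..1}. cut_dist_const ({..<n}, X) s)" by linarith
        then show "r1 * real (n choose 2) \<le> (\<Sum>e\<in>all_edges {..<n}. of_bool (e \<in> X))"
          using dense0[rule_format, OF n] X unfolding S_def by blast
      qed
      also have "\<dots> \<le> exp (- real (n choose 2) * (c / 2) + - real (n choose 2) * (h - c))"
      proof -
        have "real (n choose 2) * (h - c / 2) \<le> real (n choose 2) * rel_entropy p r1"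
          using r1 by (intro mult_left_mono) auto
        then show ?thesis by (simp add: field_simps)
      qed
      also have "\<dots> = exp (- real (n choose 2) * (c / 2)) * exp (- real (n choose 2) * (h - c))" by (rule exp_add)
      also have "\<dots> \<le> exp (- (c / 8) * (real n)\<^sup>2) * P n"
      proof (rule mult_mono)
        show "exp (- real (n choose 2) * (c / 2)) \<le> exp (- (c / 8) * (real n)\<^sup>2)"
          using mult_right_mono[OF choose_2_ge[OF n2(1)], of "c / 2"] c by simp
        have "- real (n choose 2) * (h - c) \<le> ln (P n)" using N[OF n2(2)] by simp
        then have "exp (- real (n choose 2) * (h - c)) \<le> exp (ln (P n))" by simp
        then show "exp (- real (n choose 2) * (h - c)) \<le> P n" using N[OF n2(2)] by simp
      qed auto
      finally show ?thesis unfolding bad ev .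
    next
      case False
      have "S = {}"
      proof (rule ccontr)
        assume "S \<noteq> {}"
        then obtain X where X: "X \<in> S" by blast
        have "X \<noteq> {}"
        proof
          assume "X = {}"
          obtain e where "e \<in> edges H" using e by (metis card_gt_0_iff ex_in_conv)
          moreover have "finite (edges H)" using H by (rule finite_edges)
          ultimately have "weighted_density H n (\<lambda>e. of_bool (e \<in> X)) = 0"
            unfolding weighted_density_def hom_sum_def \<open>X = {}\<close> by (auto intro!: sum.neutral prod_zero)
          then show False using X \<tau> by (simp add: S_def)
        qed
        then have "1 / (2 * (real n)\<^sup>2) \<le> (INF s\<in>{0..1}. cut_dist_const ({..<n}, X) s)"
          using X by (intro inf_cut_dist_ge n) (auto simp: S_def)
        also have "\<dots> \<le> 1 / (4 * (real N')\<^sup>2)" using X by (simp add: S_def \<epsilon>_def not_less)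
        finally have "2 * (real N')\<^sup>2 \<le> (real n)\<^sup>2" using n N' by (simp add: field_simps)
        moreover have "(real n)\<^sup>2 \<le> (real N')\<^sup>2" using False by (intro power_mono) auto
        moreover have "(real N')\<^sup>2 > 0" using N' by simp
        ultimately show False by linarith
      qed
      then show ?thesis unfolding bad by simp
    qed
    then show "\<P>(G in ?M. \<epsilon> < (INF s\<in>{0..1}. cut_dist_const G s) \<bar> hom_density H G \<ge> \<tau>)
         \<ge> 1 - exp (- (c / 8) * (real n)\<^sup>2)"
      by (rule cond_prob_pmf_ge[OF pos])
  qed
qed

text \<open>In the first case the bound is asserted for large \<open>n\<close>: a single vertex
  paired with itself shows that the cut distance to \<open>r\<close> is at least
  \<open>r / n\<^sup>2\<close>, so for small \<open>n\<close> and small \<open>\<epsilon>\<close> no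
  graph is close. In the second case positivity of the event is a premise because a conditional
  probability on a null event evaluates to 0.\<close>

theorem theorem1p1:
  fixes p r :: real and d :: nat and H :: "'a graph"
  assumes "0 < p" and "p \<le> r" and "r < 1"
    and "d \<ge> 2"
    and "finite_simple_graph H" and "verts H \<noteq> {}" and "regular d H"
  shows
    "(on_convex_minorant (\<lambda>x. rel_entropy p (x powr (1 / real d))) (r ^ d, rel_entropy p r) \<longrightarrow>
        ((\<lambda>n. 1 / real (n choose 2) *
              ln \<P>(G in measure_pmf (random_graph n p). hom_density H G \<ge> r ^ card (edges H)))
           \<longlonglongrightarrow> - rel_entropy p r)
        \<and> (\<forall>\<epsilon>>0. \<exists>C>0. \<forall>\<^sub>F n in sequentially.
              \<P>(G in measure_pmf (random_graph n p). cut_dist_const G r < \<epsilon>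
                 \<bar> hom_density H G \<ge> r ^ card (edges H))
              \<ge> 1 - exp (- C * (real n)\<^sup>2)))
   \<and> (\<not> on_convex_minorant (\<lambda>x. rel_entropy p (x powr (1 / real d))) (r ^ d, rel_entropy p r) \<longrightarrow>
        (\<exists>L. ((\<lambda>n. 1 / real (n choose 2) *
              ln \<P>(G in measure_pmf (random_graph n p). hom_density H G \<ge> r ^ card (edges H)))
           \<longlonglongrightarrow> L) \<and> L > - rel_entropy p r)
        \<and> (\<exists>\<epsilon>>0. \<exists>C>0. \<forall>n.
              \<P>(G in measure_pmf (random_graph n p). hom_density H G \<ge> r ^ card (edges H)) > 0 \<longrightarrow>
              \<P>(G in measure_pmf (random_graph n p). (INF s\<in>{0..1}. cut_dist_const G s) > \<epsilon>
                 \<bar> hom_density H G \<ge> r ^ card (edges H))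
              \<ge> 1 - exp (- C * (real n)\<^sup>2)))
   \<and> (d = 2 \<longrightarrow>
        (\<not> on_convex_minorant (\<lambda>x. rel_entropy p (x powr (1 / real d))) (r ^ d, rel_entropy p r)
         \<longleftrightarrow> p < inverse (1 + (if r = 1 / 2 then exp 2 else (inverse r - 1) powr (1 / (1 - 2 * r))))))"
proof -
  have p1: "p < 1" and r0: "0 < r" and d0: "d > 0" using assms by auto
  have ev: "\<P>(G in measure_pmf (random_graph n p). hom_density H G \<ge> \<tau>) = tail_prob p H \<tau> n" for n \<tau>
    using prob_density_event[OF assms(1) p1 assms(5)] by simp
  \<comment> \<open>A nonempty vertex set of positive degree forces an edge, by the handshake
    identity.\<close>
  have e: "card (edges H) > 0"
  proof -
    have "card (verts H) > 0" using assms by (simp add: finite_simple_graph_def card_gt_0_iff)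
    then have "card (verts H) * d > 0" using d0 by simp
    then show ?thesis using handshake[OF assms(5,7)] by simp
  qed
  note iff = on_convex_minorant_power_iff[OF assms(1) p1 r0 assms(3) d0]
  show ?thesis
  proof (intro conjI)
    show "on_convex_minorant (\<lambda>x. rel_entropy p (x powr (1 / real d))) (r ^ d, rel_entropy p r) \<longrightarrow>
        ((\<lambda>n. 1 / real (n choose 2) *
              ln \<P>(G in measure_pmf (random_graph n p). hom_density H G \<ge> r ^ card (edges H)))
           \<longlonglongrightarrow> - rel_entropy p r)
        \<and> (\<forall>\<epsilon>>0. \<exists>C>0. \<forall>\<^sub>F n in sequentially.
              \<P>(G in measure_pmf (random_graph n p). cut_dist_const G r < \<epsilon>
                 \<bar> hom_density H G \<ge> r ^ card (edges H))
              \<ge> 1 - exp (- C * (real n)\<^sup>2))"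
      unfolding iff ev
      by (intro impI conjI allI replica_symmetric_case[OF assms(1-5) assms(7) e])
    show "\<not> on_convex_minorant (\<lambda>x. rel_entropy p (x powr (1 / real d))) (r ^ d, rel_entropy p r) \<longrightarrow>
        (\<exists>L. ((\<lambda>n. 1 / real (n choose 2) *
              ln \<P>(G in measure_pmf (random_graph n p). hom_density H G \<ge> r ^ card (edges H)))
           \<longlonglongrightarrow> L) \<and> L > - rel_entropy p r)
        \<and> (\<exists>\<epsilon>>0. \<exists>C>0. \<forall>n.
              \<P>(G in measure_pmf (random_graph n p). hom_density H G \<ge> r ^ card (edges H)) > 0 \<longrightarrow>
              \<P>(G in measure_pmf (random_graph n p). (INF s\<in>{0..1}. cut_dist_const G s) > \<epsilon>
                 \<bar> hom_density H G \<ge> r ^ card (edges H))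
              \<ge> 1 - exp (- C * (real n)\<^sup>2))"
      using symmetry_breaking_case[OF assms(1-3) d0 assms(5) assms(7) e assms(6)]
      unfolding iff ev by blast
    show "d = 2 \<longrightarrow>
        (\<not> on_convex_minorant (\<lambda>x. rel_entropy p (x powr (1 / real d))) (r ^ d, rel_entropy p r)
         \<longleftrightarrow> p < inverse (1 + (if r = 1 / 2 then exp 2 else (inverse r - 1) powr (1 / (1 - 2 * r)))))"
      using on_convex_minorant_sqrt_iff[OF assms(1) p1 r0 assms(3)]
        logit_slope_less_iff[OF assms(1) p1 r0 assms(3)]
      by (auto simp: not_le)
  qed
qed

end
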